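(* Assume the ABC conjecture. Then there is an absolute constant $C$ such that $M_{\le\infty}(n)\le C\,\widetilde f(2|n|^{17})$ for every nonzero integer $n$. In particular, there are absolute constants $L$ and $C'$ such that $M_{\le\infty}(n)\le C'\exp\big(L(\log\log|n|)^2\big)$ for every integer $n$ with $|n|\ge2$.
   Context: ABC conjecture: for each $\epsilon>0$ there is a constant $C_\epsilon$ such that whenever $a,b,c$ are nonzero integers with $\gcd(a,b,c)=1$ and $a+b=c$, we have $\max\{|a|,|b|,|c|\}\le C_\epsilon\operatorname{rad}(abc)^{1+\epsilon}$, where $\operatorname{rad}(m)$ is the product of the distinct primes dividing $m$. $\mathbb{N}$ denotes the set of positive integers. $V_\infty=\{x^k:x,k\in\mathbb{N},\ k\ge2\}$ is the set of perfect powers. For a nonzero integer $n$, a set $A\subseteq\mathbb{N}$ has property $D_{\le\infty}(n)$ if $ab+n\in V_\infty$ for all $a,b\in A$ with $a\ne b$; $M_{\le\infty}(n)=\sup\{|A|:A\subseteq\mathbb{N}\text{ has property }D_{\le\infty}(n)\}$. For real $x\ge1$, $\widetilde f(x)=\max\{|A|:A\subseteq[1,x]\cap\mathbb{N}\text{ has property }D_{\le\infty}(n)\text{ for some integer }n\text{ with }1\le|n|\le x\}$. *)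

theory Defs
  imports
    Complex_Main
    "HOL-Library.Extended_Real"
    "HOL-Computational_Algebra.Primes"
begin

text \<open>On \<^typ>\<open>int\<close>, \<^const>\<open>prime_factors\<close> yields the set of positive primes dividing a nonzero
  argument, so the sign of \<open>m\<close> is irrelevant.\<close>

definition rad :: "int \<Rightarrow> int" where
  "rad m = \<Prod>(prime_factors m)"

definition ABC_conjecture :: bool where
  "ABC_conjecture \<longleftrightarrow>
     (\<forall>\<epsilon>::real. \<epsilon> > 0 \<longrightarrow>
       (\<exists>C::real. \<forall>a b c :: int.
          a \<noteq> 0 \<longrightarrow> b \<noteq> 0 \<longrightarrow> c \<noteq> 0 \<longrightarrow> Gcd {a, b, c} = 1 \<longrightarrow> a + b = c \<longrightarrow>
          real_of_int (Max {\<bar>a\<bar>, \<bar>b\<bar>, \<bar>c\<bar>}) \<le> C * real_of_int (rad (a * b * c)) powr (1 + \<epsilon>)))"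

definition perfect_powers :: "nat set" where
  "perfect_powers = {x ^ k | x k. x \<ge> 1 \<and> k \<ge> 2}"

text \<open>The sum \<open>ab + n\<close> is formed in the integers, as \<open>n\<close> may be negative; sums that are zero or
  negative are not perfect powers.\<close>

definition D_property :: "int \<Rightarrow> nat set \<Rightarrow> bool" where
  "D_property n A \<longleftrightarrow>
     A \<subseteq> {1..} \<and> (\<forall>a\<in>A. \<forall>b\<in>A. a \<noteq> b \<longrightarrow> int a * int b + n \<in> int ` perfect_powers)"

text \<open>\<^const>\<open>card\<close> is \<open>0\<close> on infinite sets, so the supremum below needs a cardinality
  that is infinite there.\<close>

definition ecard :: "'a set \<Rightarrow> enat" where
  "ecard A = (if finite A then enat (card A) else \<infinity>)"

definition M_inf :: "int \<Rightarrow> enat" where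
  "M_inf n = Sup {ecard A | A. D_property n A}"

text \<open>The maximum is over a finite nonempty set when \<open>x \<ge> 1\<close>, see the lemmas below.\<close>

definition f_tilde :: "real \<Rightarrow> nat" where
  "f_tilde x = Max {card A | A. A \<subseteq> {a. 1 \<le> a \<and> real a \<le> x} \<and>
     (\<exists>n::int. 1 \<le> \<bar>n\<bar> \<and> real_of_int \<bar>n\<bar> \<le> x \<and> D_property n A)}"

lemma f_tilde_candidates_finite:
  "finite {card A | A. A \<subseteq> {a. 1 \<le> a \<and> real a \<le> x} \<and>
     (\<exists>n::int. 1 \<le> \<bar>n\<bar> \<and> real_of_int \<bar>n\<bar> \<le> x \<and> D_property n A)}"
proof -
  have "{a. 1 \<le> a \<and> real a \<le> x} \<subseteq> {..nat \<lfloor>x\<rfloor>}"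
    by (auto simp: le_nat_floor)
  hence "finite {a. 1 \<le> a \<and> real a \<le> x}"
    using finite_subset by blast
  hence "finite (card ` Pow {a. 1 \<le> a \<and> real a \<le> x})"
    by simp
  thus ?thesis
    by (rule rev_finite_subset) auto
qed

lemma f_tilde_candidates_nonempty:
  assumes "x \<ge> 1"
  shows "{card A | A. A \<subseteq> {a. 1 \<le> a \<and> real a \<le> x} \<and>
     (\<exists>n::int. 1 \<le> \<bar>n\<bar> \<and> real_of_int \<bar>n\<bar> \<le> x \<and> D_property n A)} \<noteq> {}"
proof -
  have "\<exists>n::int. 1 \<le> \<bar>n\<bar> \<and> real_of_int \<bar>n\<bar> \<le> x \<and> D_property n {}"
    using assms by (intro exI[of _ 1]) (auto simp: D_property_def)
  thus ?thesis by blast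
qed

end

theory Submission
  imports
    Defs
    "HOL-Analysis.Generalised_Binomial_Theorem"
    "HOL-Computational_Algebra.Polynomial_FPS"
    "HOL-Library.FuncSet"
    "HOL-Number_Theory.Cong"
begin

unbundle no vec_syntax
unbundle fps_syntax

text \<open>
  Elements of size at most \<open>2|n|^17\<close> are counted by \<open>f\<close>; under ABC only boundedly many are larger.
  Indeed, if three elements satisfy \<open>a < b\<close> and \<open>c \<ge> b^100\<close>, then ABC applied to
  \<open>b(ac+n) - a(bc+n) = n(b-a)\<close> forces \<open>ac+n\<close> and \<open>bc+n\<close> to be squares, and simultaneous Pade approximation
  of \<open>sqrt(1+n/(ac))\<close> and \<open>sqrt(1+n/(bc))\<close> (Rickert, Bennett) excludes \<open>a < b\<close>, \<open>c \<ge> b^100\<close>, \<open>d \<ge> c^100\<close>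
  with all products that involve \<open>c\<close> or \<open>d\<close> giving squares. The large elements therefore lie in boundedly many windows
  \<open>[H, H^(21/20)]\<close>. In such a window, a \<open>3 \<times> 3\<close> grid of products on which all exponents are
  even, all are divisible by 3, or all are at least 5 cannot exist: for the last two this is the identity
  \<open>(ac+n)(bd+n) - (ad+n)(bc+n) = n(a-b)(c-d)\<close> (with ABC for exponents at least 5), and for squares the
  determinant of the nine roots is a nonzero integer of absolute value less than 1.

  For the explicit bound, let \<open>x\<close> be the range of the elements and \<open>n\<close>. There are \<open>O(log x)\<close> possible exponents, so
  pigeonholing yields \<open>s = O(log log x)\<close> elements \<open>a\<^sub>i\<close> and many \<open>c\<close> for which all
  \<open>a\<^sub>i c + n = z\<^sub>i^k\<close> share the exponent \<open>k\<close>, and for which the \<open>z\<^sub>i\<close> and \<open>c\<close> lie in fixed nonzero classes modulo a prime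
  \<open>p\<close> of size a power of \<open>log x\<close>. On this class the \<open>z\<^sub>i\<close> are \<open>p\<close>-adically polynomials in \<open>c\<close> (Hensel), so an integer
  combination with small coefficients of the \<open>k^s\<close> monomials in the \<open>z\<^sub>i\<close> is divisible by a high power of
  \<open>p\<close>, hence vanishes. These monomials are linearly independent over the polynomials in \<open>c\<close>, so a
  combination of them has at most \<open>s k^s\<close> zeros.
\<close>

section \<open>Residues of rational functions with prescribed poles\<close>

text \<open>The exponents split at 5 because of a balance. In a window around \<open>exp h\<close>
  both terms of the rectangle identity have size \<open>exp (4 h)\<close>, and ABC bounds this by
  the four roots times a difference of size about \<open>exp (2 h)\<close>. Roots of fifth powers
  weigh \<open>8/5 h\<close>, which gives \<open>3.6 h\<close>; exponent 4 would give exactly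
  \<open>4 h\<close>. So fourth powers must count as squares, and squares and cubes need arguments
  without ABC. For squares a 2 by 2 minor may be as large as about \<open>|n|\<close>, which
  contradicts nothing; one more row and column turns the loss into a gain. The sparse triple
  identity balances in \<open>c\<close> in the same way when both values are squares, which is the
  case left to Pade approximation.

  In the polynomial range the \<open>k^s\<close> monomials must outnumber the bits of their values,
  about \<open>s log x\<close>. As \<open>k\<close> may be 2, this fixes \<open>s\<close> at the
  order of \<open>log log x\<close>. A class is described by \<open>s\<close> indices and
  \<open>s\<close> residues, each bounded by a power of \<open>log x\<close>, and
  \<open>(log x)^O(s)\<close> classes are the source of
  \<open>exp (O((log log x)^2))\<close>.\<close>

definition shift :: "real \<Rightarrow> real poly \<Rightarrow> real fps" where
  "shift t N = fps_of_poly (pcompose N [:t, 1:])"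

definition cofac :: "real set \<Rightarrow> (real \<Rightarrow> nat) \<Rightarrow> real \<Rightarrow> real fps" where
  "cofac J \<kappa> t = (\<Prod>s\<in>J-{t}. inverse (fps_const (t - s) + fps_X) ^ \<kappa> s)"

text \<open>The residue at \<open>t\<close> of \<open>N\<close> divided by the product of all
  \<open>(X - s) ^ \<kappa> s\<close>: \<open>shift\<close> expands \<open>N\<close> at
  \<open>t\<close>, and \<open>cofac\<close> expands the inverse factors of the other poles. Without
  a pole the index \<open>\<kappa> t - 1\<close> would truncate to 0, hence the case
  distinction.\<close>

definition res :: "real set \<Rightarrow> (real \<Rightarrow> nat) \<Rightarrow> real \<Rightarrow> real poly \<Rightarrow> real" where
  "res J \<kappa> t N = (if \<kappa> t = 0 then 0 else (shift t N * cofac J \<kappa> t) $ (\<kappa> t - 1))"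

lemma shift_mult: "shift t (M * N) = shift t M * shift t N"
  by (simp add: shift_def pcompose_mult fps_of_poly_mult)

lemma shift_add: "shift t (M + N) = shift t M + shift t N"
  by (simp add: shift_def pcompose_add fps_of_poly_add)

lemma shift_smult: "shift t (smult c N) = fps_const c * shift t N"
  by (simp add: shift_def pcompose_smult fps_of_poly_smult)

lemma shift_linear: "shift t [:c, 1:] = fps_const (t + c) + fps_X"
  by (simp add: shift_def pcompose_pCons fps_of_poly_pCons algebra_simps flip: fps_const_add)

lemma shift_const: "shift t [:c:] = fps_const c"
  by (simp add: shift_def fps_of_poly_const pcompose_pCons)

lemma linear_inverse: "d \<noteq> 0 \<Longrightarrow> (fps_const d + fps_X) * inverse (fps_const (d::real) + fps_X) = 1"
  by (rule inverse_mult_eq_1') simp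

text \<open>Cancelling the common factor \<open>X - s\<close> does not change the rational
  function.\<close>

lemma res_mult_linear:
  assumes "finite J" "s \<in> J" "t \<in> J" "\<kappa> s = Suc m"
  shows "res J \<kappa> t ([:-s, 1:] * N) = res J (\<kappa>(s := m)) t N"
proof (cases "t = s")
  case True
  have "cofac J (\<kappa>(s := m)) s = cofac J \<kappa> s"
    by (auto simp: cofac_def intro!: prod.cong)
  moreover have "(fps_X * f) $ m = (if m = 0 then 0 else f $ (m - 1))" for f :: "real fps"
    by simp
  ultimately show ?thesis using assms True
    by (simp add: res_def shift_mult shift_linear mult.assoc del: mult_pCons_left)
next
  case False
  let ?f = "\<lambda>\<kappa> u. inverse (fps_const (t - u) + fps_X) ^ \<kappa> u :: real fps"
  have split: "cofac J \<mu> t = ?f \<mu> s * prod (?f \<mu>) (J - {t} - {s})" for \<mu>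
    unfolding cofac_def using assms False by (subst prod.remove[of _ s]) auto
  have "prod (?f (\<kappa>(s := m))) (J - {t} - {s}) = prod (?f \<kappa>) (J - {t} - {s})"
    by (intro prod.cong) auto
  moreover have "(fps_const (t - s) + fps_X) * ?f \<kappa> s = ?f (\<kappa>(s := m)) s"
    using linear_inverse[of "t - s"] False assms(4) by (simp add: mult.assoc[symmetric])
  ultimately have "shift t ([:-s, 1:] * N) * cofac J \<kappa> t = shift t N * cofac J (\<kappa>(s := m)) t"
    unfolding split shift_mult shift_linear by (simp add: mult_ac)
  thus ?thesis using False by (simp add: res_def)
qed

lemma res_add: "res J \<kappa> t (M + N) = res J \<kappa> t M + res J \<kappa> t N"
  by (simp add: res_def shift_add distrib_right)

lemma res_smult: "res J \<kappa> t (smult c N) = c * res J \<kappa> t N"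
  by (simp add: res_def shift_smult mult.assoc)

lemma res_diff: "res J \<kappa> t (M - N) = res J \<kappa> t M - res J \<kappa> t N"
  using res_add[of J \<kappa> t M "smult (-1) N"] res_smult[of J \<kappa> t "-1" N] by simp

text \<open>Induction on the total pole order: \<open>1\<close> is a multiple of
  \<open>(X - s2) - (X - s1)\<close>, which splits the fraction into two whose order is lower by
  one. In order 2 these are simple poles with residue 1 each, which cancel; a single pole of order
  at least 2 has no residue.\<close>

lemma sum_res_one:
  assumes "finite J" "sum \<kappa> J \<ge> 2"
  shows "(\<Sum>t\<in>J. res J \<kappa> t 1) = 0"
  using assms(2)
proof (induction "sum \<kappa> J" arbitrary: \<kappa> rule: less_induct)
  case less
  show ?case
  proof (cases "\<exists>s1\<in>J. \<exists>s2\<in>J. s1 \<noteq> s2 \<and> \<kappa> s1 > 0 \<and> \<kappa> s2 > 0")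
    case True
    then obtain s1 s2 m1 m2 where s: "s1 \<in> J" "s2 \<in> J" "s1 \<noteq> s2" "\<kappa> s1 = Suc m1" "\<kappa> s2 = Suc m2"
      by (metis gr0_implies_Suc)
    have sumeq: "sum (\<kappa>(s := m)) J + 1 = sum \<kappa> J" if "s \<in> J" "\<kappa> s = Suc m" for s m
    proof -
      have "sum (\<kappa>(s := m)) (J - {s}) = sum \<kappa> (J - {s})" by (intro sum.cong) auto
      thus ?thesis using that assms(1) by (simp add: sum.remove)
    qed
    have one: "1 = smult (1 / (s1 - s2)) ([:-s2, 1:] * 1 - [:-s1, 1:] * 1)"
      using s(3) by (simp add: one_pCons field_simps)
    have "res J \<kappa> t 1 = (res J (\<kappa>(s2 := m2)) t 1 - res J (\<kappa>(s1 := m1)) t 1) / (s1 - s2)" if "t \<in> J" for t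
      using that s assms(1)
      by (subst one) (simp add: res_smult res_diff res_mult_linear del: mult_pCons_left mult_1_right smult_pCons)
    hence eq: "(\<Sum>t\<in>J. res J \<kappa> t 1)
        = ((\<Sum>t\<in>J. res J (\<kappa>(s2 := m2)) t 1) - (\<Sum>t\<in>J. res J (\<kappa>(s1 := m1)) t 1)) / (s1 - s2)"
      by (simp add: sum_divide_distrib[symmetric] sum_subtractf)
    show ?thesis
    proof (cases "sum \<kappa> J = 2")
      case False
      thus ?thesis using eq less.hyps[of "\<kappa>(s1 := m1)"] less.hyps[of "\<kappa>(s2 := m2)"]
        sumeq[OF s(1,4)] sumeq[OF s(2,5)] less.prems by simp
    next
      case two: True
      have single: "(\<Sum>t\<in>J. res J \<mu> t 1) = 1" if "s \<in> J" "\<mu> s = 1" "\<And>t. t \<in> J - {s} \<Longrightarrow> \<mu> t = 0" for \<mu> s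
      proof -
        have "(\<Sum>t\<in>J. res J \<mu> t 1) = res J \<mu> s 1 + (\<Sum>t\<in>J - {s}. res J \<mu> t 1)"
          using that(1) assms(1) by (simp add: sum.remove)
        also have "(\<Sum>t\<in>J - {s}. res J \<mu> t 1) = 0"
          using that(3) by (intro sum.neutral) (auto simp: res_def)
        also have "res J \<mu> s 1 = 1"
          using that by (simp add: res_def cofac_def shift_const one_pCons)
        finally show ?thesis by simp
      qed
      have *: "sum \<kappa> J = \<kappa> s1 + (\<kappa> s2 + sum \<kappa> (J - {s1} - {s2}))"
        using s assms(1) sum.remove[of J s1 \<kappa>] sum.remove[of "J - {s1}" s2 \<kappa>] by simp
      have m: "m1 = 0" "m2 = 0" "\<And>t. t \<in> J - {s1,s2} \<Longrightarrow> \<kappa> t = 0" using * two s assms(1) by auto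
      have "(\<Sum>t\<in>J. res J (\<kappa>(s2 := m2)) t 1) = 1" "(\<Sum>t\<in>J. res J (\<kappa>(s1 := m1)) t 1) = 1"
        using single[of s1 "\<kappa>(s2 := m2)"] single[of s2 "\<kappa>(s1 := m1)"] s m by auto
      thus ?thesis using eq by simp
    qed
  next
    case False
    show ?thesis
    proof (rule sum.neutral, rule ballI, rule ccontr)
      fix t assume t: "t \<in> J" "res J \<kappa> t 1 \<noteq> 0"
      hence kt: "\<kappa> t > 0" by (cases "\<kappa> t = 0") (simp_all add: res_def)
      hence z: "\<kappa> s = 0" if "s \<in> J - {t}" for s using False t(1) kt that by (metis DiffE singletonI gr0I)
      hence "sum \<kappa> J = \<kappa> t" using t assms(1) by (simp add: sum.remove)
      hence "\<kappa> t \<ge> 2" using less.prems by simp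
      moreover have "cofac J \<kappa> t = 1" using z by (simp add: cofac_def)
      ultimately have "res J \<kappa> t 1 = 0" by (simp add: res_def one_pCons shift_const)
      thus False using t by simp
    qed
  qed
qed

text \<open>The fraction decays at least like \<open>1 / X^2\<close>, so there is no residue at
  infinity. Division of \<open>N\<close> by \<open>X - s\<close> reduces this to constant
  numerators.\<close>

lemma sum_res_eq_0:
  assumes "finite J" "degree N + 2 \<le> sum \<kappa> J"
  shows "(\<Sum>t\<in>J. res J \<kappa> t N) = 0"
  using assms(2)
proof (induction "degree N" arbitrary: N \<kappa>)
  case 0
  then obtain c where N: "N = smult c 1" by (metis degree_eq_zeroE smult_1_left mult.right_neutral smult_one)
  show ?case using 0 sum_res_one[OF assms(1), of \<kappa>]
    by (simp add: N res_smult sum_distrib_left[symmetric] del: smult_one)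
next
  case (Suc d)
  have "sum \<kappa> J > 0" using Suc by simp
  then obtain s where s: "s \<in> J" "\<kappa> s > 0" using assms(1) by (metis gr0I sum.neutral less_irrefl)
  then obtain m where m: "\<kappa> s = Suc m" by (metis gr0_implies_Suc)
  define N1 where "N1 = synthetic_div N s"
  have N: "N = [:-s, 1:] * N1 + smult (poly N s) 1"
    using synthetic_div_correct'[of s N] by (simp add: N1_def smult_one)
  have deg: "degree N1 = d" using Suc(2) by (simp add: N1_def degree_synthetic_div)
  have "sum (\<kappa>(s := m)) (J - {s}) = sum \<kappa> (J - {s})" by (intro sum.cong) auto
  hence "sum (\<kappa>(s := m)) J + 1 = sum \<kappa> J" using s m assms(1) by (simp add: sum.remove)
  hence "(\<Sum>t\<in>J. res J (\<kappa>(s := m)) t N1) = 0"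
    using Suc.hyps(1)[OF deg[symmetric]] Suc.prems Suc(2) deg by simp
  moreover have "(\<Sum>t\<in>J. res J \<kappa> t 1) = 0" using sum_res_one[OF assms(1)] Suc.prems by simp
  ultimately show ?case
    using assms(1) s m
    by (subst N) (simp add: res_add res_smult res_mult_linear sum.distrib sum_distrib_left[symmetric] del: mult_pCons_left smult_one)
qed

section \<open>Simultaneous Pade forms for square roots\<close>

text \<open>The Taylor series at \<open>t\<close> of the function
  \<open>(1 + z X) powr \<alpha>\<close>.\<close>

definition psi :: "real \<Rightarrow> real \<Rightarrow> real \<Rightarrow> real fps" where
  "psi \<alpha> z t = Abs_fps (\<lambda>h. (\<alpha> gchoose h) * z ^ h * (1 + z * t) powr (\<alpha> - real h))"

text \<open>With \<open>A = (\<Prod>s\<in>J. X - s)\<close>, this is the residue at \<open>t\<close> of \<open>(1 + z X)^(k + 1/2) N / A^(k + 1)\<close>; the coefficients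
  of the Pade forms are such residues.\<close>
definition rho :: "real set \<Rightarrow> nat \<Rightarrow> real \<Rightarrow> real \<Rightarrow> real poly \<Rightarrow> real" where
  "rho J k z t N = (psi (real k + 1/2) z t * shift t N * cofac J (\<lambda>_. Suc k) t) $ k"

lemma psi_deriv: "fps_deriv (psi (\<alpha> + 1) z t) = fps_const ((\<alpha> + 1) * z) * psi \<alpha> z t"
proof (rule fps_ext)
  fix n
  have "real (Suc n) * ((\<alpha> + 1) gchoose Suc n) = (\<alpha> + 1) * (\<alpha> gchoose n)"
    using gbinomial_absorption[of n "\<alpha> + 1"] by simp
  moreover have "\<alpha> + 1 - real (Suc n) = \<alpha> - real n" by simp
  moreover have "fps_deriv (psi (\<alpha> + 1) z t) $ n
     = (real (Suc n) * ((\<alpha> + 1) gchoose Suc n)) * z ^ Suc n * (1 + z * t) powr (\<alpha> + 1 - real (Suc n))"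
    by (simp add: psi_def)
  ultimately have "fps_deriv (psi (\<alpha> + 1) z t) $ n
     = ((\<alpha> + 1) * (\<alpha> gchoose n)) * z ^ Suc n * (1 + z * t) powr (\<alpha> - real n)"
    by (simp only:)
  thus "fps_deriv (psi (\<alpha> + 1) z t) $ n = (fps_const ((\<alpha> + 1) * z) * psi \<alpha> z t) $ n"
    by (simp add: psi_def)
qed

lemma psi_Suc:
  assumes "1 + z * t > 0"
  shows "psi (\<alpha> + 1) z t = (fps_const (1 + z * t) + fps_const z * fps_X) * psi \<alpha> z t"
proof (rule fps_ext)
  fix n
  let ?w = "1 + z * t"
  have w: "?w powr (x + 1) = ?w * ?w powr x" for x using assms by (simp add: powr_add)
  show "psi (\<alpha> + 1) z t $ n = ((fps_const ?w + fps_const z * fps_X) * psi \<alpha> z t) $ n"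
  proof (cases n)
    case 0
    thus ?thesis using w[of \<alpha>] by (simp add: psi_def distrib_right mult.assoc)
  next
    case (Suc m)
    define P where "P = ?w powr (\<alpha> - real (Suc m))"
    have e: "\<alpha> + 1 - real (Suc m) = \<alpha> - real m" by simp
    have P: "?w powr (\<alpha> - real m) = ?w * P"
      using w[of "\<alpha> - real (Suc m)"] by (simp add: P_def algebra_simps)
    have "psi (\<alpha> + 1) z t $ Suc m = ((\<alpha> gchoose m) + (\<alpha> gchoose Suc m)) * z ^ Suc m * (?w * P)"
      by (simp only: psi_def fps_nth_Abs_fps gbinomial_Suc_Suc e P)
    moreover have "((fps_const ?w + fps_const z * fps_X) * psi \<alpha> z t) $ Suc m
      = ?w * ((\<alpha> gchoose Suc m) * z ^ Suc m * P) + z * ((\<alpha> gchoose m) * z ^ m * (?w * P))"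
      by (simp add: psi_def distrib_right mult.assoc P P_def[symmetric] del: of_nat_Suc)
    ultimately show ?thesis unfolding Suc by (simp add: algebra_simps)
  qed
qed

lemma fps_deriv_shift: "fps_deriv (shift t N) = shift t (pderiv N)"
proof -
  have "fps_deriv (fps_of_poly p) = fps_of_poly (pderiv p)" for p :: "real poly"
    by (rule fps_ext) (simp add: coeff_pderiv)
  thus ?thesis by (simp add: shift_def pderiv_pcompose pderiv_pCons)
qed

definition nodal :: "real set \<Rightarrow> real poly" where
  "nodal J = (\<Prod>s\<in>J. [:-s, 1:])"

text \<open>With \<open>A = nodal J\<close>, the derivative of \<open>(1 + z X)^(k + 3/2) B / A^k\<close> is
  \<open>(1 + z X)^(k + 1/2) tmap B / A^(k + 1)\<close>. A derivative has no residues.\<close>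
definition tmap :: "real set \<Rightarrow> nat \<Rightarrow> real \<Rightarrow> real poly \<Rightarrow> real poly" where
  "tmap J k z B = smult ((real k + 3/2) * z) (B * nodal J)
     + (([:1, z:] * pderiv B) * nodal J - smult (real k) (B * ([:1, z:] * pderiv (nodal J))))"

definition cofac_poly :: "real set \<Rightarrow> real \<Rightarrow> real fps" where
  "cofac_poly J t = (\<Prod>s\<in>J-{t}. fps_const (t - s) + fps_X)"

lemma cofac_power: "cofac J (\<lambda>_. n) t = cofac J (\<lambda>_. 1) t ^ n"
  by (simp add: cofac_def prod_power_distrib)

lemma cofac_poly_cofac:
  assumes "finite J"
  shows "cofac_poly J t * cofac J (\<lambda>_. 1) t = 1"
proof -
  have "cofac_poly J t * cofac J (\<lambda>_. 1) t
      = (\<Prod>s\<in>J-{t}. (fps_const (t - s) + fps_X) * inverse (fps_const (t - s) + fps_X))"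
    by (simp add: cofac_poly_def cofac_def prod.distrib)
  also have "\<dots> = 1" by (intro prod.neutral ballI linear_inverse) auto
  finally show ?thesis .
qed

lemma shift_prod: "shift t (prod f J) = (\<Prod>s\<in>J. shift t (f s))"
proof (induction J rule: infinite_finite_induct)
  case (insert x F) thus ?case by (simp add: shift_mult)
qed (use shift_const[of t 1] in \<open>simp_all add: one_pCons\<close>)

lemma shift_power: "shift t (p ^ n) = shift t p ^ n"
  using shift_prod[of t "\<lambda>_. p" "{..<n}"] by simp

lemma shift_nodal:
  assumes "finite J" "t \<in> J"
  shows "shift t (nodal J) = fps_X * cofac_poly J t"
proof -
  have "nodal J = [:-t, 1:] * (\<Prod>s\<in>J-{t}. [:-s, 1:])"
    using assms by (simp add: nodal_def prod.remove[of J t] del: mult_pCons_left)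
  thus ?thesis
    by (simp add: shift_mult shift_prod shift_linear cofac_poly_def del: mult_pCons_left)
qed

lemma rho_tmap:
  assumes J: "finite J" "t \<in> J" and pos: "1 + z * t > 0"
  shows "rho J k z t (tmap J k z B) = 0"
proof -
  define C where "C = cofac_poly J t"
  define V where "V = cofac J (\<lambda>_. 1) t"
  define p1 where "p1 = psi (real k + 1/2) z t"
  define p3 where "p3 = psi (real k + 1/2 + 1) z t"
  define w where "w = fps_const (1 + z * t) + fps_const z * fps_X"
  define c where "c = fps_const ((real k + 3/2) * z)"
  define b where "b = shift t B"
  define b' where "b' = shift t (pderiv B)"
  have CV: "C * V = 1" using cofac_poly_cofac[OF J(1)] by (simp add: C_def V_def)
  have dV: "fps_deriv V = - (V * V * fps_deriv C)"
  proof -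
    have "fps_deriv C * V + C * fps_deriv V = 0"
      using arg_cong[OF CV, of fps_deriv] by (simp add: add.commute)
    hence "V * (C * fps_deriv V) = - (V * (fps_deriv C * V))"
      by (metis add.commute add_eq_0_iff mult_minus_right)
    thus ?thesis using CV by (simp add: mult_ac) (metis mult.assoc mult.commute mult_1_left)
  qed
  have dVk: "fps_deriv (V ^ k) = - (of_nat k * V ^ Suc k * fps_deriv C)"
  proof (induction k)
    case (Suc m)
    have "fps_deriv (V ^ Suc m) = fps_deriv V * V ^ m + V * fps_deriv (V ^ m)" by (simp add: add.commute)
    also have "\<dots> = - ((1 + of_nat m) * V ^ Suc (Suc m) * fps_deriv C)"
      unfolding Suc dV by (simp add: algebra_simps)
    finally show ?case by simp
  qed simp
  have p3: "p3 = w * p1" unfolding p3_def p1_def w_def by (rule psi_Suc[OF pos])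
  have dp3: "fps_deriv p3 = c * p1"
    unfolding p3_def p1_def c_def psi_deriv by (rule arg_cong[of _ _ "\<lambda>x. fps_const (x * z) * _"]) simp
  have shA: "shift t (nodal J) = fps_X * C" using shift_nodal[OF J] by (simp add: C_def)
  have shA': "shift t (pderiv (nodal J)) = C + fps_X * fps_deriv C"
    using arg_cong[OF shA, of fps_deriv] by (simp add: fps_deriv_shift)
  have shw: "shift t [:1, z:] = w"
    by (simp add: shift_def w_def pcompose_pCons fps_of_poly_pCons algebra_simps flip: fps_const_add)
  have sm: "shift t (M - N) = shift t M - shift t N" for M N
    by (simp add: shift_def pcompose_diff fps_of_poly_diff)
  have T: "shift t (tmap J k z B)
     = c * (b * (fps_X * C)) + ((w * b') * (fps_X * C) - of_nat k * (b * (w * (C + fps_X * fps_deriv C))))"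
    unfolding tmap_def shift_add sm shift_smult shift_mult shA shA' shw b_def b'_def c_def
    by (simp add: fps_of_nat)
  \<comment> \<open>\<open>G / X^k\<close> is the expansion at \<open>t\<close> of
    \<open>(1 + z X)^(k + 3/2) B / A^k\<close> with \<open>A = nodal J\<close>. Its derivative is
    \<open>(X G' - k G) / X^(k + 1)\<close>, and the coefficient of \<open>X^k\<close> in
    \<open>X G' - k G\<close> vanishes.\<close>
  define G where "G = p3 * b * V ^ k"
  have CVk: "C * V ^ Suc k = V ^ k" using CV by (simp add: mult.assoc[symmetric])
  have "p1 * shift t (tmap J k z B) * V ^ Suc k
     = p1 * (c * b * fps_X * (C * V ^ Suc k) + w * b' * fps_X * (C * V ^ Suc k)
         - of_nat k * b * w * (C * V ^ Suc k) - of_nat k * b * w * fps_X * fps_deriv C * V ^ Suc k)"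
    unfolding T by (simp add: algebra_simps del: power_Suc)
  also have "\<dots> = fps_X * fps_deriv G - of_nat k * G"
    unfolding CVk G_def fps_deriv_mult dVk dp3 unfolding p3 b_def fps_deriv_shift b'_def
    by (simp add: algebra_simps del: power_Suc)
  finally have eq: "p1 * shift t (tmap J k z B) * V ^ Suc k = fps_X * fps_deriv G - of_nat k * G" .
  have "rho J k z t (tmap J k z B) = (fps_X * fps_deriv G - of_nat k * G) $ k"
    unfolding rho_def cofac_power[of J "Suc k"] using eq by (simp add: p1_def V_def)
  also have "\<dots> = 0"
    by (cases k) (simp_all add: fps_of_nat[symmetric])
  finally show ?thesis .
qed

lemma rho_add: "rho J k z t (M + N) = rho J k z t M + rho J k z t N"
  by (simp add: rho_def shift_add algebra_simps)

lemma rho_smult: "rho J k z t (smult c N) = c * rho J k z t N"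
proof -
  have "psi (real k + 1/2) z t * (fps_const c * shift t N) * cofac J (\<lambda>_. Suc k) t
     = fps_const c * (psi (real k + 1/2) z t * shift t N * cofac J (\<lambda>_. Suc k) t)"
    by (simp add: mult_ac)
  thus ?thesis by (simp only: rho_def shift_smult fps_mult_left_const_nth)
qed

lemma coeff_mult_top:
  fixes p q :: "real poly"
  assumes "degree p \<le> a" "degree q \<le> b"
  shows "coeff (p * q) (a + b) = coeff p a * coeff q b"
proof (cases "degree p = a \<and> degree q = b")
  case True thus ?thesis using coeff_mult_degree_sum by blast
next
  case False
  hence "degree p + degree q < a + b" using assms by linarith
  hence "coeff (p * q) (a + b) = 0" using degree_mult_le[of p q] by (intro coeff_eq_0) linarith
  moreover have "coeff p a = 0 \<or> coeff q b = 0"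
    using False assms by (metis coeff_eq_0 le_neq_implies_less)
  ultimately show ?thesis by auto
qed

lemma linear_pderiv_top:
  fixes p :: "real poly"
  assumes "degree p \<le> d"
  shows "degree ([:1, z:] * pderiv p) \<le> d" "coeff ([:1, z:] * pderiv p) d = z * real d * coeff p d"
proof -
  have c: "coeff ([:1, z:] * pderiv p) i = coeff (pderiv p) i + z * real i * coeff p i" for i
    by (cases i) (simp_all add: coeff_pderiv)
  have "coeff ([:1, z:] * pderiv p) i = 0" if "i > d" for i
    unfolding c using assms that by (simp add: coeff_pderiv coeff_eq_0)
  thus "degree ([:1, z:] * pderiv p) \<le> d" by (intro degree_le) auto
  show "coeff ([:1, z:] * pderiv p) d = z * real d * coeff p d"
    unfolding c using assms by (simp add: coeff_pderiv coeff_eq_0)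
qed

lemma nodal_degree: "finite J \<Longrightarrow> degree (nodal J) = card J" 
  by (simp add: nodal_def degree_prod_eq_sum_degree)

lemma nodal_monic: "finite J \<Longrightarrow> coeff (nodal J) (card J) = 1"
  using nodal_degree[of J] lead_coeff_prod[of "\<lambda>s. [:-s, 1:] :: real poly" J] by (simp add: nodal_def)

lemma tmap_top:
  assumes "finite J" "degree B \<le> \<beta>"
  shows "degree (tmap J k z B) \<le> \<beta> + card J"
    "coeff (tmap J k z B) (\<beta> + card J) = z * (real k + 3/2 + real \<beta> - real k * real (card J)) * coeff B \<beta>"
proof -
  let ?A = "nodal J" and ?m = "card J"
  have A: "degree ?A \<le> ?m" "coeff ?A ?m = 1" using nodal_degree nodal_monic assms by auto
  note B = linear_pderiv_top[OF assms(2), of z]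
  note A' = linear_pderiv_top[OF A(1), of z]
  have "degree (B * ?A) \<le> \<beta> + ?m" "degree (([:1, z:] * pderiv B) * ?A) \<le> \<beta> + ?m"
    "degree (B * ([:1, z:] * pderiv ?A)) \<le> \<beta> + ?m"
    using degree_mult_le[of B ?A] degree_mult_le[of "[:1, z:] * pderiv B" ?A]
      degree_mult_le[of B "[:1, z:] * pderiv ?A"] A(1) A'(1) B(1) assms(2) by linarith+
  thus "degree (tmap J k z B) \<le> \<beta> + card J"
    unfolding tmap_def by (intro degree_add_le degree_diff_le) (use degree_smult_le le_trans in blast)+
  show "coeff (tmap J k z B) (\<beta> + card J) = z * (real k + 3/2 + real \<beta> - real k * real (card J)) * coeff B \<beta>"
    unfolding tmap_def coeff_add coeff_diff coeff_smult
      coeff_mult_top[OF assms(2) A(1)] coeff_mult_top[OF B(1) A(1)] coeff_mult_top[OF assms(2) A'(1)]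
    using A(2) A'(2) B(2) by (simp add: algebra_simps)
qed

text \<open>The residue functionals kill the image of \<open>tmap\<close>, which raises degrees by exactly \<open>card J\<close>: the factor
  of the leading coefficient in \<open>tmap_top\<close> is nonzero, as twice it over \<open>z\<close> is an odd integer. If all residues of
  polynomials of low degree vanished, they would thus vanish in every degree.\<close>
lemma rho_nonvanishing:
  assumes J: "finite J" and t0: "t0 \<in> J" "Y t0 \<noteq> 0" and pos: "\<And>t. t \<in> J \<Longrightarrow> 1 + z * t > 0" and z: "z \<noteq> 0"
  shows "\<exists>i<card J. (\<Sum>t\<in>J. rho J k z t (monom 1 i) * Y t) \<noteq> 0"
proof (rule ccontr)
  define \<Phi> where "\<Phi> N = (\<Sum>t\<in>J. rho J k z t N * Y t)" for N
  let ?m = "card J"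
  assume "\<not> (\<exists>i<card J. (\<Sum>t\<in>J. rho J k z t (monom 1 i) * Y t) \<noteq> 0)"
  hence mon: "\<Phi> (monom 1 i) = 0" if "i < ?m" for i using that by (auto simp: \<Phi>_def)
  have add: "\<Phi> (M + N) = \<Phi> M + \<Phi> N" for M N
    by (simp add: \<Phi>_def rho_add algebra_simps sum.distrib)
  have smult: "\<Phi> (smult c N) = c * \<Phi> N" for c N
    by (simp add: \<Phi>_def rho_smult algebra_simps sum_distrib_left)
  have tm: "\<Phi> (tmap J k z B) = 0" for B
    unfolding \<Phi>_def using rho_tmap[OF J _ pos] by (intro sum.neutral) auto
  have m: "?m > 0" using J t0(1) card_gt_0_iff by blast
  have zero: "\<Phi> N = 0" for N
  proof (induction "degree N" arbitrary: N rule: less_induct)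
    case less
    show ?case
    proof (cases "degree N < ?m")
      case True
      have "\<Phi> (\<Sum>i\<in>I. monom (coeff N i) i) = 0" if "I \<subseteq> {..degree N}" for I
      proof -
        have "finite I" using that finite_subset by blast
        thus ?thesis using that
        proof (induction I)
          case empty thus ?case using smult[of 0 0] by simp
        next
          case (insert i I)
          have "\<Phi> (monom (coeff N i) i) = 0"
            using mon[of i] insert.prems True smult[of "coeff N i" "monom 1 i"] by (simp add: smult_monom)
          thus ?case using insert add by simp
        qed
      qed
      from this[of "{..degree N}"] show ?thesis using poly_as_sum_of_monoms[of N] by simp
    next
      case False
      define \<beta> where "\<beta> = degree N - ?m"
      have \<beta>: "degree N = \<beta> + ?m" using False by (simp add: \<beta>_def)
      define T where "T = tmap J k z (monom 1 \<beta>)"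
      have T: "degree T \<le> degree N" "coeff T (degree N) = z * (real k + 3/2 + real \<beta> - real k * real ?m)"
        using tmap_top[OF J, of "monom 1 \<beta>" \<beta> k z] by (auto simp: T_def \<beta> degree_monom_le)
      have "real k + 3/2 + real \<beta> - real k * real ?m \<noteq> 0"
      proof
        assume "real k + 3/2 + real \<beta> - real k * real ?m = 0"
        hence "real_of_int (2 * int k + 3 + 2 * int \<beta> - 2 * int k * int ?m) = 0" by (simp add: field_simps)
        hence "2 * int k + 3 + 2 * int \<beta> - 2 * int k * int ?m = 0" by (simp only: of_int_eq_0_iff)
        hence "2 * (int k + 1 + int \<beta> - int k * int ?m) + 1 = 0" by (simp add: algebra_simps)
        thus False by presburger
      qed
      hence T0: "coeff T (degree N) \<noteq> 0" using T(2) z by simp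
      define N' where "N' = N + smult (- (lead_coeff N / coeff T (degree N))) T"
      have "degree N' < degree N"
      proof -
        have "degree N' \<le> degree N" unfolding N'_def
          by (intro degree_add_le order_refl) (use T(1) degree_smult_le le_trans in blast)
        moreover have "coeff N' (degree N) = 0" using T0 by (simp add: N'_def)
        moreover have "degree N > 0" using \<beta> m by simp
        ultimately show ?thesis by (metis leading_coeff_0_iff degree_0 le_neq_implies_less)
      qed
      hence "\<Phi> N' = 0" by (rule less)
      thus ?thesis unfolding N'_def add smult T_def tm by simp
    qed
  qed
  \<comment> \<open>Cancels the poles at all points of \<open>J\<close> but \<open>t0\<close> and
    leaves a simple pole there, so that only the residue at \<open>t0\<close> survives.\<close>
  define N where "N = (\<Prod>s\<in>J-{t0}. [:-s, 1:] ^ Suc k) * [:-t0, 1:] ^ k"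
  have "rho J k z t N = 0" if t: "t \<in> J - {t0}" for t
  proof -
    have "shift t N = fps_X ^ Suc k * ((\<Prod>s\<in>J-{t0}-{t}. shift t [:-s, 1:] ^ Suc k) * shift t [:-t0, 1:] ^ k)"
    proof -
      have "shift t N = (shift t [:-t, 1:] ^ Suc k * (\<Prod>s\<in>J-{t0}-{t}. shift t [:-s, 1:] ^ Suc k)) * shift t [:-t0, 1:] ^ k"
        unfolding N_def shift_mult shift_prod shift_power using t J by (subst prod.remove[of _ t]) auto
      moreover have "shift t [:-t, 1:] = fps_X" by (simp add: shift_linear)
      ultimately show ?thesis by (simp only: mult.assoc)
    qed
    hence "psi (real k + 1/2) z t * shift t N * cofac J (\<lambda>_. Suc k) t = fps_X ^ Suc k *
       (psi (real k + 1/2) z t * ((\<Prod>s\<in>J-{t0}-{t}. shift t [:-s, 1:] ^ Suc k) * shift t [:-t0, 1:] ^ k) * cofac J (\<lambda>_. Suc k) t)"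
      by (simp only: mult_ac)
    thus ?thesis unfolding rho_def by (simp only: fps_X_power_mult_nth) simp
  qed
  moreover have "rho J k z t0 N = (1 + z * t0) powr (real k + 1/2)"
  proof -
    have "shift t0 N = cofac_poly J t0 ^ Suc k * fps_X ^ k"
      by (simp add: N_def shift_mult shift_prod shift_power shift_linear cofac_poly_def prod_power_distrib del: power_Suc mult_pCons_left)
    moreover have "cofac_poly J t0 ^ Suc k * cofac J (\<lambda>_. Suc k) t0 = 1"
      unfolding cofac_power[of J "Suc k"] power_mult_distrib[symmetric] cofac_poly_cofac[OF J] by simp
    have assoc: "a * (b * x) * v = x * a * (b * v)" for a b x v :: "real fps" by (simp only: mult_ac)
    with \<open>shift t0 N = _\<close> \<open>cofac_poly J t0 ^ Suc k * _ = 1\<close> have "psi (real k + 1/2) z t0 * shift t0 N * cofac J (\<lambda>_. Suc k) t0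
        = fps_X ^ k * psi (real k + 1/2) z t0"
      using assoc[of "psi (real k + 1/2) z t0" "cofac_poly J t0 ^ Suc k" "fps_X ^ k" "cofac J (\<lambda>_. Suc k) t0"]
      by simp
    thus ?thesis unfolding rho_def by (simp only: fps_X_power_mult_nth) (simp add: psi_def)
  qed
  ultimately have "\<Phi> N = (1 + z * t0) powr (real k + 1/2) * Y t0"
    using J t0(1) by (simp add: \<Phi>_def sum.remove)
  thus False using zero[of N] t0(2) pos[OF t0(1)] by simp
qed

section \<open>Size and denominators of the forms\<close>

text \<open>A submultiplicative norm on the coefficients up to \<open>k\<close>. The radius 1/2 is
  safe because distinct poles have distance at least 1.\<close>

definition wnorm :: "nat \<Rightarrow> real fps \<Rightarrow> real" where
  "wnorm k f = (\<Sum>r\<le>k. \<bar>f $ r\<bar> * (1/2) ^ r)"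

lemma wnorm_nonneg: "wnorm k f \<ge> 0"
  by (auto simp: wnorm_def intro!: sum_nonneg)

lemma nth_le_wnorm: "\<bar>f $ k\<bar> \<le> 2 ^ k * wnorm k f"
proof -
  have "\<bar>f $ k\<bar> * (1/2) ^ k \<le> wnorm k f"
    unfolding wnorm_def by (rule member_le_sum) auto
  thus ?thesis by (simp add: field_simps power_divide)
qed

lemma wnorm_mult: "wnorm k (f * g) \<le> wnorm k f * wnorm k g"
proof -
  let ?a = "\<lambda>r. \<bar>f $ r\<bar> * (1/2) ^ r" and ?b = "\<lambda>r. \<bar>g $ r\<bar> * (1/2::real) ^ r"
  have "wnorm k (f * g) \<le> (\<Sum>r\<le>k. \<Sum>i\<le>r. ?a i * ?b (r - i))"
    unfolding wnorm_def
  proof (rule sum_mono)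
    fix r
    have "\<bar>(f * g) $ r\<bar> * (1/2) ^ r \<le> (\<Sum>i\<le>r. \<bar>f $ i * g $ (r - i)\<bar>) * (1/2) ^ r"
      unfolding fps_mult_nth atLeast0AtMost by (intro mult_right_mono sum_abs) auto
    also have "\<dots> = (\<Sum>i\<le>r. ?a i * ?b (r - i))"
      unfolding sum_distrib_right
    proof (rule sum.cong)
      fix i assume "i \<in> {..r}"
      hence "(1/2::real) ^ r = (1/2) ^ i * (1/2) ^ (r - i)" by (simp flip: power_add)
      thus "\<bar>f $ i * g $ (r - i)\<bar> * (1/2) ^ r = ?a i * ?b (r - i)" by (simp add: abs_mult mult_ac)
    qed simp
    finally show "\<bar>(f * g) $ r\<bar> * (1/2) ^ r \<le> (\<Sum>i\<le>r. ?a i * ?b (r - i))" .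
  qed
  also have "\<dots> = (\<Sum>(r, i)\<in>Sigma {..k} (\<lambda>r. {..r}). ?a i * ?b (r - i))"
    by (simp add: sum.Sigma)
  also have "\<dots> = (\<Sum>(i, j)\<in>{(i, j). i + j \<le> k}. ?a i * ?b j)"
    by (rule sum.reindex_bij_witness[of _ "\<lambda>(i, j). (i + j, i)" "\<lambda>(r, i). (i, r - i)"]) auto
  also have "\<dots> \<le> (\<Sum>(i, j)\<in>{..k} \<times> {..k}. ?a i * ?b j)"
    by (intro sum_mono2) auto
  also have "\<dots> = wnorm k f * wnorm k g"
    by (simp add: wnorm_def sum_product sum.cartesian_product)
  finally show ?thesis .
qed

lemma wnorm_one: "wnorm k 1 = 1"
proof -
  have "wnorm k 1 = (\<Sum>r\<in>{0}. \<bar>(1 :: real fps) $ r\<bar> * (1/2) ^ r)"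
    unfolding wnorm_def by (rule sum.mono_neutral_right) auto
  thus ?thesis by simp
qed

lemma wnorm_prod:
  assumes "\<And>s. s \<in> A \<Longrightarrow> wnorm k (f s) \<le> c" "c \<ge> 0"
  shows "wnorm k (prod f A) \<le> c ^ card A"
  using assms(1)
proof (induction A rule: infinite_finite_induct)
  case (insert x F)
  have "wnorm k (f x * prod f F) \<le> wnorm k (f x) * wnorm k (prod f F)" by (rule wnorm_mult)
  also have "\<dots> \<le> c * c ^ card F" by (intro mult_mono insert wnorm_nonneg assms) auto
  finally show ?case using insert by simp
qed (auto simp: wnorm_one)

lemma wnorm_power: "wnorm k f \<le> c \<Longrightarrow> c \<ge> 0 \<Longrightarrow> wnorm k (f ^ n) \<le> c ^ n"
  using wnorm_prod[of "{..<n}" k "\<lambda>_. f" c] by simp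

lemma half_geometric: "(\<Sum>r\<le>k. (1/2::real) ^ r) \<le> 2"
proof -
  have "(\<Sum>r<Suc k. (1/2::real) ^ r) = 2 * (1 - (1/2) ^ Suc k)" by (subst sum_gp_strict) simp
  also have "\<dots> \<le> 2" by simp
  finally show ?thesis by (simp add: lessThan_Suc_atMost)
qed

lemma inverse_linear_nth:
  assumes "d \<noteq> 0"
  shows "inverse (fps_const d + fps_X) $ r = (-1) ^ r / (d::real) ^ Suc r"
proof -
  have "(fps_const d + fps_X) * Abs_fps (\<lambda>r. (-1) ^ r / d ^ Suc r) = 1"
  proof (rule fps_ext)
    fix n show "((fps_const d + fps_X) * Abs_fps (\<lambda>r. (-1) ^ r / d ^ Suc r)) $ n = (1 :: real fps) $ n"
      using assms by (cases n) (simp_all add: distrib_right field_simps)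
  qed
  hence "Abs_fps (\<lambda>r. (-1) ^ r / d ^ Suc r) = inverse (fps_const d + fps_X)"
    by (metis fps_inverse_unique)
  thus ?thesis by (metis fps_nth_Abs_fps)
qed

lemma wnorm_inverse_linear:
  assumes "\<bar>d\<bar> \<ge> 1"
  shows "wnorm k (inverse (fps_const d + fps_X)) \<le> 2"
proof -
  have "wnorm k (inverse (fps_const d + fps_X)) \<le> (\<Sum>r\<le>k. (1/2) ^ r)"
    unfolding wnorm_def
  proof (rule sum_mono)
    fix r
    have "\<bar>d\<bar> ^ Suc r \<ge> 1" using assms by (rule one_le_power)
    hence "\<bar>(-1) ^ r / d ^ Suc r\<bar> \<le> 1" by (simp add: power_abs abs_mult divide_le_eq)
    moreover have "d \<noteq> 0" using assms by auto
    ultimately have "\<bar>inverse (fps_const d + fps_X) $ r\<bar> \<le> 1" by (metis inverse_linear_nth)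
    thus "\<bar>inverse (fps_const d + fps_X) $ r\<bar> * (1/2) ^ r \<le> (1/2) ^ r"
      by (intro mult_left_le_one_le) auto
  qed
  with half_geometric[of k] show ?thesis by linarith
qed

lemma wnorm_linear: "wnorm k (fps_const t + fps_X) \<le> \<bar>t\<bar> + 1"
proof -
  have "wnorm k (fps_const t + fps_X) \<le> (\<Sum>r\<in>{..k} \<inter> {0, 1}. \<bar>(fps_const t + fps_X) $ r\<bar> * (1/2) ^ r)"
    unfolding wnorm_def by (rule eq_refl, rule sum.mono_neutral_right) auto
  also have "\<dots> \<le> (\<Sum>r\<in>{0, 1}. \<bar>(fps_const t + fps_X) $ r\<bar> * (1/2) ^ r)"
    by (rule sum_mono2) auto
  also have "\<dots> \<le> \<bar>t\<bar> + 1" by simp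
  finally show ?thesis .
qed

lemma shift_monom: "shift t (monom 1 i) = (fps_const t + fps_X) ^ i"
proof -
  have "monom 1 i = ([:0, 1:] ^ i :: real poly)" by (simp add: monom_altdef)
  thus ?thesis using shift_linear[of t 0] by (simp only: shift_power add_0_right)
qed

lemma wnorm_cofac:
  assumes "finite J" "t \<in> J" "\<And>s. s \<in> J - {t} \<Longrightarrow> \<bar>t - s\<bar> \<ge> 1"
  shows "wnorm k (cofac J (\<lambda>_. e) t) \<le> (2 ^ e) ^ (card J - 1)"
proof -
  have "wnorm k (cofac J (\<lambda>_. e) t) \<le> (2 ^ e) ^ card (J - {t})"
    unfolding cofac_def using assms by (intro wnorm_prod wnorm_power wnorm_inverse_linear) auto
  thus ?thesis using assms by (simp add: card_Diff_singleton)
qed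

lemma res_monom_bound:
  assumes "finite J" "t \<in> J" "\<And>s. s \<in> J - {t} \<Longrightarrow> \<bar>t - s\<bar> \<ge> 1" "\<bar>t\<bar> \<le> b"
  shows "\<bar>res J (\<lambda>_. Suc k) t (monom 1 h)\<bar> \<le> 2 ^ k * (b + 1) ^ h * (2 ^ Suc k) ^ (card J - 1)"
proof -
  have "wnorm k (shift t (monom 1 h)) \<le> (b + 1) ^ h"
    unfolding shift_monom using wnorm_linear[of k t] assms(4) by (intro wnorm_power) auto
  hence "wnorm k (shift t (monom 1 h) * cofac J (\<lambda>_. Suc k) t) \<le> (b + 1) ^ h * (2 ^ Suc k) ^ (card J - 1)"
    using wnorm_cofac[OF assms(1-3), of k "Suc k"] assms(4)
    by (intro order.trans[OF wnorm_mult] mult_mono wnorm_nonneg) auto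
  hence "2 ^ k * wnorm k (shift t (monom 1 h) * cofac J (\<lambda>_. Suc k) t) \<le> 2 ^ k * ((b + 1) ^ h * (2 ^ Suc k) ^ (card J - 1))"
    by (rule mult_left_mono) simp
  moreover have "res J (\<lambda>_. Suc k) t (monom 1 h) = (shift t (monom 1 h) * cofac J (\<lambda>_. Suc k) t) $ k"
    by (simp add: res_def)
  ultimately show ?thesis
    using nth_le_wnorm[of "shift t (monom 1 h) * cofac J (\<lambda>_. Suc k) t" k] by (simp only: mult.assoc)
qed

text \<open>Factor by factor, \<open>|k + 1/2 - j|\<close> is at most \<open>k + 1 + j\<close>, and
  the quotients \<open>(k + 1 + j) / (j + 1)\<close> for \<open>j < h\<close> multiply to
  \<open>(k + h) choose h\<close>.\<close>

lemma half_gbinomial_bound: "\<bar>(real k + 1/2) gchoose h\<bar> \<le> 2 ^ (k + h)"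
proof -
  have "\<bar>(real k + 1/2) gchoose h\<bar> \<le> real ((k + h) choose h)"
  proof (induction h)
    case (Suc h)
    have "real (Suc h) * ((real k + 1/2) gchoose Suc h) = (real k + 1/2 - real h) * ((real k + 1/2) gchoose h)"
      using gbinomial_mult_1[of "real k + 1/2" h] by (simp only: left_diff_distrib)
    hence "real (Suc h) * \<bar>(real k + 1/2) gchoose Suc h\<bar> = \<bar>real k + 1/2 - real h\<bar> * \<bar>(real k + 1/2) gchoose h\<bar>"
      by (metis abs_mult abs_of_nat)
    also have "\<dots> \<le> real (k + Suc h) * real ((k + h) choose h)"
      by (intro mult_mono Suc) auto
    also have "\<dots> = real (Suc h * ((k + Suc h) choose Suc h))"
      unfolding of_nat_mult[symmetric] add_Suc_right Suc_times_binomial_eq by (simp only: mult.commute)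
    finally show ?case unfolding of_nat_mult by (rule mult_left_le_imp_le) simp
  qed simp
  also have "real ((k + h) choose h) \<le> real (2 ^ (k + h))"
    unfolding of_nat_le_iff by (rule binomial_le_pow2)
  finally show ?thesis by simp
qed

lemma wnorm_psi:
  assumes "\<bar>z\<bar> \<le> 1/4" "0 < 1 + z * t" "1 + z * t \<le> 2"
  shows "wnorm k (psi (real k + 1/2) z t) \<le> 4 ^ Suc k"
proof -
  have "wnorm k (psi (real k + 1/2) z t) \<le> (\<Sum>r\<le>k. 2 ^ k * 2 ^ Suc k * (1/2) ^ r)"
    unfolding wnorm_def
  proof (rule sum_mono)
    fix r assume r: "r \<in> {..k}"
    have "(1 + z * t) powr (real k + 1/2 - real r) \<le> 2 powr (real k + 1/2 - real r)"
      using assms r by (intro powr_mono2) auto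
    also have "\<dots> \<le> 2 powr real (Suc k)" by (intro powr_mono) auto
    also have "\<dots> = 2 ^ Suc k" by (rule powr_realpow) simp
    finally have w: "(1 + z * t) powr (real k + 1/2 - real r) \<le> 2 ^ Suc k" .
    have "\<bar>psi (real k + 1/2) z t $ r\<bar> = \<bar>(real k + 1/2) gchoose r\<bar> * \<bar>z\<bar> ^ r * (1 + z * t) powr (real k + 1/2 - real r)"
      by (simp add: psi_def abs_mult power_abs)
    also have "\<dots> \<le> 2 ^ (k + r) * (1/4) ^ r * 2 ^ Suc k"
      using assms(1) by (intro mult_mono half_gbinomial_bound w power_mono) auto
    also have "\<dots> = 2 ^ k * 2 ^ Suc k * (1/2) ^ r"
      by (simp add: power_add power_mult_distrib[symmetric])
    also have "\<dots> \<le> 2 ^ k * 2 ^ Suc k" by (simp add: power_le_one)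
    finally show "\<bar>psi (real k + 1/2) z t $ r\<bar> * (1/2) ^ r \<le> 2 ^ k * 2 ^ Suc k * (1/2) ^ r"
      by (intro mult_right_mono) auto
  qed
  also have "\<dots> = 2 ^ k * 2 ^ Suc k * (\<Sum>r\<le>k. (1/2) ^ r)" by (rule sum_distrib_left[symmetric])
  also have "\<dots> \<le> 2 ^ k * 2 ^ Suc k * 2" by (intro mult_left_mono half_geometric) auto
  also have "\<dots> = 4 ^ Suc k"
    by (simp add: power_mult_distrib[symmetric])
  finally show ?thesis .
qed

text \<open>Controls each coefficient separately, for use with the error terms. Only the sum over
  \<open>J\<close> is exceptionally small, see \<open>sum_rho_small\<close>.\<close>

lemma rho_bound:
  assumes "finite J" "t \<in> J" "\<And>s. s \<in> J - {t} \<Longrightarrow> \<bar>t - s\<bar> \<ge> 1" "\<bar>t\<bar> \<le> b"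
    and "\<bar>z\<bar> \<le> 1/4" "0 < 1 + z * t" "1 + z * t \<le> 2"
  shows "\<bar>rho J k z t (monom 1 i)\<bar> \<le> 2 ^ k * (4 ^ Suc k * (b + 1) ^ i * (2 ^ Suc k) ^ (card J - 1))"
proof -
  let ?f = "psi (real k + 1/2) z t * shift t (monom 1 i) * cofac J (\<lambda>_. Suc k) t"
  have s: "wnorm k (shift t (monom 1 i)) \<le> (b + 1) ^ i"
    unfolding shift_monom using wnorm_linear[of k t] assms(4) by (intro wnorm_power) auto
  have "wnorm k ?f \<le> 4 ^ Suc k * (b + 1) ^ i * (2 ^ Suc k) ^ (card J - 1)"
    using assms(4) by (intro order.trans[OF wnorm_mult] mult_mono wnorm_nonneg s wnorm_psi assms
      wnorm_cofac[OF assms(1-3), of k "Suc k"]) auto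
  with nth_le_wnorm[of ?f k] show ?thesis
    unfolding rho_def by (meson mult_left_mono order.trans zero_le_numeral zero_le_power)
qed

section \<open>Expansion of the residues in powers of \<open>z\<close>\<close>

lemma shift_monom_nth: "shift t (monom 1 h) $ r = real (h choose r) * t ^ (h - r)"
proof -
  have "shift t (monom 1 h) = fps_of_poly ([:t, 1:] ^ h)"
    by (simp add: shift_monom fps_of_poly_power fps_of_poly_pCons add.commute)
  moreover have "coeff ([:t, 1:] ^ h) r = real (h choose r) * t ^ (h - r)"
  proof (cases "r \<le> h")
    case True thus ?thesis by (simp add: coeff_linear_poly_power)
  next
    case False thus ?thesis by (simp add: coeff_eq_0 degree_linear_power binomial_eq_0)
  qed
  ultimately show ?thesis by simp
qed

text \<open>The Taylor coefficient of index \<open>r\<close> at \<open>t\<close>, taken term by term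
  in the binomial series in \<open>z X\<close>. Trinomial revision turns the terms with
  \<open>h \<ge> r\<close> into the binomial series with exponent
  \<open>\<alpha> - r\<close>.\<close>

lemma psi_nth_series:
  assumes "\<bar>z * t\<bar> < 1"
  shows "(\<lambda>h. (\<alpha> gchoose h) * z ^ h * (real (h choose r) * t ^ (h - r))) sums (psi \<alpha> z t $ r)"
proof -
  let ?f = "\<lambda>h. (\<alpha> gchoose h) * z ^ h * (real (h choose r) * t ^ (h - r))"
  have "(\<lambda>j. ((\<alpha> - real r) gchoose j) * (z * t) ^ j) sums (1 + z * t) powr (\<alpha> - real r)"
    by (rule gen_binomial_real[OF assms])
  hence "(\<lambda>j. ((\<alpha> gchoose r) * z ^ r) * (((\<alpha> - real r) gchoose j) * (z * t) ^ j)) sums (psi \<alpha> z t $ r)"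
    unfolding psi_def fps_nth_Abs_fps by (rule sums_mult)
  moreover have "((\<alpha> gchoose r) * z ^ r) * (((\<alpha> - real r) gchoose j) * (z * t) ^ j) = ?f (j + r)" for j
  proof -
    have "(\<alpha> gchoose (j + r)) * (of_nat (j + r) gchoose r) = (\<alpha> gchoose r) * (\<alpha> - of_nat r gchoose (j + r - r))"
      by (rule gbinomial_trinomial_revision) simp
    thus ?thesis by (simp add: power_add power_mult_distrib binomial_gbinomial algebra_simps)
  qed
  ultimately have "(\<lambda>j. ?f (j + r)) sums (psi \<alpha> z t $ r)" by simp
  thus ?thesis by (subst (asm) sums_zero_iff_shift) (auto simp: binomial_eq_0)
qed

text \<open>Expanding the root in powers of \<open>z\<close> reduces \<open>rho\<close> to residues
  of rational functions, which are accessible to \<open>sum_res_eq_0\<close>.\<close>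

lemma rho_series:
  assumes "\<bar>z * t\<bar> < 1"
  shows "(\<lambda>h. ((real k + 1/2) gchoose h) * z ^ h * res J (\<lambda>_. Suc k) t (monom 1 (h + i))) sums rho J k z t (monom 1 i)"
proof -
  define g where "g = shift t (monom 1 i) * cofac J (\<lambda>_. Suc k) t"
  let ?c = "\<lambda>h. ((real k + 1/2) gchoose h) * z ^ h"
  have "(\<lambda>h. \<Sum>r\<le>k. ?c h * (real (h choose r) * t ^ (h - r)) * g $ (k - r)) sums
    (\<Sum>r\<le>k. psi (real k + 1/2) z t $ r * g $ (k - r))"
    by (intro sums_sum sums_mult2 psi_nth_series assms)
  also have "(\<Sum>r\<le>k. psi (real k + 1/2) z t $ r * g $ (k - r)) = rho J k z t (monom 1 i)"
    by (simp add: rho_def g_def mult.assoc fps_mult_nth[of "psi _ _ _"] atLeast0AtMost)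
  also have "(\<lambda>h. \<Sum>r\<le>k. ?c h * (real (h choose r) * t ^ (h - r)) * g $ (k - r))
    = (\<lambda>h. ?c h * res J (\<lambda>_. Suc k) t (monom 1 (h + i)))"
  proof
    fix h
    have "monom 1 (h + i) = (monom 1 h * monom 1 i :: real poly)" by (simp add: mult_monom)
    hence "res J (\<lambda>_. Suc k) t (monom 1 (h + i)) = (shift t (monom 1 h) * g) $ k"
      by (simp add: res_def g_def shift_mult mult.assoc)
    also have "\<dots> = (\<Sum>r\<le>k. (real (h choose r) * t ^ (h - r)) * g $ (k - r))"
      by (simp add: fps_mult_nth shift_monom_nth atLeast0AtMost)
    finally show "(\<Sum>r\<le>k. ?c h * (real (h choose r) * t ^ (h - r)) * g $ (k - r))
      = ?c h * res J (\<lambda>_. Suc k) t (monom 1 (h + i))"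
      by (simp add: sum_distrib_left mult_ac)
  qed
  finally show ?thesis .
qed

text \<open>This is the Pade property. With \<open>A = nodal J\<close>, the residues of
  \<open>X^(h + i) / A^(k + 1)\<close> sum to 0 over \<open>J\<close> as long as
  \<open>h < card J * k\<close>. Hence the series in \<open>z\<close> starts at order
  \<open>card J * k\<close>, and its tail is dominated by a geometric series with ratio
  \<open>2 |z| (b + 1)\<close>.\<close>

lemma sum_rho_small:
  assumes J: "finite J" and sep: "\<And>s t. s \<in> J \<Longrightarrow> t \<in> J \<Longrightarrow> s \<noteq> t \<Longrightarrow> \<bar>t - s\<bar> \<ge> 1"
    and b: "\<And>t. t \<in> J \<Longrightarrow> \<bar>t\<bar> \<le> b" "b \<ge> 0" and z: "2 * \<bar>z\<bar> * (b + 1) \<le> 1/2" and i: "i < card J"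
  shows "\<bar>\<Sum>t\<in>J. rho J k z t (monom 1 i)\<bar>
    \<le> 2 * (real (card J) * 4 ^ k * (b + 1) ^ i * (2 ^ Suc k) ^ (card J - 1)) * (2 * \<bar>z\<bar> * (b + 1)) ^ (card J * k)"
proof -
  define q where "q = 2 * \<bar>z\<bar> * (b + 1)"
  define m where "m = card J"
  define K where "K = real m * 4 ^ k * (b + 1) ^ i * (2 ^ Suc k) ^ (m - 1)"
  define F where "F h = ((real k + 1/2) gchoose h) * z ^ h * (\<Sum>t\<in>J. res J (\<lambda>_. Suc k) t (monom 1 (h + i)))" for h
  have q: "0 \<le> q" "q \<le> 1/2" using z b(2) by (auto simp: q_def)
  have zt: "\<bar>z * t\<bar> < 1" if "t \<in> J" for t
  proof -
    have "\<bar>z * t\<bar> \<le> \<bar>z\<bar> * (b + 1)" unfolding abs_mult using b(1)[OF that] by (intro mult_left_mono) auto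
    thus ?thesis using q by (simp add: q_def)
  qed
  have "(\<lambda>h. \<Sum>t\<in>J. ((real k + 1/2) gchoose h) * z ^ h * res J (\<lambda>_. Suc k) t (monom 1 (h + i))) sums
      (\<Sum>t\<in>J. rho J k z t (monom 1 i))"
    by (intro sums_sum rho_series zt)
  hence Fs: "F sums (\<Sum>t\<in>J. rho J k z t (monom 1 i))" by (simp add: F_def[abs_def] sum_distrib_left)
  have F0: "F h = 0" if "h < m * k" for h
  proof -
    have "degree (monom (1::real) (h + i)) + 2 \<le> sum (\<lambda>_. Suc k) J"
      using that i by (simp add: degree_monom_eq m_def)
    thus ?thesis using sum_res_eq_0[OF J, of "monom 1 (h + i)" "\<lambda>_. Suc k"] by (simp add: F_def)
  qed
  have Fb: "\<bar>F h\<bar> \<le> K * q ^ h" for h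
  proof -
    have "\<bar>\<Sum>t\<in>J. res J (\<lambda>_. Suc k) t (monom 1 (h + i))\<bar> \<le> (\<Sum>t\<in>J. 2 ^ k * (b + 1) ^ (h + i) * (2 ^ Suc k) ^ (m - 1))"
      unfolding m_def by (intro order.trans[OF sum_abs] sum_mono res_monom_bound J b) (use sep in auto)
    hence r: "\<bar>\<Sum>t\<in>J. res J (\<lambda>_. Suc k) t (monom 1 (h + i))\<bar> \<le> real m * (2 ^ k * (b + 1) ^ (h + i) * (2 ^ Suc k) ^ (m - 1))"
      by (simp add: m_def)
    have "\<bar>F h\<bar> = \<bar>(real k + 1/2) gchoose h\<bar> * \<bar>z\<bar> ^ h * \<bar>\<Sum>t\<in>J. res J (\<lambda>_. Suc k) t (monom 1 (h + i))\<bar>"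
      by (simp add: F_def abs_mult power_abs)
    also have "\<dots> \<le> 2 ^ (k + h) * \<bar>z\<bar> ^ h * (real m * (2 ^ k * (b + 1) ^ (h + i) * (2 ^ Suc k) ^ (m - 1)))"
      by (intro mult_mono half_gbinomial_bound r) auto
    also have "\<dots> = (2 ^ k * 2 ^ k) * (real m * (b + 1) ^ i * (2 ^ Suc k) ^ (m - 1)) * (2 ^ h * \<bar>z\<bar> ^ h * (b + 1) ^ h)"
      by (simp only: power_add mult_ac)
    also have "\<dots> = K * q ^ h"
      unfolding K_def q_def power_mult_distrib[symmetric] by (simp add: mult_ac)
    finally show ?thesis .
  qed
  have K: "K \<ge> 0" using b(2) by (simp add: K_def)
  have "(\<lambda>h. F (h + m * k)) sums (\<Sum>t\<in>J. rho J k z t (monom 1 i))"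
    using Fs F0 by (subst sums_zero_iff_shift) auto
  moreover have gs: "(\<lambda>h. K * q ^ (m * k) * q ^ h) sums (K * q ^ (m * k) * (1 / (1 - q)))"
    using q by (intro sums_mult geometric_sums) auto
  moreover have "norm (F (h + m * k)) \<le> K * q ^ (m * k) * q ^ h" for h
    using Fb[of "h + m * k"] by (simp add: power_add mult_ac)
  ultimately have "norm (\<Sum>t\<in>J. rho J k z t (monom 1 i)) \<le> K * q ^ (m * k) * (1 / (1 - q))"
    using norm_suminf_le[of "\<lambda>h. F (h + m * k)" "\<lambda>h. K * q ^ (m * k) * q ^ h"]
    by (metis sums_iff)
  also have "\<dots> \<le> K * q ^ (m * k) * 2"
    using q K by (intro mult_left_mono) (auto simp: field_simps)
  finally show ?thesis by (simp add: K_def q_def m_def mult_ac)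
qed

section \<open>Denominators of the forms\<close>

definition scaled_int :: "real \<Rightarrow> nat \<Rightarrow> real fps \<Rightarrow> bool" where
  "scaled_int \<Delta> w f \<longleftrightarrow> (\<forall>r. \<Delta> ^ (w + r) * f $ r \<in> \<int>)"

text \<open>The weights are additive under products. The building block is the inverse of
  \<open>d + X\<close>: its coefficient at \<open>r\<close> has denominator
  \<open>d^(r + 1)\<close>, so its weight is 1 when \<open>d\<close> divides
  \<open>\<Delta>\<close>.\<close>

lemma scaled_int_mult:
  assumes "scaled_int \<Delta> w f" "scaled_int \<Delta> v g"
  shows "scaled_int \<Delta> (w + v) (f * g)"
  unfolding scaled_int_def
proof
  fix r
  have "\<Delta> ^ (w + v + r) * (f * g) $ r = (\<Sum>i\<le>r. (\<Delta> ^ (w + i) * f $ i) * (\<Delta> ^ (v + (r - i)) * g $ (r - i)))"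
    unfolding fps_mult_nth atLeast0AtMost sum_distrib_left
  proof (rule sum.cong)
    fix i assume "i \<in> {..r}"
    hence "w + v + r = (w + i) + (v + (r - i))" by simp
    hence "\<Delta> ^ (w + v + r) = \<Delta> ^ (w + i) * \<Delta> ^ (v + (r - i))" by (simp only: power_add)
    thus "\<Delta> ^ (w + v + r) * (f $ i * g $ (r - i)) = (\<Delta> ^ (w + i) * f $ i) * (\<Delta> ^ (v + (r - i)) * g $ (r - i))"
      by (simp only: mult_ac)
  qed simp
  also have "\<dots> \<in> \<int>"
    using assms unfolding scaled_int_def by (blast intro: Ints_sum Ints_mult)
  finally show "\<Delta> ^ (w + v + r) * (f * g) $ r \<in> \<int>" .
qed

lemma scaled_int_one: "\<Delta> \<in> \<int> \<Longrightarrow> scaled_int \<Delta> 0 1"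
  by (auto simp: scaled_int_def)

lemma scaled_int_prod:
  assumes "\<And>s. s \<in> A \<Longrightarrow> scaled_int \<Delta> w (f s)" "\<Delta> \<in> \<int>"
  shows "scaled_int \<Delta> (card A * w) (prod f A)"
  using assms(1)
proof (induction A rule: infinite_finite_induct)
  case (insert x F)
  hence "scaled_int \<Delta> (w + card F * w) (f x * prod f F)"
    by (intro scaled_int_mult) auto
  thus ?case using insert by simp
qed (auto simp: scaled_int_one assms(2))

lemma scaled_int_power: "scaled_int \<Delta> w f \<Longrightarrow> \<Delta> \<in> \<int> \<Longrightarrow> scaled_int \<Delta> (n * w) (f ^ n)"
  using scaled_int_prod[of "{..<n}" \<Delta> w "\<lambda>_. f"] by simp

lemma scaled_int_inverse_linear:
  assumes "d \<noteq> 0" "\<Delta> / d \<in> \<int>"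
  shows "scaled_int \<Delta> 1 (inverse (fps_const d + fps_X))"
  unfolding scaled_int_def
proof
  fix r
  have "\<Delta> ^ (1 + r) * inverse (fps_const d + fps_X) $ r = (-1) ^ r * (\<Delta> / d) ^ Suc r"
    using inverse_linear_nth[OF assms(1), of r] by (simp add: power_divide)
  also have "\<dots> \<in> \<int>" using assms(2) by (intro Ints_mult Ints_power) auto
  finally show "\<Delta> ^ (1 + r) * inverse (fps_const d + fps_X) $ r \<in> \<int>" .
qed

lemma scaled_int_cofac:
  assumes "finite J" "t \<in> J" "\<And>s. s \<in> J - {t} \<Longrightarrow> \<Delta> / (t - s) \<in> \<int>" "\<Delta> \<in> \<int>"
  shows "scaled_int \<Delta> ((card J - 1) * e) (cofac J (\<lambda>_. e) t)"
proof -
  have "scaled_int \<Delta> (card (J - {t}) * (e * 1)) (cofac J (\<lambda>_. e) t)"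
    unfolding cofac_def using assms by (intro scaled_int_prod scaled_int_power scaled_int_inverse_linear) auto
  thus ?thesis using assms by (simp add: card_Diff_singleton)
qed

lemma scaled_int_shift_monom:
  assumes "t \<in> \<int>" "\<Delta> \<in> \<int>" shows "scaled_int \<Delta> 0 (shift t (monom 1 i))"
  using assms by (auto simp: scaled_int_def shift_monom_nth)

text \<open>By Vandermonde the series of \<open>(1 + 4 X)^(k + 1/2)\<close> squares to that of
  \<open>(1 + 4 X)^(2 k + 1)\<close>, which expresses \<open>2 c h\<close> by a multiple of 4 and
  products of two earlier coefficients. Evenness is carried along because it makes these products
  multiples of 4, so that \<open>c h\<close> is an even integer again.\<close>

lemma half_gbinomial_4_power:
  "\<exists>c::int. 4 ^ h * ((real k + 1/2) gchoose h) = of_int c \<and> (h > 0 \<longrightarrow> even c)"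
proof (induction h rule: less_induct)
  case (less h)
  let ?\<alpha> = "real k + 1/2"
  define c where "c j = 4 ^ j * (?\<alpha> gchoose j)" for j
  show ?case
  proof (cases "h = 0")
    case False
    have "\<forall>j\<in>{0<..<h}. \<exists>d::int. c j = of_int (2 * d)"
      using less.IH unfolding c_def by (metis evenE greaterThanLessThan_iff)
    then obtain d where d: "\<And>j. j \<in> {0<..<h} \<Longrightarrow> c j = of_int (2 * d j)" by metis
    have "(\<Sum>j\<in>{0..h}. (?\<alpha> gchoose j) * (?\<alpha> gchoose (h - j))) = real (2 * k + 1) gchoose h"
      using gbinomial_Vandermonde[of ?\<alpha> ?\<alpha> h] by (simp add: algebra_simps)
    hence "4 ^ h * (\<Sum>j\<in>{0..h}. (?\<alpha> gchoose j) * (?\<alpha> gchoose (h - j))) = 4 ^ h * real ((2 * k + 1) choose h)"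
      by (simp only: binomial_gbinomial)
    moreover have "4 ^ h * (\<Sum>j\<in>{0..h}. (?\<alpha> gchoose j) * (?\<alpha> gchoose (h - j))) = (\<Sum>j\<in>{0..h}. c j * c (h - j))"
      unfolding sum_distrib_left
    proof (rule sum.cong)
      fix j assume "j \<in> {0..h}"
      hence "(4::real) ^ h = 4 ^ j * 4 ^ (h - j)" by (simp flip: power_add)
      thus "4 ^ h * ((?\<alpha> gchoose j) * (?\<alpha> gchoose (h - j))) = c j * c (h - j)" by (simp add: c_def)
    qed simp
    moreover have "(\<Sum>j\<in>{0..h}. c j * c (h - j)) = c 0 * c h + (c h * c 0 + (\<Sum>j\<in>{0<..<h}. c j * c (h - j)))"
    proof -
      have "{0..h} = insert 0 (insert h {0<..<h})" using False by auto
      thus ?thesis using False by simp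
    qed
    moreover have "(\<Sum>j\<in>{0<..<h}. c j * c (h - j)) = of_int (4 * (\<Sum>j\<in>{0<..<h}. d j * d (h - j)))"
      unfolding of_int_mult of_int_sum sum_distrib_left using d by (intro sum.cong) auto
    moreover have "c 0 = 1" by (simp add: c_def)
    ultimately have "2 * c h = 4 ^ h * real ((2 * k + 1) choose h) - of_int (4 * (\<Sum>j\<in>{0<..<h}. d j * d (h - j)))"
      by (simp only: mult_1 mult_1_right)
    moreover have "(4::real) ^ h = 4 * 4 ^ (h - 1)" using False by (cases h) auto
    ultimately have "c h = of_int (2 * (4 ^ (h - 1) * int ((2 * k + 1) choose h) - (\<Sum>j\<in>{0<..<h}. d j * d (h - j))))"
      by (simp del: of_nat_mult binomial_Suc_Suc of_int_sum)
    thus ?thesis unfolding c_def by (metis dvd_triv_left)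
  qed auto
qed

text \<open>The exponents \<open>k + 1/2 - r\<close> with \<open>r \<le> k\<close> leave a single
  factor \<open>sqrt (1 + z t)\<close>, so the quotient is rational. The power of \<open>4 M\<close>
  clears the binomials, \<open>z\<close> and \<open>1 + z t\<close>; the power of
  \<open>\<Delta>\<close> clears the inverse factors of the other poles.\<close>

lemma rho_rational:
  fixes n M :: real
  assumes "finite J" "t \<in> J" "\<And>s. s \<in> J - {t} \<Longrightarrow> \<Delta> / (t - s) \<in> \<int>" "\<Delta> \<in> \<int>" "t \<in> \<int>"
    and "n \<in> \<int>" "M \<in> \<int>" "M \<noteq> 0" and z: "z = n / M" "1 + z * t > 0"
  shows "(4 * M) ^ k * \<Delta> ^ ((card J - 1) * Suc k + k) * (rho J k z t (monom 1 i) / sqrt (1 + z * t)) \<in> \<int>"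
proof -
  define w where "w = 1 + z * t"
  define g where "g = shift t (monom 1 i) * cofac J (\<lambda>_. Suc k) t"
  let ?W = "(card J - 1) * Suc k"
  have "scaled_int \<Delta> (0 + ?W) g"
    unfolding g_def by (intro scaled_int_mult scaled_int_shift_monom scaled_int_cofac assms)
  hence gint: "\<Delta> ^ (?W + r) * g $ r \<in> \<int>" for r by (simp add: scaled_int_def)
  have pint: "(4 * M) ^ k * (psi (real k + 1/2) z t $ r / sqrt w) \<in> \<int>" if "r \<le> k" for r
  proof -
    have "w powr (real k + 1/2 - real r) = w powr (real (k - r) + 1/2)"
      using that by (simp add: of_nat_diff algebra_simps)
    also have "\<dots> = w ^ (k - r) * sqrt w"
      using z(2) unfolding w_def[symmetric] by (simp only: powr_add powr_realpow powr_half_sqrt less_imp_le)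
    finally have "psi (real k + 1/2) z t $ r / sqrt w = ((real k + 1/2) gchoose r) * z ^ r * w ^ (k - r)"
      using z(2) unfolding w_def[symmetric] by (simp add: psi_def w_def)
    moreover have "M ^ k = M ^ r * M ^ (k - r)" "(4::real) ^ k = 4 ^ r * 4 ^ (k - r)"
      using that by (simp_all flip: power_add)
    ultimately have "(4 * M) ^ k * (psi (real k + 1/2) z t $ r / sqrt w)
      = 4 ^ (k - r) * (4 ^ r * ((real k + 1/2) gchoose r)) * (M * z) ^ r * (M * w) ^ (k - r)"
      by (simp add: power_mult_distrib)
    also have "\<dots> \<in> \<int>"
    proof -
      obtain c :: int where "4 ^ r * ((real k + 1/2) gchoose r) = of_int c"
        using half_gbinomial_4_power by blast
      moreover have "M * z = n" "M * w = M + n * t" using assms by (simp_all add: w_def field_simps)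
      ultimately show ?thesis using assms by (auto intro!: Ints_mult Ints_power Ints_add)
    qed
    finally show ?thesis .
  qed
  have "rho J k z t (monom 1 i) = (\<Sum>r\<le>k. psi (real k + 1/2) z t $ r * g $ (k - r))"
    by (simp add: rho_def g_def mult.assoc fps_mult_nth[of "psi _ _ _"] atLeast0AtMost)
  hence "(4 * M) ^ k * \<Delta> ^ (?W + k) * (rho J k z t (monom 1 i) / sqrt w)
     = (\<Sum>r\<le>k. (4 * M) ^ k * \<Delta> ^ (?W + k) * (psi (real k + 1/2) z t $ r * g $ (k - r) / sqrt w))"
    by (simp only: sum_divide_distrib sum_distrib_left)
  also have "\<dots> = (\<Sum>r\<le>k. ((4 * M) ^ k * (psi (real k + 1/2) z t $ r / sqrt w)) * (\<Delta> ^ r * (\<Delta> ^ (?W + (k - r)) * g $ (k - r))))"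
  proof (rule sum.cong)
    fix r assume "r \<in> {..k}"
    hence "\<Delta> ^ (?W + k) = \<Delta> ^ r * \<Delta> ^ (?W + (k - r))" by (simp flip: power_add)
    thus "(4 * M) ^ k * \<Delta> ^ (?W + k) * (psi (real k + 1/2) z t $ r * g $ (k - r) / sqrt w)
      = ((4 * M) ^ k * (psi (real k + 1/2) z t $ r / sqrt w)) * (\<Delta> ^ r * (\<Delta> ^ (?W + (k - r)) * g $ (k - r)))"
      by (simp only: mult_ac times_divide_eq_right times_divide_eq_left)
  qed simp
  also have "\<dots> \<in> \<int>"
    using pint gint assms(4) by (blast intro: Ints_sum Ints_mult Ints_power)
  finally show ?thesis by (simp add: w_def)
qed

section \<open>Sparse quadruples of squares\<close>

lemma sqrt_one_plus_diff:
  assumes "\<bar>e\<bar> \<le> (1::real)" shows "\<bar>sqrt (1 + e) - 1\<bar> \<le> \<bar>e\<bar>"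
proof -
  have e: "e = (sqrt (1 + e) - 1) * (sqrt (1 + e) + 1)" using assms by (simp add: algebra_simps)
  have "\<bar>e\<bar> = \<bar>sqrt (1 + e) - 1\<bar> * (sqrt (1 + e) + 1)" using assms by (subst e) (simp add: abs_mult)
  moreover have "\<bar>sqrt (1 + e) - 1\<bar> * 1 \<le> \<bar>sqrt (1 + e) - 1\<bar> * (sqrt (1 + e) + 1)"
    using assms by (intro mult_left_mono) auto
  ultimately show ?thesis by simp
qed

text \<open>The left-hand sides are the logarithms of the two error terms in
  \<open>no_sparse_square_quadruple\<close>. With \<open>T = \<delta> / (2 \<gamma>)\<close> they
  require \<open>1.88 k \<ge> T + 1.61\<close> and \<open>1.12 k \<le> T - 1.61\<close>. The ratios
  100 give \<open>T \<ge> 50\<close>, which leaves room for an integer: \<open>k\<close> is the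
  least solution \<open>r\<close> of the first condition, rounded up.\<close>

lemma exponent_choice:
  fixes \<beta> \<gamma> \<delta> :: real
  assumes "0 < \<beta>" "100 * \<beta> \<le> \<gamma>" "100 * \<gamma> \<le> \<delta>" "1 \<le> \<gamma>"
  obtains k :: nat where "(12 * k + 11) * \<beta> + k * \<gamma> + \<gamma> / 2 + \<delta> / 2 - 3 * k * \<gamma> \<le> - \<gamma>"
    "(12 * k + 11) * \<beta> + k * \<gamma> + \<gamma> / 2 + \<delta> / 2 - \<delta> \<le> - \<gamma>"
proof -
  define T where "T = \<delta> / (2 * \<gamma>)"
  have T: "T \<ge> 50" "\<delta> = 2 * T * \<gamma>" using assms by (auto simp: T_def field_simps)
  define r where "r = (T + 1.61) / 1.88"
  define k where "k = nat \<lceil>r\<rceil>"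
  have r: "r \<ge> 0" using T by (simp add: r_def)
  have k: "r \<le> k" "k \<le> r + 1" using r unfolding k_def by linarith+
  have kb: "(12 * k + 11) * \<beta> \<le> (0.12 * k + 0.11) * \<gamma>"
  proof -
    have "(12 * k + 11) * \<beta> \<le> (12 * k + 11) * (\<gamma> / 100)" using assms by (intro mult_left_mono) auto
    thus ?thesis by (simp add: algebra_simps)
  qed
  have "1.88 * k \<ge> T + 1.61" using k(1) by (simp add: r_def field_simps)
  hence "(1.88 * k - T - 1.61) * \<gamma> \<ge> 0" using assms by (intro mult_nonneg_nonneg) auto
  hence 1: "(0.12 * k + 0.11) * \<gamma> + k * \<gamma> + \<gamma> / 2 + \<delta> / 2 - 3 * k * \<gamma> \<le> - \<gamma>"
    unfolding T(2) by (simp add: algebra_simps)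
  have "1.12 * k \<le> T - 1.61" using k(2) T(1) unfolding r_def by (simp add: field_simps)
  hence "(T - 1.61 - 1.12 * k) * \<gamma> \<ge> 0" using assms by (intro mult_nonneg_nonneg) auto
  hence 2: "(0.12 * k + 0.11) * \<gamma> + k * \<gamma> + \<gamma> / 2 + \<delta> / 2 - \<delta> \<le> - \<gamma>"
    unfolding T(2) by (simp add: algebra_simps)
  show ?thesis using that[of k] 1 2 kb by linarith
qed

lemma int_sqrt:
  fixes v m :: int
  assumes "v \<ge> 0" "v\<^sup>2 = m" shows "real_of_int v = sqrt (real_of_int m)"
  using assms by (metis of_int_0_le_iff of_int_power real_sqrt_unique)

text \<open>The integers \<open>a b w\<close>, \<open>a t y\<close>, \<open>b s x\<close> are
  proportional to \<open>1\<close>, \<open>sqrt (1 + z A)\<close>, \<open>sqrt (1 + z B)\<close> up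
  to relative errors \<open>1 / D\<close>, although their size is at most about
  \<open>B^2 sqrt (C D)\<close>. Nonvanishing Pade forms rule out such good simultaneous
  approximations.\<close>

lemma no_sparse_square_quadruple:
  fixes n a b c d s t x y w :: int
  assumes ord: "0 < a" "a < b" and n: "n \<noteq> 0" "\<bar>n\<bar> \<le> a" and b: "b \<ge> 4096"
    and cd: "b ^ 100 \<le> c" "c ^ 100 \<le> d"
    and sq: "s\<^sup>2 = a * c + n" "t\<^sup>2 = b * c + n" "x\<^sup>2 = a * d + n" "y\<^sup>2 = b * d + n" "w\<^sup>2 = c * d + n"
    and nonneg: "s \<ge> 0" "t \<ge> 0" "x \<ge> 0" "y \<ge> 0" "w \<ge> 0"
  shows False
proof -
  define A B C D N where R: "A = real_of_int a" "B = real_of_int b" "C = real_of_int c" "D = real_of_int d" "N = real_of_int n"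
  have B: "B \<ge> 4096" "0 < A" "1 \<le> A" "A + 1 \<le> B" "\<bar>N\<bar> \<le> A" "N \<noteq> 0" "N \<in> \<int>" "A \<in> \<int>" "B \<in> \<int>"
    using ord n b unfolding R by (linarith | simp)+
  have C: "B ^ 100 \<le> C" and D: "C ^ 100 \<le> D"
    using cd unfolding R by (simp_all flip: of_int_power)
  have BC: "B \<le> C" using C B power_increasing[of 1 100 B] by simp
  have CD: "C \<le> D" using D B BC power_increasing[of 1 100 C] by simp
  define \<beta> \<gamma> \<delta> where L: "\<beta> = ln B" "\<gamma> = ln C" "\<delta> = ln D"
  have "ln B \<ge> 1" using B by (subst ln_ge_iff) (auto intro: order.trans[OF exp_le])
  moreover have "100 * \<beta> \<le> \<gamma>" unfolding L using C B BC ln_le_cancel_iff[of "B ^ 100" C] by (simp add: ln_realpow)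
  moreover have "100 * \<gamma> \<le> \<delta>" unfolding L using D B BC CD ln_le_cancel_iff[of "C ^ 100" D] by (simp add: ln_realpow)
  ultimately have "0 < \<beta>" "100 * \<beta> \<le> \<gamma>" "100 * \<gamma> \<le> \<delta>" "1 \<le> \<gamma>" unfolding L by linarith+
  then obtain k :: nat where k: "(12 * k + 11) * \<beta> + k * \<gamma> + \<gamma> / 2 + \<delta> / 2 - 3 * k * \<gamma> \<le> - \<gamma>"
    "(12 * k + 11) * \<beta> + k * \<gamma> + \<gamma> / 2 + \<delta> / 2 - \<delta> \<le> - \<gamma>"
    by (rule exponent_choice)
  \<comment> \<open>For these nodes and this \<open>z\<close>, the values
    \<open>z A = N / (B C)\<close> and \<open>z B = N / (A C)\<close> belong to the squares
    \<open>b c + n\<close> and \<open>a c + n\<close>. The differences of the nodes all divide their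
    product \<open>\<Delta>\<close>, up to sign.\<close>
  define J where "J = {0, A, B}"
  define M where "M = A * B * C"
  define z where "z = N / M"
  define \<Delta> where "\<Delta> = A * B * (B - A)"
  have J: "finite J" "card J = 3" using B by (auto simp: J_def)
  have M: "M > 0" "M \<in> \<int>" using B BC by (auto simp: M_def R)
  have zC: "\<bar>z\<bar> * B * C \<le> 1"
  proof -
    have "\<bar>z\<bar> * B * C = \<bar>N\<bar> / A" using B BC by (simp add: z_def M_def abs_mult field_simps)
    thus ?thesis using B by simp
  qed
  hence zC': "\<bar>z\<bar> \<le> 1 / (B * C)" using B BC by (simp add: field_simps)
  have BC_big: "B * C \<ge> 4096 * 4096" using B BC by (intro mult_mono) auto
  have z4: "2 * \<bar>z\<bar> * (B + 1) \<le> 4 / C"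
  proof -
    have "2 * \<bar>z\<bar> * (B + 1) \<le> 2 * \<bar>z\<bar> * (2 * B)" using B by (intro mult_left_mono) auto
    also have "\<dots> = 4 * (\<bar>z\<bar> * B * C) / C" using B BC by simp
    also have "\<dots> \<le> 4 * 1 / C" using zC B BC by (intro divide_right_mono mult_left_mono) auto
    finally show ?thesis by simp
  qed
  have z_half: "2 * \<bar>z\<bar> * (B + 1) \<le> 1 / 2"
    using z4 B BC by (intro order.trans[OF z4]) (simp add: field_simps)
  have z0: "z \<noteq> 0" using B M by (simp add: z_def)
  have z_quarter: "\<bar>z\<bar> \<le> 1/4"
  proof -
    have "1 / (B * C) \<le> 1 / 4" using BC_big by (intro divide_left_mono) auto
    with zC' show ?thesis by linarith
  qed
  have Jb: "\<bar>u\<bar> \<le> B" if "u \<in> J" for u using that B by (auto simp: J_def)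
  have zu: "\<bar>z * u\<bar> \<le> 1/2" if "u \<in> J" for u
  proof -
    have "\<bar>z * u\<bar> \<le> \<bar>z\<bar> * (B + 1)" unfolding abs_mult using Jb[OF that] by (intro mult_left_mono) auto
    with z_half show ?thesis by linarith
  qed
  have pos: "0 < 1 + z * u" "1 + z * u \<le> 2" if "u \<in> J" for u using zu[OF that] by linarith+
  have Jint: "u \<in> \<int>" if "u \<in> J" for u using that B by (auto simp: J_def)
  have sep: "\<bar>u - v\<bar> \<ge> 1" if "u \<in> J" "v \<in> J" "v \<noteq> u" for u v
    using that B by (auto simp: J_def)
  have \<Delta>div: "\<Delta> / (u - v) \<in> \<int>" if "u \<in> J" "v \<in> J - {u}" for u v
  proof -
    have "\<Delta> / (A - B) = - (A * B)" "\<Delta> / (B - A) = A * B" "\<Delta> / A = B * (B - A)" "\<Delta> / B = A * (B - A)"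
      "\<Delta> / (- A) = - (B * (B - A))" "\<Delta> / (- B) = - (A * (B - A))"
      using B by (auto simp: \<Delta>_def field_simps)
    thus ?thesis using that B by (auto simp: J_def)
  qed
  have \<Delta>: "\<Delta> \<in> \<int>" "0 \<le> \<Delta>" "\<Delta> \<le> B ^ 3"
  proof -
    show "\<Delta> \<in> \<int>" "0 \<le> \<Delta>" using B by (auto simp: \<Delta>_def)
    have "A * B * (B - A) \<le> B * B * B" using B by (intro mult_mono) auto
    thus "\<Delta> \<le> B ^ 3" by (simp add: \<Delta>_def power3_eq_cube)
  qed
  \<comment> \<open>\<open>q\<close> is the common scale of the three integers \<open>Y u\<close>,
    and \<open>E u\<close> measures their deviation from \<open>q * sqrt (1 + z u)\<close>. It is at
    most \<open>1 / D\<close> because \<open>|n| \<le> a\<close>.\<close>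
  define q where "q = A * B * sqrt (C * D)"
  define E where "E u = (if u = 0 then N / (C * D) else if u = A then N / (B * D) else N / (A * D))" for u
  define Y where "Y u = (if u = 0 then a * b * w else if u = A then a * t * y else b * s * x)" for u
  have D0: "D > 0" "C > 0" using B BC CD by auto
  have Eb: "\<bar>E u\<bar> \<le> 1 / D" for u
  proof -
    have "\<bar>N\<bar> / (P * D) \<le> 1 / D" if "P \<ge> A" for P
    proof -
      have "\<bar>N\<bar> / (P * D) \<le> A / (A * D)" using that B D0 by (intro frac_le mult_right_mono) auto
      thus ?thesis using B by simp
    qed
    thus ?thesis using B BC D0 by (auto simp: E_def)
  qed
  have D1: "1 / D \<le> 1" using B BC CD by simp
  have sr: "real_of_int s = sqrt (A * C + N)" "real_of_int t = sqrt (B * C + N)"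
    "real_of_int x = sqrt (A * D + N)" "real_of_int y = sqrt (B * D + N)" "real_of_int w = sqrt (C * D + N)"
    using int_sqrt[OF nonneg(1) sq(1)] int_sqrt[OF nonneg(2) sq(2)] int_sqrt[OF nonneg(3) sq(3)]
      int_sqrt[OF nonneg(4) sq(4)] int_sqrt[OF nonneg(5) sq(5)] unfolding R by simp_all
  have fac: "sqrt (P * Q + N) = sqrt (P * Q) * sqrt (1 + N / (P * Q))" if "P > 0" "Q > 0" for P Q
    using that by (simp add: real_sqrt_mult[symmetric] algebra_simps)
  have Yq: "real_of_int (Y u) = q * sqrt (1 + z * u) * sqrt (1 + E u)" if u: "u \<in> J" for u
  proof -
    have zA: "z * A = N / (B * C)" "z * B = N / (A * C)" using B D0 by (auto simp: z_def M_def)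
    consider "u = 0" | "u = A" | "u = B" using u by (auto simp: J_def)
    thus ?thesis
    proof cases
      case 1
      thus ?thesis using B D0 fac[of C D] unfolding Y_def E_def q_def by (simp add: sr flip: R)
    next
      case 2
      have "B * (sqrt (C * D)) = sqrt (B * C) * sqrt (B * D)" using B by (simp add: real_sqrt_mult)
      thus ?thesis using 2 B D0 fac[of B C] fac[of B D] zA unfolding Y_def E_def q_def
        by (simp add: sr flip: R; simp add: mult.assoc)
    next
      case 3
      have "A * (sqrt (C * D)) = sqrt (A * C) * sqrt (A * D)" using B by (simp add: real_sqrt_mult)
      thus ?thesis using 3 B D0 fac[of A C] fac[of A D] zA unfolding Y_def E_def q_def
        by (simp add: sr flip: R; simp add: mult_ac)
    qed
  qed
  have q: "q > 0" "q \<le> B ^ 2 * sqrt (C * D)"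
  proof -
    show "q > 0" using B D0 by (simp add: q_def)
    have "A * B \<le> B * B" using B by (intro mult_right_mono) auto
    thus "q \<le> B ^ 2 * sqrt (C * D)" unfolding q_def power2_eq_square using D0 by (simp add: mult_right_mono)
  qed
  have Y0: "real_of_int (Y 0) / sqrt (1 + z * 0) \<noteq> 0"
  proof -
    have "1 / D < 1" using B BC CD by simp
    hence "1 + E 0 > 0" using Eb[of 0] by linarith
    thus ?thesis using Yq[of 0] q by (simp add: J_def)
  qed
  \<comment> \<open>One of the three forms, with numerators \<open>1\<close>, \<open>X\<close> and
    \<open>X^2\<close>, does not vanish at the given vector. Dividing by
    \<open>sqrt (1 + z u)\<close> makes the coefficients of \<open>Y u\<close> rational by
    \<open>rho_rational\<close>.\<close>
  obtain i where i: "i < card J" "(\<Sum>u\<in>J. rho J k z u (monom 1 i) * (Y u / sqrt (1 + z * u))) \<noteq> 0"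
    using rho_nonvanishing[where J = J and k = k and z = z and Y = "\<lambda>u. Y u / sqrt (1 + z * u)" and ?t0.0 = 0] J pos z0 Y0
    by (auto simp: J_def)
  define P where "P u = rho J k z u (monom 1 i)" for u
  define \<Lambda> where "\<Lambda> = (\<Sum>u\<in>J. P u * (Y u / sqrt (1 + z * u)))"
  define Den where "Den = (4 * M) ^ k * \<Delta> ^ (2 * Suc k + k)"
  have Den: "Den > 0" using M B by (simp add: Den_def \<Delta>_def)
  have "Den * \<Lambda> \<in> \<int>"
  proof -
    have "Den * \<Lambda> = (\<Sum>u\<in>J. (Den * (P u / sqrt (1 + z * u))) * Y u)"
      unfolding \<Lambda>_def sum_distrib_left by (intro sum.cong) auto
    also have "\<dots> \<in> \<int>"
    proof (rule Ints_sum)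
      fix u assume u: "u \<in> J"
      have "Den * (P u / sqrt (1 + z * u)) \<in> \<int>"
        using rho_rational[of J u \<Delta> N M z k i] J u \<Delta>div \<Delta> Jint B M pos
        by (simp add: Den_def P_def z_def numeral_2_eq_2)
      thus "Den * (P u / sqrt (1 + z * u)) * real_of_int (Y u) \<in> \<int>" by (intro Ints_mult[OF _ Ints_of_int])
    qed
    finally show ?thesis .
  qed
  moreover have "Den * \<Lambda> \<noteq> 0" using Den i(2) by (simp add: \<Lambda>_def P_def)
  ultimately have ge1: "1 \<le> Den * \<bar>\<Lambda>\<bar>"
    using Ints_nonzero_abs_ge1[of "Den * \<Lambda>"] Den by (simp add: abs_mult)
  \<comment> \<open>The first sum is small by the Pade property, the second because of the factors
    \<open>sqrt (1 + E u) - 1\<close>.\<close>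
  have \<Lambda>: "\<Lambda> = q * ((\<Sum>u\<in>J. P u) + (\<Sum>u\<in>J. P u * (sqrt (1 + E u) - 1)))"
  proof -
    have "\<Lambda> = (\<Sum>u\<in>J. q * (P u * sqrt (1 + E u)))"
      unfolding \<Lambda>_def
    proof (rule sum.cong)
      fix u assume u: "u \<in> J"
      have "sqrt (1 + z * u) \<noteq> 0" using pos(1)[OF u] by simp
      thus "P u * (Y u / sqrt (1 + z * u)) = q * (P u * sqrt (1 + E u))"
        unfolding Yq[OF u] by simp
    qed simp
    also have "\<dots> = q * ((\<Sum>u\<in>J. P u) + (\<Sum>u\<in>J. P u * (sqrt (1 + E u) - 1)))"
      by (simp add: sum_distrib_left[symmetric] sum.distrib[symmetric] algebra_simps)
    finally show ?thesis .
  qed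
  have B1: "(B + 1) ^ i \<le> 4 * B ^ 2"
  proof -
    have "(B + 1) ^ i \<le> (B + 1) ^ 2" using i(1) J(2) B by (intro power_increasing) auto
    also have "\<dots> \<le> (2 * B) ^ 2" using B by (intro power_mono) auto
    finally show ?thesis by (simp add: power_mult_distrib)
  qed
  have "\<bar>\<Sum>u\<in>J. P u\<bar> \<le> 2 * (real (card J) * 4 ^ k * (B + 1) ^ i * (2 ^ Suc k) ^ (card J - 1)) * (2 * \<bar>z\<bar> * (B + 1)) ^ (card J * k)"
    unfolding P_def using sep by (intro sum_rho_small J Jb z_half i) (use B in auto)
  also have "\<dots> \<le> 2 * (3 * 4 ^ k * (4 * B ^ 2) * (2 ^ Suc k) ^ 2) * (4 / C) ^ (3 * k)"
    unfolding J(2) using B1 z4 B by (intro mult_mono power_mono) auto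
  also have "\<dots> = 96 * B ^ 2 * (4 ^ k * 4 ^ k * 64 ^ k) / C ^ (3 * k)"
  proof -
    have "((2::real) ^ Suc k) ^ 2 = 4 * 4 ^ k" "(4::real) ^ (3 * k) = 64 ^ k"
      by (simp_all add: power2_eq_square power_mult flip: power_mult_distrib)
    thus ?thesis by (simp add: power_divide)
  qed
  finally have S1: "\<bar>\<Sum>u\<in>J. P u\<bar> \<le> 96 * B ^ 2 * (4 ^ k * 4 ^ k * 64 ^ k) / C ^ (3 * k)" .
  have Pb: "\<bar>P u\<bar> \<le> 64 * B ^ 2 * 32 ^ k" if u: "u \<in> J" for u
  proof -
    have "\<bar>P u\<bar> \<le> 2 ^ k * (4 ^ Suc k * (B + 1) ^ i * (2 ^ Suc k) ^ (card J - 1))"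
      unfolding P_def using sep u by (intro rho_bound J Jb z_quarter pos) auto
    also have "\<dots> \<le> 2 ^ k * (4 ^ Suc k * (4 * B ^ 2) * (2 ^ Suc k) ^ 2)"
      unfolding J(2) using B1 B by (intro mult_mono) auto
    also have "\<dots> = 64 * B ^ 2 * (2 ^ k * 4 ^ k * 4 ^ k)"
    proof -
      have "((2::real) ^ Suc k) ^ 2 = 4 * 4 ^ k"
        by (simp add: power2_eq_square flip: power_mult_distrib)
      thus ?thesis by simp
    qed
    also have "(2::real) ^ k * 4 ^ k * 4 ^ k = 32 ^ k" by (simp flip: power_mult_distrib)
    finally show ?thesis .
  qed
  have "\<bar>\<Sum>u\<in>J. P u * (sqrt (1 + E u) - 1)\<bar> \<le> (\<Sum>u\<in>J. (64 * B ^ 2 * 32 ^ k) * (1 / D))"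
  proof (intro order.trans[OF sum_abs] sum_mono)
    fix u assume u: "u \<in> J"
    have "\<bar>sqrt (1 + E u) - 1\<bar> \<le> 1 / D" using sqrt_one_plus_diff[of "E u"] Eb[of u] D1 by linarith
    thus "\<bar>P u * (sqrt (1 + E u) - 1)\<bar> \<le> (64 * B ^ 2 * 32 ^ k) * (1 / D)"
      unfolding abs_mult by (intro mult_mono Pb u) auto
  qed
  also have "\<dots> = 192 * B ^ 2 * 32 ^ k / D" by (simp add: J)
  finally have S2: "\<bar>\<Sum>u\<in>J. P u * (sqrt (1 + E u) - 1)\<bar> \<le> 192 * B ^ 2 * 32 ^ k / D" .
  have tot: "\<bar>\<Lambda>\<bar> \<le> q * (192 * B ^ 2 * 1024 ^ k * (1 / C ^ (3 * k) + 1 / D))"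
  proof -
    have "96 * B ^ 2 * (4 ^ k * 4 ^ k * 64 ^ k) / C ^ (3 * k) \<le> 192 * B ^ 2 * 1024 ^ k * (1 / C ^ (3 * k))"
      using B D0 by (simp add: power_mult_distrib[symmetric] divide_right_mono)
    moreover have "192 * B ^ 2 * 32 ^ k / D \<le> 192 * B ^ 2 * 1024 ^ k * (1 / D)"
      using B D0 power_mono[of "32::real" 1024 k] by (simp add: divide_right_mono mult_left_mono)
    ultimately have "\<bar>(\<Sum>u\<in>J. P u) + (\<Sum>u\<in>J. P u * (sqrt (1 + E u) - 1))\<bar>
       \<le> 192 * B ^ 2 * 1024 ^ k * (1 / C ^ (3 * k)) + 192 * B ^ 2 * 1024 ^ k * (1 / D)"
      using S1 S2 by linarith
    also have "\<dots> = 192 * B ^ 2 * 1024 ^ k * (1 / C ^ (3 * k) + 1 / D)" by (simp add: distrib_left)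
    finally show ?thesis unfolding \<Lambda> using q by (simp add: abs_mult)
  qed
  have DenB: "Den \<le> (4 * B ^ 2 * C) ^ k * (B ^ 3) ^ (2 * Suc k + k)"
  proof -
    have "A * B \<le> B * B" using B by (intro mult_right_mono) auto
    hence "4 * M \<le> 4 * B ^ 2 * C" using D0 mult_right_mono[of "A * B" "B * B" C] by (simp add: M_def power2_eq_square)
    hence "(4 * M) ^ k \<le> (4 * B ^ 2 * C) ^ k" using M by (intro power_mono) auto
    moreover have "\<Delta> ^ (2 * Suc k + k) \<le> (B ^ 3) ^ (2 * Suc k + k)" by (intro power_mono \<Delta>)
    moreover have "(4 * B ^ 2 * C) ^ k \<ge> 0" "\<Delta> ^ (2 * Suc k + k) \<ge> 0" using B D0 \<Delta> by auto
    ultimately show ?thesis unfolding Den_def by (rule mult_mono)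
  qed
  have "1 \<le> Den * \<bar>\<Lambda>\<bar>" by (rule ge1)
  also have "\<dots> \<le> ((4 * B ^ 2 * C) ^ k * (B ^ 3) ^ (2 * Suc k + k)) * ((B ^ 2 * sqrt (C * D)) * (192 * B ^ 2 * 1024 ^ k * (1 / C ^ (3 * k) + 1 / D)))"
    using DenB tot q B D0 Den by (intro mult_mono order.trans[OF tot] mult_right_mono) auto
  also have "\<dots> = (192 * 4096 ^ k) * B ^ (11 * k + 10) * C ^ k * sqrt (C * D) * (1 / C ^ (3 * k) + 1 / D)"
  proof -
    have "(4 * B ^ 2 * C) ^ k = 4 ^ k * B ^ (2 * k) * C ^ k" by (simp add: power_mult_distrib power_mult)
    moreover have "(B ^ 3) ^ (2 * Suc k + k) = B ^ (9 * k + 6)" 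
    proof -
      have "3 * (2 * Suc k + k) = 9 * k + 6" by simp
      thus ?thesis by (simp only: power_mult[symmetric])
    qed
    moreover have "(4096::real) ^ k = 4 ^ k * 1024 ^ k" by (simp flip: power_mult_distrib)
    moreover have "B ^ (11 * k + 10) = B ^ (2 * k) * B ^ (9 * k + 6) * B ^ 2 * B ^ 2"
    proof -
      have e: "11 * k + 10 = 2 * k + (9 * k + 6) + 2 + 2" by simp
      show ?thesis by (subst e) (simp only: power_add)
    qed
    ultimately show ?thesis by (simp only: mult_ac)
  qed
  \<comment> \<open>The bound \<open>B \<ge> 4096\<close> absorbs \<open>192 * 4096^k\<close> into
    \<open>B^(k + 1)\<close>.\<close>
  also have "\<dots> \<le> B ^ Suc k * B ^ (11 * k + 10) * C ^ k * sqrt (C * D) * (1 / C ^ (3 * k) + 1 / D)"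
  proof -
    have "192 * 4096 ^ k \<le> B * B ^ k" using B by (intro mult_mono power_mono) auto
    thus ?thesis using B D0 by (intro mult_right_mono) auto
  qed
  also have "\<dots> = B ^ (12 * k + 11) * C ^ k * sqrt (C * D) * (1 / C ^ (3 * k)) + B ^ (12 * k + 11) * C ^ k * sqrt (C * D) * (1 / D)"
  proof -
    have "B ^ Suc k * B ^ (11 * k + 10) = B ^ (12 * k + 11)"
    proof -
      have e: "12 * k + 11 = Suc k + (11 * k + 10)" by simp
      show ?thesis by (subst e) (simp only: power_add)
    qed
    thus ?thesis by (simp only: distrib_left)
  qed
  also have "\<dots> = exp ((12 * k + 11) * \<beta> + k * \<gamma> + \<gamma> / 2 + \<delta> / 2 - 3 * k * \<gamma>) + exp ((12 * k + 11) * \<beta> + k * \<gamma> + \<gamma> / 2 + \<delta> / 2 - \<delta>)"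
  proof -
    have pw: "X ^ e = exp (real e * ln X)" if "X > 0" for X :: real and e
      using that by (simp add: exp_of_nat_mult)
    have sq: "sqrt (C * D) = exp (\<gamma> / 2 + \<delta> / 2)"
    proof -
      have "exp (\<gamma> / 2 + \<delta> / 2) ^ 2 = exp (2 * (\<gamma> / 2 + \<delta> / 2))" by (rule exp_double[symmetric])
      also have "\<dots> = C * D" using D0 by (simp add: L exp_add)
      finally have "exp (\<gamma> / 2 + \<delta> / 2) ^ 2 = C * D" .
      thus ?thesis by (metis abs_exp_cancel real_sqrt_abs)
    qed
    have 1: "B ^ (12 * k + 11) = exp ((12 * k + 11) * \<beta>)" "C ^ k = exp (k * \<gamma>)"
      "1 / C ^ (3 * k) = exp (- (3 * k * \<gamma>))" "1 / D = exp (- \<delta>)"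
      using B D0 pw[of B "12 * k + 11"] pw[of C k] pw[of C "3 * k"] by (simp_all add: L exp_minus field_simps)
    show ?thesis unfolding 1 sq exp_add[symmetric] by (simp add: algebra_simps)
  qed
  also have "\<dots> \<le> exp (- \<gamma>) + exp (- \<gamma>)"
    by (intro add_mono iffD2[OF exp_le_cancel_iff] k)
  also have "\<dots> = 2 / C" using D0 by (simp add: L exp_minus field_simps)
  finally show False using B BC by (simp add: field_simps)
qed

section \<open>Zeros of combinations of radicals\<close>

lemma homogeneous_system_nontrivial:
  fixes M :: "'v \<Rightarrow> 'u \<Rightarrow> real"
  assumes "finite V" "finite U" "card V < card U"
  shows "\<exists>c. (\<exists>u\<in>U. c u \<noteq> 0) \<and> (\<forall>v\<in>V. (\<Sum>u\<in>U. M v u * c u) = 0)"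
  using assms
proof (induction V arbitrary: U M)
  case empty
  then obtain u where "u \<in> U" by fastforce
  thus ?case by (intro exI[of _ "\<lambda>_. 1"]) auto
next
  case (insert v V)
  show ?case
  proof (cases "\<forall>u\<in>U. M v u = 0")
    case True
    obtain c where "\<exists>u\<in>U. c u \<noteq> 0" "\<forall>w\<in>V. (\<Sum>u\<in>U. M w u * c u) = 0"
      using insert.IH[of U M] insert.prems insert.hyps by auto
    thus ?thesis using True by (intro exI[of _ c]) auto
  next
    case False
    then obtain u0 where u0: "u0 \<in> U" "M v u0 \<noteq> 0" by blast
    define M' where "M' w u = M w u - M w u0 * M v u / M v u0" for w u
    have "card V < card (U - {u0})" using insert.prems insert.hyps u0 by simp
    then obtain c where c: "\<exists>u\<in>U - {u0}. c u \<noteq> 0" "\<forall>w\<in>V. (\<Sum>u\<in>U - {u0}. M' w u * c u) = 0"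
      using insert.IH[of "U - {u0}" M'] insert.prems by auto
    define S where "S = (\<Sum>u\<in>U - {u0}. M v u * c u)"
    define d where "d = c(u0 := - S / M v u0)"
    have sum_d: "(\<Sum>u\<in>U. M w u * d u) = M w u0 * (- S / M v u0) + (\<Sum>u\<in>U - {u0}. M w u * c u)" for w
    proof -
      have "(\<Sum>u\<in>U - {u0}. M w u * d u) = (\<Sum>u\<in>U - {u0}. M w u * c u)"
        by (intro sum.cong) (auto simp: d_def)
      thus ?thesis using u0 insert.prems by (simp add: sum.remove d_def)
    qed
    have "(\<Sum>u\<in>U. M w u * d u) = 0" if "w \<in> insert v V" for w
    proof (cases "w = v")
      case True thus ?thesis using u0 by (simp add: sum_d S_def)
    next
      case False
      hence "(\<Sum>u\<in>U - {u0}. M' w u * c u) = 0" using c that by blast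
      moreover have "(\<Sum>u\<in>U - {u0}. M' w u * c u) = (\<Sum>u\<in>U - {u0}. M w u * c u) - M w u0 / M v u0 * S"
        unfolding M'_def S_def sum_distrib_left sum_subtractf[symmetric]
        by (intro sum.cong) (auto simp: algebra_simps)
      ultimately show ?thesis by (simp add: sum_d)
    qed
    moreover have "\<exists>u\<in>U. d u \<noteq> 0" using c(1) by (auto simp: d_def)
    ultimately show ?thesis by blast
  qed
qed

lemma linear_times_pderiv_power:
  "[:-r, 1:] * pderiv ([:-r, 1:] ^ v * U) = [:-r, 1:] ^ v * (of_nat v * U + [:-r, 1:] * pderiv (U :: real poly))"
proof -
  have "[:-r, 1:] * pderiv ([:-r, 1:] ^ v) = of_nat v * [:-r, 1::real:] ^ v"
  proof (induction v)
    case (Suc v)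
    have p: "pderiv [:-r, 1::real:] = 1" by (simp add: pderiv_pCons)
    have "[:-r, 1:] * pderiv ([:-r, 1:] ^ Suc v)
        = [:-r, 1:] * ([:-r, 1:] * pderiv ([:-r, 1:] ^ v) + [:-r, 1:] ^ v)"
      unfolding power_Suc pderiv_mult p by (simp only: mult_1_right mult_1 mult.commute)
    also have "\<dots> = of_nat (Suc v) * [:-r, 1:] ^ Suc v"
      unfolding Suc power_Suc of_nat_Suc by (simp only: algebra_simps)
    finally show ?case .
  qed simp
  hence "U * ([:-r, 1:] * pderiv ([:-r, 1:] ^ v)) = U * (of_nat v * [:-r, 1::real:] ^ v)" by simp
  thus ?thesis unfolding pderiv_mult by (simp only: algebra_simps)
qed

locale linear_forms =
  fixes s k :: nat and a :: "nat \<Rightarrow> real" and n :: real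
  assumes k: "k > 0" and n: "n \<noteq> 0" and a_pos: "\<And>i. i < s \<Longrightarrow> a i > 0" and inj: "inj_on a {..<s}"
begin

definition L :: "nat \<Rightarrow> real poly" where "L i = [:n, a i:]"
definition Box :: "(nat \<Rightarrow> nat) set" where "Box = ({..<s} \<rightarrow>\<^sub>E {..<k})"
text \<open>The product of the \<open>L i\<close> to the powers \<open>e i / k\<close>, meaningful
  where all linear forms are positive. At a solution \<open>c\<close> it is a monomial in the roots
  \<open>z i c\<close>.\<close>

definition y :: "(nat \<Rightarrow> nat) \<Rightarrow> real \<Rightarrow> real" where
  "y e x = exp (\<Sum>i<s. real (e i) / real k * ln (poly (L i) x))"
definition \<Lambda> :: "real poly" where "\<Lambda> = (\<Prod>i<s. L i)"
text \<open>\<open>\<Lambda>\<close> times the logarithmic derivative of \<open>y e\<close>.\<close>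

definition \<sigma> :: "(nat \<Rightarrow> nat) \<Rightarrow> real poly" where
  "\<sigma> e = (\<Sum>i<s. smult (real (e i) / real k * a i) (\<Prod>j\<in>{..<s}-{i}. L j))"

text \<open>By \<open>eq\<close>, the quotient of \<open>P * y e\<close> and \<open>Q * y e'\<close>
  has logarithmic derivative 0. The residue of that derivative at the root of \<open>L i\<close> is
  \<open>order P - order Q + (e i - e' i) / k\<close>, so \<open>k\<close> divides
  \<open>e i - e' i\<close>, which is smaller than \<open>k\<close> in absolute value. The roots
  \<open>- n / a i\<close> are distinct because \<open>n \<noteq> 0\<close>.\<close>

lemma log_derivative_rigid:
  assumes e: "e \<in> Box" "e' \<in> Box" and P: "P \<noteq> 0" "Q \<noteq> 0"
    and eq: "\<Lambda> * (pderiv P * Q - P * pderiv Q) + (\<sigma> e - \<sigma> e') * P * Q = 0"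
  shows "e = e'"
proof -
  have "e i = e' i" if i: "i < s" for i
  proof -
    define r where "r = - n / a i"
    define X where "X = [:-r, 1:]"
    define M where "M = smult (a i) (\<Prod>j\<in>{..<s}-{i}. L j)"
    obtain U where U: "P = X ^ order r P * U" "poly U r \<noteq> 0"
      using order_decomp[OF P(1), of r] by (auto simp: X_def poly_eq_0_iff_dvd)
    obtain V where V: "Q = X ^ order r Q * V" "poly V r \<noteq> 0"
      using order_decomp[OF P(2), of r] by (auto simp: X_def poly_eq_0_iff_dvd)
    define u v where uv: "u = order r P" "v = order r Q"
    have P': "X * pderiv P = X ^ u * (of_nat u * U + X * pderiv U)"
      using linear_times_pderiv_power[of r u U] U(1) by (simp only: X_def uv)
    have Q': "X * pderiv Q = X ^ v * (of_nat v * V + X * pderiv V)"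
      using linear_times_pderiv_power[of r v V] V(1) by (simp only: X_def uv)
    have Li: "L i = smult (a i) X" using a_pos[OF i] by (simp add: L_def X_def r_def)
    have \<Lambda>: "\<Lambda> = X * M"
      using i by (simp add: \<Lambda>_def M_def Li prod.remove[of "{..<s}" i] del: mult_pCons_left)
    have "0 = M * (X * pderiv P) * Q - M * P * (X * pderiv Q) + (\<sigma> e - \<sigma> e') * P * Q"
      using eq unfolding \<Lambda> by (simp add: algebra_simps)
    also have "\<dots> = (X ^ u * X ^ v) * (M * (of_nat u * U + X * pderiv U) * V
         - M * U * (of_nat v * V + X * pderiv V) + (\<sigma> e - \<sigma> e') * U * V)"
      unfolding P' Q' using U(1) V(1) unfolding uv[symmetric] by (simp add: algebra_simps)
    finally have "M * (of_nat u * U + X * pderiv U) * V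
         - M * U * (of_nat v * V + X * pderiv V) + (\<sigma> e - \<sigma> e') * U * V = 0"
      by (simp add: X_def)
    hence "poly (M * (of_nat u * U + X * pderiv U) * V
         - M * U * (of_nat v * V + X * pderiv V) + (\<sigma> e - \<sigma> e') * U * V) r = 0" by simp
    moreover have "poly X r = 0" by (simp add: X_def)
    ultimately have ev: "(poly M r * (real u - real v) + (poly (\<sigma> e) r - poly (\<sigma> e') r)) * (poly U r * poly V r) = 0"
      by (simp add: algebra_simps)
    have \<sigma>r: "poly (\<sigma> f) r = real (f i) / real k * poly M r" for f
    proof -
      have "poly (\<sigma> f) r = (\<Sum>m<s. real (f m) / real k * a m * (\<Prod>j\<in>{..<s}-{m}. poly (L j) r))"
        by (simp add: \<sigma>_def poly_sum poly_prod)
      also have "\<dots> = (\<Sum>m\<in>{i}. real (f m) / real k * a m * (\<Prod>j\<in>{..<s}-{m}. poly (L j) r))"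
      proof (rule sum.mono_neutral_right)
        show "\<forall>m\<in>{..<s} - {i}. real (f m) / real k * a m * (\<Prod>j\<in>{..<s}-{m}. poly (L j) r) = 0"
        proof
          fix m assume m: "m \<in> {..<s} - {i}"
          have "poly (L i) r = 0" by (simp add: Li X_def)
          hence "(\<Prod>j\<in>{..<s}-{m}. poly (L j) r) = 0" using m i by (intro prod_zero) auto
          thus "real (f m) / real k * a m * (\<Prod>j\<in>{..<s}-{m}. poly (L j) r) = 0" by simp
        qed
      qed (use i in auto)
      finally show ?thesis by (simp add: M_def poly_prod)
    qed
    have "poly M r \<noteq> 0"
    proof -
      have "poly (L j) r \<noteq> 0" if "j \<in> {..<s} - {i}" for j
      proof -
        have "a j \<noteq> a i" using inj that i by (auto simp: inj_on_def)
        hence "n * (a i - a j) \<noteq> 0" using n by simp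
        thus ?thesis using a_pos[OF i] by (simp add: L_def r_def field_simps)
      qed
      thus ?thesis using a_pos[OF i] by (simp add: M_def poly_prod)
    qed
    moreover have "poly M r * (real u - real v) + (poly (\<sigma> e) r - poly (\<sigma> e') r) = 0"
      using ev U(2) V(2) by (simp only: mult_eq_0_iff) blast
    hence "poly M r * (real u - real v + real (e i) / real k - real (e' i) / real k) = 0"
      by (simp add: \<sigma>r algebra_simps)
    ultimately have "real u - real v + real (e i) / real k - real (e' i) / real k = 0" by simp
    hence "real u - real v = (real (e' i) - real (e i)) / real k" by (simp add: diff_divide_distrib)
    hence "real_of_int (int k * (int u - int v)) = real_of_int (int (e' i) - int (e i))"
      using k by simp
    hence d: "int k * (int u - int v) = int (e' i) - int (e i)" by (simp only: of_int_eq_iff)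
    have "e i < k" "e' i < k" using e i by (auto simp: Box_def PiE_iff)
    hence "\<bar>int (e' i) - int (e i)\<bar> < int k" by linarith
    moreover have "int k dvd int (e' i) - int (e i)" using d by (metis dvd_triv_left)
    ultimately have "int (e' i) - int (e i) = 0" using dvd_imp_le_int[of "int (e' i) - int (e i)" "int k"] by linarith
    thus ?thesis by simp
  qed
  thus ?thesis using e unfolding Box_def by (intro PiE_ext) auto
qed

lemma y_pos: "y e x > 0" by (simp add: y_def)

lemma y_deriv:
  assumes "\<And>i. i < s \<Longrightarrow> poly (L i) x > 0"
  shows "(y e has_real_derivative y e x * (\<Sum>i<s. real (e i) / real k * (a i / poly (L i) x))) (at x)"
proof -
  have "((\<lambda>x. real (e i) / real k * ln (poly (L i) x)) has_real_derivative real (e i) / real k * (a i / poly (L i) x)) (at x)"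
    if "i < s" for i
    using assms[OF that] by (intro DERIV_cmult) (auto intro!: derivative_eq_intros simp: L_def)
  hence "((\<lambda>x. \<Sum>i<s. real (e i) / real k * ln (poly (L i) x)) has_real_derivative
     (\<Sum>i<s. real (e i) / real k * (a i / poly (L i) x))) (at x)"
    by (intro DERIV_sum) auto
  thus ?thesis unfolding y_def by (rule DERIV_fun_exp)
qed

lemma \<Lambda>_log_deriv:
  assumes "\<And>i. i < s \<Longrightarrow> poly (L i) x > 0"
  shows "poly \<Lambda> x * (\<Sum>i<s. real (e i) / real k * (a i / poly (L i) x)) = poly (\<sigma> e) x"
  unfolding \<Lambda>_def \<sigma>_def poly_sum sum_distrib_left
proof (rule sum.cong)
  fix i assume i: "i \<in> {..<s}"
  have "poly (prod L {..<s}) x = poly (L i) x * poly (\<Prod>j\<in>{..<s}-{i}. L j) x"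
    using i by (simp add: prod.remove[of "{..<s}" i] poly_mult)
  thus "poly (prod L {..<s}) x * (real (e i) / real k * (a i / poly (L i) x))
    = poly (smult (real (e i) / real k * a i) (\<Prod>j\<in>{..<s}-{i}. L j)) x"
    using assms[of i] i by simp
qed simp

text \<open>Induction on the number of monomials: combining the relation with its derivative,
  multiplied by \<open>\<Lambda>\<close>, eliminates \<open>e1\<close>. Vanishing of the new
  coefficients means that \<open>P e1 * y e1\<close> and \<open>P e * y e\<close> have the same
  logarithmic derivative, which \<open>log_derivative_rigid\<close> excludes for nonzero
  \<open>P e1\<close>, \<open>P e\<close>.\<close>

lemma y_independent:
  assumes lh: "lo < hi" and pos: "\<And>x i. lo < x \<Longrightarrow> x < hi \<Longrightarrow> i < s \<Longrightarrow> poly (L i) x > 0"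
    and E: "finite E" "E \<subseteq> Box" and zero: "\<And>x. lo < x \<Longrightarrow> x < hi \<Longrightarrow> (\<Sum>e\<in>E. poly (P e) x * y e x) = 0"
  shows "\<forall>e\<in>E. P e = 0"
  using E zero
proof (induction E arbitrary: P)
  case (insert e1 E)
  have vanish: "p = 0" if "\<And>x. lo < x \<Longrightarrow> x < hi \<Longrightarrow> poly p x = 0" for p :: "real poly"
  proof (rule ccontr)
    assume "p \<noteq> 0"
    hence "finite {x. poly p x = 0}" by (rule poly_roots_finite)
    moreover have "{lo<..<hi} \<subseteq> {x. poly p x = 0}" using that by auto
    ultimately have "finite {lo<..<hi}" by (rule finite_subset[rotated])
    thus False using infinite_Ioo[OF lh] by simp
  qed
  define Q where "Q e = \<Lambda> * pderiv (P e) + \<sigma> e * P e" for e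
  have Qzero: "(\<Sum>e\<in>insert e1 E. poly (Q e) x * y e x) = 0" if x: "lo < x" "x < hi" for x
  proof -
    let ?d = "\<lambda>e. poly (pderiv (P e)) x * y e x + poly (P e) x * (y e x * (\<Sum>i<s. real (e i) / real k * (a i / poly (L i) x)))"
    have "((\<lambda>x. \<Sum>e\<in>insert e1 E. poly (P e) x * y e x) has_real_derivative (\<Sum>e\<in>insert e1 E. ?d e)) (at x)"
      using pos x by (intro DERIV_sum) (auto intro!: derivative_eq_intros y_deriv poly_DERIV simp: mult_ac)
    moreover have "((\<lambda>x. \<Sum>e\<in>insert e1 E. poly (P e) x * y e x) has_real_derivative 0) (at x)"
    proof (rule DERIV_cong_ev[THEN iffD2, OF refl _ refl])
      have ev: "\<forall>\<^sub>F u in nhds x. u \<in> {lo<..<hi}"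
        using eventually_nhds_in_open[of "{lo<..<hi}" x] x by simp
      show "\<forall>\<^sub>F x in nhds x. (\<Sum>e\<in>insert e1 E. poly (P e) x * y e x) = 0"
        by (rule eventually_mono[OF ev]) (use insert.prems(2) in auto)
    qed auto
    ultimately have "(\<Sum>e\<in>insert e1 E. ?d e) = 0" by (rule DERIV_unique)
    hence "poly \<Lambda> x * (\<Sum>e\<in>insert e1 E. ?d e) = 0" by simp
    also have "poly \<Lambda> x * (\<Sum>e\<in>insert e1 E. ?d e) = (\<Sum>e\<in>insert e1 E. poly \<Lambda> x * ?d e)"
      by (rule sum_distrib_left)
    also have "\<dots> = (\<Sum>e\<in>insert e1 E. poly (Q e) x * y e x)"
    proof (rule sum.cong)
      fix e
      have \<sigma>: "poly (\<sigma> e) x = poly \<Lambda> x * (\<Sum>i<s. real (e i) / real k * (a i / poly (L i) x))"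
        using \<Lambda>_log_deriv[OF pos[OF x], of e] by simp
      show "poly \<Lambda> x * ?d e = poly (Q e) x * y e x"
        unfolding Q_def poly_add poly_mult \<sigma> by (simp only: algebra_simps)
    qed simp
    finally show ?thesis .
  qed
  have "\<forall>e\<in>E. Q e1 * P e - P e1 * Q e = 0"
  proof (rule insert.IH)
    fix x assume x: "lo < x" "x < hi"
    have "0 = poly (Q e1) x * (\<Sum>e\<in>insert e1 E. poly (P e) x * y e x) - poly (P e1) x * (\<Sum>e\<in>insert e1 E. poly (Q e) x * y e x)"
      using insert.prems(2)[OF x] Qzero[OF x] by simp
    also have "\<dots> = (\<Sum>e\<in>E. poly (Q e1 * P e - P e1 * Q e) x * y e x)"
      using insert.hyps by (simp add: algebra_simps sum_distrib_left sum_subtractf)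
    finally show "(\<Sum>e\<in>E. poly (Q e1 * P e - P e1 * Q e) x * y e x) = 0" by simp
  qed (use insert.prems in auto)
  hence rel: "\<Lambda> * (pderiv (P e1) * P e - P e1 * pderiv (P e)) + (\<sigma> e1 - \<sigma> e) * P e1 * P e = 0" if "e \<in> E" for e
  proof -
    have "\<Lambda> * (pderiv (P e1) * P e - P e1 * pderiv (P e)) + (\<sigma> e1 - \<sigma> e) * P e1 * P e = Q e1 * P e - P e1 * Q e"
      unfolding Q_def by (simp add: algebra_simps)
    thus ?thesis using \<open>\<forall>e\<in>E. Q e1 * P e - P e1 * Q e = 0\<close> that by simp
  qed
  have P1: "P e1 = 0"
  proof (rule ccontr)
    assume P1: "P e1 \<noteq> 0"
    have "P e = 0" if "e \<in> E" for e
      using log_derivative_rigid[of e1 e "P e1" "P e"] rel[OF that] P1 that insert.prems(1) insert.hyps(2) by auto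
    hence "poly (P e1) x * y e1 x = 0" if "lo < x" "x < hi" for x
      using insert.prems(2)[OF that] insert.hyps by simp
    hence "P e1 = 0" using y_pos[of e1] by (intro vanish) (metis mult_eq_0_iff less_irrefl)
    thus False using P1 by simp
  qed
  moreover have "\<forall>e\<in>E. P e = 0"
    using insert.prems insert.hyps P1 by (intro insert.IH) auto
  ultimately show ?case by blast
qed simp

section \<open>Products of the monomials and the number of zeros\<close>

definition red :: "(nat \<Rightarrow> nat) \<Rightarrow> (nat \<Rightarrow> nat) \<Rightarrow> nat \<Rightarrow> nat" where
  "red e f = (\<lambda>i\<in>{..<s}. (e i + f i) mod k)"
definition carry :: "(nat \<Rightarrow> nat) \<Rightarrow> (nat \<Rightarrow> nat) \<Rightarrow> real poly" where
  "carry e f = (\<Prod>i<s. L i ^ ((e i + f i) div k))"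

lemma finite_Box: "finite Box" by (simp add: Box_def finite_PiE)

lemma card_Box: "card Box = k ^ s" by (simp add: Box_def card_PiE)

lemma red_Box: "red e f \<in> Box" using k by (auto simp: red_def Box_def)

text \<open>Exponents add modulo \<open>k\<close>; each wrap-around of the exponent of
  \<open>L i\<close> releases a full factor \<open>L i\<close>, collected in
  \<open>carry\<close>.\<close>

lemma y_mult:
  assumes "\<And>i. i < s \<Longrightarrow> poly (L i) x > 0"
  shows "y e x * y f x = poly (carry e f) x * y (red e f) x"
proof -
  have "poly (carry e f) x = (\<Prod>i<s. exp (real ((e i + f i) div k) * ln (poly (L i) x)))"
    unfolding carry_def poly_prod poly_power using assms by (intro prod.cong) (auto simp: exp_of_nat_mult)
  also have "\<dots> = exp (\<Sum>i<s. real ((e i + f i) div k) * ln (poly (L i) x))"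
    by (simp add: exp_sum)
  finally have "poly (carry e f) x * y (red e f) x
     = exp (\<Sum>i<s. real ((e i + f i) div k) * ln (poly (L i) x) + real (red e f i) / real k * ln (poly (L i) x))"
    by (simp add: y_def exp_add sum.distrib)
  also have "(\<Sum>i<s. real ((e i + f i) div k) * ln (poly (L i) x) + real (red e f i) / real k * ln (poly (L i) x))
     = (\<Sum>i<s. real (e i) / real k * ln (poly (L i) x) + real (f i) / real k * ln (poly (L i) x))"
  proof (rule sum.cong)
    fix i assume i: "i \<in> {..<s}"
    have "real (e i + f i) = real (k * ((e i + f i) div k) + (e i + f i) mod k)" by simp
    hence "real ((e i + f i) div k) + real ((e i + f i) mod k) / real k = real (e i) / real k + real (f i) / real k"
      using k by (simp only: of_nat_add of_nat_mult) (simp add: field_simps)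
    thus "real ((e i + f i) div k) * ln (poly (L i) x) + real (red e f i) / real k * ln (poly (L i) x)
      = real (e i) / real k * ln (poly (L i) x) + real (f i) / real k * ln (poly (L i) x)"
      
    proof -
      have "red e f i = (e i + f i) mod k" using i by (simp add: red_def)
      thus ?thesis using \<open>_ + _ = real (e i) / real k + _\<close> by (simp only: distrib_right[symmetric])
    qed
  qed simp
  finally show ?thesis by (simp add: y_def exp_add sum.distrib)
qed

lemma degree_carry:
  assumes "e \<in> Box" "f \<in> Box" shows "degree (carry e f) \<le> s"
proof -
  have "degree (carry e f) \<le> (\<Sum>i<s. degree (L i ^ ((e i + f i) div k)))"
    unfolding carry_def using degree_prod_sum_le[of "{..<s}" "\<lambda>i. L i ^ ((e i + f i) div k)"] by (simp add: o_def)
  also have "\<dots> \<le> (\<Sum>i<s. 1)"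
  proof (rule sum_mono)
    fix i assume "i \<in> {..<s}"
    hence "e i < k" "f i < k" using assms by (auto simp: Box_def PiE_iff)
    hence "(e i + f i) div k < 2" by (simp add: div_less_iff_less_mult k)
    moreover have "degree (L i) \<le> 1" by (simp add: L_def)
    ultimately have "degree (L i) * ((e i + f i) div k) \<le> 1 * 1" by (intro mult_le_mono) auto
    thus "degree (L i ^ ((e i + f i) div k)) \<le> 1" using order.trans[OF degree_power_le, of "L i" _ 1] by simp
  qed
  finally show ?thesis by simp
qed

text \<open>Linear algebra gives \<open>H \<noteq> 0\<close> in the span of the monomials \<open>y\<close> over the polynomials such that the product of
  \<open>H\<close> and the given combination is a nonzero polynomial of small degree.\<close>
lemma zeros_bound:
  assumes q: "e0 \<in> Box" "q e0 \<noteq> 0" and T: "finite T" "\<And>x i. x \<in> T \<Longrightarrow> i < s \<Longrightarrow> poly (L i) x > 0"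
    "\<And>x. x \<in> T \<Longrightarrow> (\<Sum>e\<in>Box. q e * y e x) = 0"
  shows "card T \<le> s * k ^ s"
proof -
  define D where "D = card Box"
  have D: "D > 0" using q finite_Box by (auto simp: D_def card_gt_0_iff)
  \<comment> \<open>With this degree bound the \<open>D (m + 1)\<close> unknown coefficients of
    \<open>H\<close> outnumber the \<open>(D - 1) (m + s + 1)\<close> equations by exactly one. The
    equations say that no monomial other than \<open>y z = 1\<close> occurs in the product.\<close>
  define m where "m = (D - 1) * s"
  define z where "z = (\<lambda>i\<in>{..<s}. 0 :: nat)"
  have z: "z \<in> Box" using k by (auto simp: z_def Box_def)
  define U where "U = Box \<times> {..m}"
  define V where "V = (Box - {z}) \<times> {..m + s}"
  define N0 where "N0 g f = (\<Sum>e\<in>{e\<in>Box. red e f = g}. smult (q e) (carry e f))" for g f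
  define M where "M = (\<lambda>(g, j) (f, h). coeff (N0 g f * monom 1 h) j)"
  have "card V < card U"
  proof -
    obtain D' where D': "D = Suc D'" using D gr0_implies_Suc by blast
    have "card V = D' * (D' * s + s + 1)" "card U = Suc D' * (D' * s + 1)"
      using z finite_Box D' by (auto simp: V_def U_def m_def D_def card_Diff_singleton)
    thus ?thesis by (simp add: algebra_simps)
  qed
  then obtain c where c: "\<exists>u\<in>U. c u \<noteq> 0" "\<forall>v\<in>V. (\<Sum>u\<in>U. M v u * c u) = 0"
    using homogeneous_system_nontrivial[of V U M] finite_Box by (auto simp: U_def V_def)
  define H where "H f = (\<Sum>h\<le>m. monom (c (f, h)) h)" for f
  define N where "N g = (\<Sum>f\<in>Box. N0 g f * H f)" for g
  have degH: "degree (H f) \<le> m" for f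
    unfolding H_def by (intro degree_sum_le) (auto intro: order.trans[OF degree_monom_le])
  have degN: "degree (N g) \<le> m + s" for g
  proof -
    have "degree (N0 g f) \<le> s" if "f \<in> Box" for f
      unfolding N0_def using that finite_Box
      by (intro degree_sum_le) (auto intro!: order.trans[OF degree_smult_le] degree_carry)
    thus ?thesis unfolding N_def using degH finite_Box
      by (intro degree_sum_le) (auto intro!: order.trans[OF degree_mult_le] simp: add.commute add_mono)
  qed
  have N_coeff: "coeff (N g) j = (\<Sum>u\<in>U. M (g, j) u * c u)" for g j
  proof -
    have "N0 g f * H f = (\<Sum>h\<le>m. smult (c (f, h)) (N0 g f * monom 1 h))" for f
      unfolding H_def sum_distrib_left by (intro sum.cong) (simp_all add: mult_smult_right[symmetric] smult_monom)
    hence "coeff (N g) j = (\<Sum>f\<in>Box. \<Sum>h\<le>m. coeff (N0 g f * monom 1 h) j * c (f, h))"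
      by (simp add: N_def coeff_sum mult.commute)
    thus ?thesis by (simp add: U_def M_def sum.cartesian_product split_def)
  qed
  have N_zero: "N g = 0" if "g \<in> Box - {z}" for g
  proof (rule poly_eqI)
    fix j
    show "coeff (N g) j = coeff 0 j"
    proof (cases "j \<le> m + s")
      case True thus ?thesis using c(2) that unfolding N_coeff by (auto simp: V_def)
    next
      case False thus ?thesis using degN[of g] by (simp add: coeff_eq_0)
    qed
  qed
  have y_z: "y z x = 1" for x by (simp add: y_def z_def)
  have product: "(\<Sum>e\<in>Box. q e * y e x) * (\<Sum>f\<in>Box. poly (H f) x * y f x) = poly (N z) x"
    if x: "\<And>i. i < s \<Longrightarrow> poly (L i) x > 0" for x
  proof -
    have inner: "(\<Sum>e\<in>Box. q e * (y e x * y f x)) = (\<Sum>g\<in>Box. poly (N0 g f) x * y g x)" for f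
    proof -
      have "(\<Sum>e\<in>Box. q e * (y e x * y f x)) = (\<Sum>g\<in>Box. \<Sum>e\<in>{e\<in>Box. red e f = g}. q e * (y e x * y f x))"
        using finite_Box red_Box by (intro sum.group[symmetric]) auto
      also have "\<dots> = (\<Sum>g\<in>Box. poly (N0 g f) x * y g x)"
        unfolding N0_def poly_sum sum_distrib_right
        using y_mult[OF x] by (intro sum.cong) (auto simp: mult.assoc)
      finally show ?thesis .
    qed
    have "(\<Sum>e\<in>Box. q e * y e x) * (\<Sum>f\<in>Box. poly (H f) x * y f x)
      = (\<Sum>e\<in>Box. \<Sum>f\<in>Box. q e * y e x * (poly (H f) x * y f x))" by (rule sum_product)
    also have "\<dots> = (\<Sum>f\<in>Box. \<Sum>e\<in>Box. q e * y e x * (poly (H f) x * y f x))" by (rule sum.swap)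
    also have "\<dots> = (\<Sum>f\<in>Box. poly (H f) x * (\<Sum>e\<in>Box. q e * (y e x * y f x)))"
      by (intro sum.cong refl) (simp add: sum_distrib_left mult_ac)
    also have "\<dots> = (\<Sum>f\<in>Box. poly (H f) x * (\<Sum>g\<in>Box. poly (N0 g f) x * y g x))"
      by (simp only: inner)
    also have "\<dots> = (\<Sum>g\<in>Box. poly (N g) x * y g x)"
      unfolding N_def poly_sum sum_distrib_left sum_distrib_right
      by (subst sum.swap) (intro sum.cong refl, simp add: mult_ac)
    also have "\<dots> = (\<Sum>g\<in>{z}. poly (N g) x * y g x)"
      using z finite_Box N_zero by (intro sum.mono_neutral_right) auto
    finally show ?thesis by (simp add: y_z)
  qed
  have "N z \<noteq> 0"
  proof
    assume Nz: "N z = 0"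
    \<comment> \<open>Beyond \<open>lo\<close> all linear forms are positive. Independence provides
      a point there at which the given combination is nonzero, and continuity an interval. If the
      product vanished, the combination with coefficients \<open>H\<close> would vanish on it, and
      independence would force \<open>H = 0\<close>.\<close>
    define lo where "lo = (\<Sum>i<s. \<bar>n\<bar> / a i)"
    have pos: "poly (L i) x > 0" if "lo < x" "i < s" for x i
    proof -
      have "\<bar>n\<bar> / a i \<le> lo" unfolding lo_def using that a_pos by (intro member_le_sum) (auto simp: less_imp_le)
      hence "\<bar>n\<bar> < x * a i" using that a_pos[of i] by (simp add: pos_divide_less_eq[symmetric])
      thus ?thesis by (simp add: L_def)
    qed
    have "\<exists>x. lo < x \<and> x < lo + 1 \<and> (\<Sum>e\<in>Box. q e * y e x) \<noteq> 0"
    proof (rule ccontr)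
      assume no: "\<not> ?thesis"
      have "\<forall>e\<in>Box. [:q e:] = 0"
        by (rule y_independent[of lo "lo + 1"]) (use no pos finite_Box in auto)
      thus False using q by auto
    qed
    then obtain x0 where x0: "lo < x0" "x0 < lo + 1" "(\<Sum>e\<in>Box. q e * y e x0) \<noteq> 0" by blast
    have "isCont (\<lambda>x. \<Sum>e\<in>Box. q e * y e x) x0"
      using pos x0 by (intro continuous_intros) (auto intro!: DERIV_isCont y_deriv)
    hence "\<forall>\<^sub>F x in at x0. (\<Sum>e\<in>Box. q e * y e x) \<noteq> 0"
      using x0(3) unfolding isCont_def by (rule tendsto_imp_eventually_ne)
    then obtain d where d: "d > 0" "\<And>x. x \<noteq> x0 \<Longrightarrow> dist x x0 < d \<Longrightarrow> (\<Sum>e\<in>Box. q e * y e x) \<noteq> 0"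
      unfolding eventually_at by auto
    have "\<forall>f\<in>Box. H f = 0"
    proof (rule y_independent[of x0 "x0 + d"])
      fix x assume x: "x0 < x" "x < x0 + d"
      hence "(\<Sum>e\<in>Box. q e * y e x) \<noteq> 0" by (intro d) (auto simp: dist_real_def)
      moreover have "(\<Sum>e\<in>Box. q e * y e x) * (\<Sum>f\<in>Box. poly (H f) x * y f x) = 0"
        using product[of x] pos[of x] x x0 Nz by simp
      ultimately show "(\<Sum>f\<in>Box. poly (H f) x * y f x) = 0" by simp
    qed (use d pos x0 finite_Box in auto)
    hence "c (f, h) = 0" if "(f, h) \<in> U" for f h
    proof -
      have "coeff (H f) h = 0" using \<open>\<forall>f\<in>Box. H f = 0\<close> that by (auto simp: U_def)
      moreover have "coeff (H f) h = c (f, h)"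
        using that by (simp add: H_def coeff_sum U_def)
      ultimately show ?thesis by simp
    qed
    thus False using c(1) by auto
  qed
  moreover have "T \<subseteq> {x. poly (N z) x = 0}" using product T by force
  ultimately have "card T \<le> card {x. poly (N z) x = 0}" by (intro card_mono poly_roots_finite)
  also have "\<dots> \<le> degree (N z)" using \<open>N z \<noteq> 0\<close> by (rule card_poly_roots_bound)
  also have "\<dots> \<le> m + s" by (rule degN)
  also have "m + s = s * k ^ s" using D card_Box by (cases D) (auto simp: m_def D_def algebra_simps)
  finally show ?thesis .
qed

end

section \<open>Small solutions in a residue class\<close>

text \<open>The uniqueness part of Hensel's lemma: the cofactor of \<open>x - y\<close> in
  \<open>x^k - y^k\<close> is congruent to \<open>k x^(k - 1)\<close>, a unit modulo
  \<open>p\<close>.\<close>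

lemma power_diff_dvd_lift:
  fixes x y p :: int
  assumes "prime p" "\<not> p dvd int k" "\<not> p dvd x" "[x = y] (mod p)" "p ^ N dvd x ^ k - y ^ k"
  shows "p ^ N dvd x - y"
proof -
  have "[(\<Sum>i<k. y ^ (k - Suc i) * x ^ i) = (\<Sum>i<k. x ^ (k - Suc i) * x ^ i)] (mod p)"
    using assms(4) by (intro cong_sum cong_mult cong_pow) (auto simp: cong_sym)
  also have "(\<Sum>i<k. x ^ (k - Suc i) * x ^ i) = int k * x ^ (k - 1)"
    by (simp flip: power_add)
  finally have "\<not> p dvd (\<Sum>i<k. y ^ (k - Suc i) * x ^ i)"
    using assms(1-3) by (metis cong_dvd_iff prime_dvd_mult_iff prime_dvd_power)
  hence "coprime (p ^ N) (\<Sum>i<k. y ^ (k - Suc i) * x ^ i)"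
    using assms(1) by (simp add: prime_imp_coprime)
  moreover have "x ^ k - y ^ k = (x - y) * (\<Sum>i<k. y ^ (k - Suc i) * x ^ i)"
    using power_diff_sumr2[of x k y] by (simp add: mult.commute)
  ultimately show ?thesis using assms(5) by (simp add: coprime_dvd_mult_left_iff)
qed

text \<open>Newton's iteration with a fixed inverse \<open>\<kappa>\<close> of the derivative
  \<open>k \<zeta>^(k - 1)\<close> modulo \<open>p\<close>. Each step gains one power of
  \<open>p\<close> and stays polynomial in \<open>t\<close>, so one \<open>g\<close> serves all
  multiples \<open>t\<close> of \<open>p\<close>.\<close>

lemma hensel_polynomial:
  fixes p \<zeta> :: int and l :: "int poly"
  assumes p: "prime p" and k: "\<not> p dvd int k" "\<not> p dvd \<zeta>" and l: "\<And>t. p dvd t \<Longrightarrow> [poly l t = \<zeta> ^ k] (mod p)"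
  shows "\<exists>g :: int poly. \<forall>t. p dvd t \<longrightarrow> [poly g t = \<zeta>] (mod p) \<and> p ^ Suc N dvd poly g t ^ k - poly l t"
proof (induction N)
  case 0
  show ?case using l by (intro exI[of _ "[:\<zeta>:]"]) (auto simp: cong_iff_dvd_diff cong_sym dvd_minus_iff dvd_diff_commute)
next
  case (Suc N)
  then obtain g where g: "\<And>t. p dvd t \<Longrightarrow> [poly g t = \<zeta>] (mod p)" "\<And>t. p dvd t \<Longrightarrow> p ^ Suc N dvd poly g t ^ k - poly l t"
    by blast
  have "coprime (int k * \<zeta> ^ (k - 1)) p"
    using p k by (metis coprime_commute prime_dvd_mult_iff prime_dvd_power prime_imp_coprime)
  then obtain \<kappa> where \<kappa>: "[int k * \<zeta> ^ (k - 1) * \<kappa> = 1] (mod p)" using cong_solve_coprime_int by blast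
  have k0: "k > 0" using k(1) by (cases k) auto
  define E where "E = g ^ k - l"
  define h where "h = g - smult \<kappa> E"
  have "[poly h t = \<zeta>] (mod p) \<and> p ^ Suc (Suc N) dvd poly h t ^ k - poly l t" if t: "p dvd t" for t
  proof
    define e where "e = poly E t"
    define x where "x = poly g t"
    have e: "p ^ Suc N dvd e" "e = x ^ k - poly l t" using g(2)[OF t] by (simp_all add: e_def E_def x_def)
    have pe: "p dvd e" using e(1) by (metis dvd_mult_left power_Suc)
    have hx: "poly h t = x - \<kappa> * e" by (simp add: h_def e_def x_def)
    show "[poly h t = \<zeta>] (mod p)"
    proof -
      have "p dvd (x - \<zeta>) - \<kappa> * e"
        using g(1)[OF t] pe dvd_diff[of p "x - \<zeta>" "\<kappa> * e"] unfolding x_def[symmetric] cong_iff_dvd_diff by simp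
      thus ?thesis unfolding hx cong_iff_dvd_diff by (simp add: algebra_simps)
    qed
    have S: "[(\<Sum>i<k. x ^ (k - Suc i) * (x - \<kappa> * e) ^ i) = int k * \<zeta> ^ (k - 1)] (mod p)"
    proof -
      have "[x - \<kappa> * e = \<zeta>] (mod p)" "[x = \<zeta>] (mod p)"
        using \<open>[poly h t = \<zeta>] (mod p)\<close> hx g(1)[OF t] by (simp_all add: x_def)
      hence "[(\<Sum>i<k. x ^ (k - Suc i) * (x - \<kappa> * e) ^ i) = (\<Sum>i<k. \<zeta> ^ (k - Suc i) * \<zeta> ^ i)] (mod p)"
        by (intro cong_sum cong_mult cong_pow)
      thus ?thesis by (simp flip: power_add)
    qed
    have "(x - \<kappa> * e) ^ k - x ^ k = - (\<kappa> * e) * (\<Sum>i<k. x ^ (k - Suc i) * (x - \<kappa> * e) ^ i)"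
      using power_diff_sumr2[of "x - \<kappa> * e" k x] by (simp add: mult.commute)
    hence eq: "poly h t ^ k - poly l t = e * (1 - \<kappa> * (\<Sum>i<k. x ^ (k - Suc i) * (x - \<kappa> * e) ^ i))"
    proof -
      have "poly h t ^ k - poly l t = ((x - \<kappa> * e) ^ k - x ^ k) + (x ^ k - poly l t)" by (simp add: hx)
      also have "\<dots> = - (\<kappa> * e) * (\<Sum>i<k. x ^ (k - Suc i) * (x - \<kappa> * e) ^ i) + e"
        using \<open>(x - \<kappa> * e) ^ k - x ^ k = _\<close> e(2) by (simp only:)
      finally show ?thesis by (simp only: right_diff_distrib mult_1_right mult_minus_left mult.assoc mult.left_commute[of e])
    qed
    have "[\<kappa> * (\<Sum>i<k. x ^ (k - Suc i) * (x - \<kappa> * e) ^ i) = 1] (mod p)"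
      using cong_mult[OF cong_refl[of \<kappa>] S] \<kappa> by (metis cong_trans mult.commute)
    hence "p dvd 1 - \<kappa> * (\<Sum>i<k. x ^ (k - Suc i) * (x - \<kappa> * e) ^ i)"
      by (simp add: cong_iff_dvd_diff dvd_diff_commute)
    from mult_dvd_mono[OF e(1) this] show "p ^ Suc (Suc N) dvd poly h t ^ k - poly l t"
      unfolding eq by (simp only: power_Suc mult_ac)
  qed
  thus ?case by blast
qed

text \<open>Siegel's lemma by pigeonhole: for \<open>p dvd u\<close> only the coefficient of \<open>u^h\<close> modulo \<open>p^(N - h)\<close> matters.\<close>
lemma small_combination:
  fixes G :: "'e \<Rightarrow> int poly" and p :: int
  assumes B: "finite B" and p: "p > 1" and card: "N * Suc N < 2 * (card B * j)"
  shows "\<exists>q :: 'e \<Rightarrow> int. (\<exists>e\<in>B. q e \<noteq> 0) \<and> (\<forall>e\<in>B. \<bar>q e\<bar> < p ^ j) \<and>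
    (\<forall>u. p dvd u \<longrightarrow> p ^ N dvd (\<Sum>e\<in>B. q e * poly (G e) u))"
proof -
  define Q where "Q = (B \<rightarrow>\<^sub>E {0..<p ^ j})"
  \<comment> \<open>\<open>R\<close> has \<open>p^(N (N + 1) / 2)\<close> elements and
    \<open>Q\<close> has \<open>p^(card B * j)\<close>; the hypothesis \<open>card\<close> compares
    these exponents.\<close>
  define R where "R = (\<Pi>\<^sub>E h\<in>{..<N}. {0..<p ^ (N - h)})"
  define \<phi> where "\<phi> q = (\<lambda>h\<in>{..<N}. (\<Sum>e\<in>B. q e * coeff (G e) h) mod p ^ (N - h))" for q
  have fin: "finite Q" "finite R" using B by (auto simp: Q_def R_def intro!: finite_PiE)
  have "card R = (\<Prod>h<N. nat (p ^ (N - h)))" by (simp add: R_def card_PiE)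
  also have "\<dots> = nat p ^ (\<Sum>h<N. N - h)"
    using p by (simp add: nat_power_eq power_sum)
  also have "(\<Sum>h<N. N - h) = (\<Sum>h\<le>N. h)"
  proof -
    have "(\<Sum>h<N. N - h) = (\<Sum>h\<in>{1..N}. h)"
      by (rule sum.reindex_bij_witness[of _ "\<lambda>h. N - h" "\<lambda>h. N - h"]) auto
    also have "\<dots> = (\<Sum>h\<le>N. h)" by (intro sum.mono_neutral_left) auto
    finally show ?thesis .
  qed
  finally have cR: "card R = nat p ^ (\<Sum>h\<le>N. h)" .
  have cQ: "card Q = nat p ^ (card B * j)"
    using B p by (simp add: Q_def card_PiE nat_power_eq power_mult[symmetric] mult.commute)
  have "2 * (\<Sum>h\<le>N. h) = N * Suc N" by (induction N) auto
  hence "(\<Sum>h\<le>N. h) < card B * j" using card by linarith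
  hence "card R < card Q" unfolding cR cQ using p by (intro power_strict_increasing) auto
  moreover have "\<phi> ` Q \<subseteq> R" using p by (auto simp: \<phi>_def R_def PiE_def Pi_def extensional_def)
  ultimately have "\<not> inj_on \<phi> Q" using fin card_inj_on_le[of \<phi> Q R] by linarith
  then obtain q1 q2 where q: "q1 \<in> Q" "q2 \<in> Q" "q1 \<noteq> q2" "\<phi> q1 = \<phi> q2" by (auto simp: inj_on_def)
  define q where "q e = q1 e - q2 e" for e
  have "\<exists>e\<in>B. q e \<noteq> 0"
  proof (rule ccontr)
    assume "\<not> ?thesis"
    hence "q1 = q2" using q unfolding Q_def by (intro PiE_ext[of q1 B _ q2]) (auto simp: q_def)
    thus False using q by simp
  qed
  moreover have "\<bar>q e\<bar> < p ^ j" if "e \<in> B" for e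
  proof -
    have "q1 e \<in> {0..<p ^ j}" "q2 e \<in> {0..<p ^ j}" using q that by (auto simp: Q_def)
    thus ?thesis unfolding q_def atLeastLessThan_iff by linarith
  qed
  moreover have "p ^ N dvd (\<Sum>e\<in>B. q e * poly (G e) u)" if u: "p dvd u" for u
  proof -
    define F where "F = (\<Sum>e\<in>B. smult (q e) (G e))"
    have cF: "p ^ (N - h) dvd coeff F h" if h: "h < N" for h
    proof -
      have "(\<Sum>e\<in>B. q1 e * coeff (G e) h) mod p ^ (N - h) = (\<Sum>e\<in>B. q2 e * coeff (G e) h) mod p ^ (N - h)"
        using fun_cong[OF q(4), of h] h by (simp add: \<phi>_def)
      hence "p ^ (N - h) dvd (\<Sum>e\<in>B. q1 e * coeff (G e) h) - (\<Sum>e\<in>B. q2 e * coeff (G e) h)"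
        by (simp add: mod_eq_dvd_iff)
      thus ?thesis by (simp add: F_def coeff_sum q_def left_diff_distrib sum_subtractf)
    qed
    have "p ^ N dvd coeff F h * u ^ h" for h
    proof (cases "h < N")
      case True
      have "p ^ (N - h) * p ^ h dvd coeff F h * u ^ h"
        using cF[OF True] u by (intro mult_dvd_mono dvd_power_same)
      thus ?thesis using True by (simp flip: power_add)
    next
      case False
      have "p ^ N dvd p ^ h" using False by (intro le_imp_power_dvd) simp
      also have "p ^ h dvd u ^ h" using u by (rule dvd_power_same)
      finally show ?thesis by simp
    qed
    hence "p ^ N dvd poly F u" unfolding poly_altdef by (intro dvd_sum) auto
    thus ?thesis by (simp add: F_def poly_sum)
  qed
  ultimately show ?thesis by blast
qed

text \<open>The conclusion reads \<open>1/x = 1/y - 1/z\<close>, the recursion of the Leibniz harmonic triangle: a common multiple of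
  \<open>y\<close> and \<open>z\<close> is one of \<open>x\<close>.\<close>
lemma leibniz_identity:
  fixes x y z a b c :: int
  assumes "a * x = c * y" "b * z = c * y" "c = b + a" "a \<noteq> 0" "b \<noteq> 0"
  shows "x * (z - y) = y * z"
proof -
  have *: "b * (z - y) = a * y" using assms(2,3) by (simp add: algebra_simps)
  have "b * (a * (x * (z - y))) = (a * x) * (b * (z - y))" by (simp only: mult_ac)
  also have "\<dots> = (a * x) * (a * y)" by (simp only: *)
  also have "\<dots> = a * y * (b * z)" unfolding assms(1,2) by (simp only: mult_ac)
  finally have "(a * b) * (x * (z - y)) = (a * b) * (y * z)" by (simp only: mult_ac)
  thus ?thesis using assms(4,5) by simp
qed

text \<open>Induction over the rows of Leibniz's triangle and along each row: the denominator
  \<open>x\<close> is reached from \<open>y\<close> in the row above and from its left neighbour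
  \<open>z\<close>.\<close>

lemma binomial_dvd_Lcm: "k \<le> n \<Longrightarrow> Suc n * (n choose k) dvd Lcm {1..Suc n}"
proof (induction n arbitrary: k)
  case (Suc n)
  note outer = Suc.IH
  show ?case using Suc.prems
  proof (induction k)
    case 0
    show ?case by (simp add: dvd_Lcm)
  next
    case (Suc k)
    let ?l = "Lcm {1..Suc (Suc n)}"
    define y where "y = Suc n * (n choose k)"
    define z where "z = Suc (Suc n) * (Suc n choose k)"
    define x where "x = Suc (Suc n) * (Suc n choose Suc k)"
    have "Lcm {1..Suc n} dvd ?l" by (rule Lcm_subset) auto
    moreover have "y dvd Lcm {1..Suc n}" unfolding y_def using Suc.prems by (intro outer) simp
    ultimately have "y dvd ?l" by (rule dvd_trans[rotated])
    then obtain u where u: "?l = y * u" by auto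
    have "z dvd ?l" unfolding z_def using Suc by simp
    then obtain v where v: "?l = z * v" by auto
    have pos: "y > 0" "z > 0" using Suc.prems by (simp_all add: y_def z_def)
    have 1: "Suc k * x = Suc (Suc n) * y"
      using binomial_absorption[of k "Suc n"] by (simp add: x_def y_def algebra_simps del: binomial_Suc_Suc)
    have 2: "(Suc n - k) * z = Suc (Suc n) * y"
      using binomial_absorb_comp[of "Suc n" k] by (simp add: z_def y_def algebra_simps del: binomial_Suc_Suc)
    have e1: "int (Suc k) * int x = int (Suc (Suc n)) * int y" using 1 by (metis of_nat_mult)
    have e2: "(int (Suc n) - int k) * int z = int (Suc (Suc n)) * int y"
      using 2 Suc.prems by (metis Suc_leD of_nat_diff of_nat_mult)
    have e3: "int (Suc (Suc n)) = (int (Suc n) - int k) + int (Suc k)" by simp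
    have xyz: "int x * (int z - int y) = int y * int z"
      using leibniz_identity[OF e1 e2 e3] Suc.prems by simp
    define l where "l = int ?l"
    have l: "l = int y * int u" "l = int z * int v"
      using arg_cong[OF u, of int] arg_cong[OF v, of int] unfolding l_def by (simp_all only: of_nat_mult)
    have "int y * int z * (int x * (int u - int v)) = int x * (int z * (int y * int u) - int y * (int z * int v))"
      by (simp add: algebra_simps)
    also have "\<dots> = (int x * (int z - int y)) * l" unfolding l(1)[symmetric] l(2)[symmetric] by (simp add: algebra_simps)
    finally have "int y * int z * (int x * (int u - int v)) = int y * int z * l" unfolding xyz .
    hence "l = int x * (int u - int v)" using pos by simp
    hence "int ?l = int x * (int u - int v)" unfolding l_def .
    hence "int x dvd int ?l" by (metis dvd_triv_left)
    thus ?case unfolding x_def by (simp only: int_dvd_int_iff)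
  qed
qed simp

text \<open>Nair's argument: the central binomial coefficient is the largest of
  \<open>2 m + 1\<close> that sum to \<open>4^m\<close>, and \<open>2 m + 1\<close> times it divides
  the least common multiple.\<close>

lemma Lcm_ge: "4 ^ m \<le> Lcm {1..2 * m + 1 :: nat}"
proof -
  have "4 ^ m = (\<Sum>i\<le>2 * m. (2 * m) choose i)"
    using choose_row_sum[of "2 * m"] by (simp add: power_mult)
  also have "\<dots> \<le> (\<Sum>i\<le>2 * m. (2 * m) choose m)" by (intro sum_mono binomial_maximum')
  also have "\<dots> = Suc (2 * m) * ((2 * m) choose m)" by simp
  also have "\<dots> \<le> Lcm {1..Suc (2 * m)}"
  proof (rule dvd_imp_le[OF binomial_dvd_Lcm])
    have "Lcm {1..Suc (2 * m)} \<noteq> 0" by (subst Lcm_0_iff) auto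
    thus "Lcm {1..Suc (2 * m)} > 0" by (simp only: neq0_conv)
  qed simp
  finally show ?thesis by simp
qed

text \<open>If every prime up to \<open>2 m + 1\<close> divided \<open>Z\<close>, the least common
  multiple would divide \<open>Z^e\<close>, since prime powers up to
  \<open>2 m + 1 \<le> 2^e\<close> have exponents at most \<open>e\<close>. \<open>Lcm_ge\<close>
  contradicts this.\<close>

lemma prime_not_dividing:
  fixes Z :: nat
  assumes Z: "Z > 0" "Z ^ e < 4 ^ m" "2 * m + 1 \<le> 2 ^ e"
  shows "\<exists>p. prime p \<and> p \<le> 2 * m + 1 \<and> \<not> p dvd Z"
proof (rule ccontr)
  assume no: "\<not> ?thesis"
  have "Lcm {1..2 * m + 1} dvd Z ^ e"
  proof (rule Lcm_least)
    fix j assume j: "j \<in> {1..2 * m + 1}"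
    show "j dvd Z ^ e"
    proof (rule multiplicity_le_imp_dvd)
      show "j \<noteq> 0" using j by simp
      fix p :: nat assume p: "prime p"
      show "multiplicity p j \<le> multiplicity p (Z ^ e)"
      proof (cases "p dvd j")
        case True
        hence "p \<le> 2 * m + 1" using j dvd_imp_le[of p j] by simp
        hence "p dvd Z" using no p by blast
        hence "1 \<le> multiplicity p Z" using Z(1) p by (intro multiplicity_geI) auto
        hence "e \<le> multiplicity p (Z ^ e)" using p Z(1) by (simp add: prime_elem_multiplicity_power_distrib)
        moreover have "multiplicity p j \<le> e"
        proof -
          have "2 ^ multiplicity p j \<le> p ^ multiplicity p j" using p by (intro power_mono prime_ge_2_nat) auto
          also have "\<dots> \<le> j" using j by (intro dvd_imp_le multiplicity_dvd) auto
          also have "\<dots> \<le> 2 ^ e" using j Z(3) by simp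
          finally show ?thesis by simp
        qed
        ultimately show ?thesis by linarith
      qed (simp add: not_dvd_imp_multiplicity_0)
    qed
  qed
  hence "Lcm {1..2 * m + 1} \<le> Z ^ e" using Z(1) by (intro dvd_imp_le) auto
  thus False using Lcm_ge[of m] Z(2) by linarith
qed

text \<open>Put \<open>D = k^s\<close>. Modulo \<open>p^(D - 1)\<close> the monomials in the
  \<open>z i c\<close> agree with polynomials in \<open>c - c1\<close>, so
  \<open>small_combination\<close> yields a combination that is divisible by
  \<open>p^(D - 1)\<close> at every \<open>c\<close> in \<open>T\<close>. The hypothesis
  \<open>big\<close> makes its values smaller than that, hence 0, and \<open>zeros_bound\<close>
  counts such \<open>c\<close>.\<close>

lemma residue_class_bound:
  fixes a :: "nat \<Rightarrow> nat" and n :: int and p s k b :: nat and z :: "nat \<Rightarrow> nat \<Rightarrow> nat"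
  assumes n: "n \<noteq> 0" and a: "\<And>i. i < s \<Longrightarrow> a i > 0" "inj_on a {..<s}"
    and p: "prime p" "\<not> p dvd k"
    and T: "finite T" "\<And>c i. c \<in> T \<Longrightarrow> i < s \<Longrightarrow> int (a i) * int c + n = int (z i c) ^ k"
      "\<And>c i. c \<in> T \<Longrightarrow> i < s \<Longrightarrow> z i c > 0 \<and> z i c ^ k \<le> 2 ^ b \<and> \<not> p dvd z i c"
    and cls: "\<And>c d. c \<in> T \<Longrightarrow> d \<in> T \<Longrightarrow> [c = d] (mod p)"
      "\<And>c d i. c \<in> T \<Longrightarrow> d \<in> T \<Longrightarrow> i < s \<Longrightarrow> [z i c = z i d] (mod p)"
    and big: "2 \<le> k ^ s" "k ^ s * 2 ^ (b * s) \<le> 2 ^ (k ^ s - 1 - (k ^ s + 1) div 2)"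
  shows "card T \<le> s * k ^ s"
proof (cases "T = {}")
  case False
  then obtain c1 where c1: "c1 \<in> T" by blast
  have k: "k > 0" using p(2) by (cases k) auto
  interpret linear_forms s k "\<lambda>i. real (a i)" "real_of_int n"
    using k n a by unfold_locales (auto simp: inj_on_def)
  define P where "P = int p"
  have P: "prime P" "P > 1" "\<not> P dvd int k" using p prime_gt_1_nat[of p] by (auto simp: P_def)
  define D where "D = k ^ s"
  have D2: "D \<ge> 2" using big(1) by (simp only: D_def)
  \<comment> \<open>The linear form recentred at \<open>c1\<close>: the new argument
    \<open>c - c1\<close> is divisible by \<open>p\<close> for all \<open>c\<close> in
    \<open>T\<close>, as Hensel lifting and \<open>small_combination\<close> require.\<close>
  define l where "l i = [:int (a i) * int c1 + n, int (a i):]" for i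
  have l: "poly (l i) (int c - int c1) = int (z i c) ^ k" if "i < s" "c \<in> T" for i c
    using T(2)[OF that(2,1)] by (simp add: l_def algebra_simps)
  have "\<exists>g :: int poly. \<forall>t. P dvd t \<longrightarrow> [poly g t = int (z i c1)] (mod P) \<and> P ^ Suc (D - 2) dvd poly g t ^ k - poly (l i) t"
    if i: "i < s" for i
  proof (rule hensel_polynomial[OF P(1,3)])
    show "\<not> P dvd int (z i c1)" using T(3)[OF c1 i] by (simp add: P_def)
    fix t assume "P dvd t"
    moreover have "poly (l i) t - int (z i c1) ^ k = t * int (a i)"
      using T(2)[OF c1 i] by (simp add: l_def)
    ultimately show "[poly (l i) t = int (z i c1) ^ k] (mod P)" by (simp add: cong_iff_dvd_diff)
  qed
  then obtain g where g: "\<And>i t. i < s \<Longrightarrow> P dvd t \<Longrightarrow> [poly (g i) t = int (z i c1)] (mod P)"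
    "\<And>i t. i < s \<Longrightarrow> P dvd t \<Longrightarrow> P ^ Suc (D - 2) dvd poly (g i) t ^ k - poly (l i) t"
    by metis
  have DN: "Suc (D - 2) = D - 1" using D2 by simp
  have zg: "[int (z i c) = poly (g i) (int c - int c1)] (mod P ^ (D - 1))" if i: "i < s" and c: "c \<in> T" for i c
  proof -
    have t: "P dvd int c - int c1"
      using cls(1)[OF c c1] by (simp add: P_def cong_int_iff flip: cong_iff_dvd_diff)
    have "[int (z i c) = int (z i c1)] (mod P)" using cls(2)[OF c c1 i] by (simp add: P_def cong_int_iff)
    hence "[int (z i c) = poly (g i) (int c - int c1)] (mod P)" using g(1)[OF i t] by (metis cong_sym cong_trans)
    moreover have "P ^ (D - 1) dvd int (z i c) ^ k - poly (g i) (int c - int c1) ^ k"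
      using g(2)[OF i t] l[OF i c] DN by (metis dvd_diff_commute)
    moreover have "\<not> P dvd int (z i c)" using T(3)[OF c i] by (simp add: P_def)
    ultimately have "P ^ (D - 1) dvd int (z i c) - poly (g i) (int c - int c1)"
      using power_diff_dvd_lift[OF P(1,3)] by blast
    thus ?thesis by (simp add: cong_iff_dvd_diff)
  qed
  define G where "G e = (\<Prod>i<s. g i ^ e i)" for e
  \<comment> \<open>Coefficients with half as many digits as the modulus: \<open>2 j \<ge> D\<close>
    is enough for the pigeonhole count, and the other half of the digits is left for the size of the
    monomials.\<close>
  define j where "j = (D + 1) div 2"
  have DB: "card Box = D" by (simp add: card_Box D_def)
  have "(D - 1) * Suc (D - 1) < 2 * (card Box * j)"
  proof -
    have "D - 1 < 2 * j" using D2 by (simp add: j_def)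
    hence "(D - 1) * D < 2 * j * D" using D2 by simp
    moreover have "Suc (D - 1) = D" using D2 by simp
    ultimately show ?thesis by (simp add: DB mult_ac)
  qed
  from small_combination[OF finite_Box P(2) this, of G]
  obtain q where q: "\<exists>e\<in>Box. q e \<noteq> 0" "\<And>e. e \<in> Box \<Longrightarrow> \<bar>q e\<bar> < P ^ j"
    "\<And>u. P dvd u \<Longrightarrow> P ^ (D - 1) dvd (\<Sum>e\<in>Box. q e * poly (G e) u)" by blast
  have zero: "(\<Sum>e\<in>Box. q e * (\<Prod>i<s. int (z i c) ^ e i)) = 0" if c: "c \<in> T" for c
  proof -
    let ?S = "\<Sum>e\<in>Box. q e * (\<Prod>i<s. int (z i c) ^ e i)"
    have cong: "[?S = (\<Sum>e\<in>Box. q e * poly (G e) (int c - int c1))] (mod P ^ (D - 1))"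
      unfolding G_def poly_prod poly_power
      using zg[OF _ c] by (intro cong_sum cong_mult cong_refl cong_prod cong_pow) auto
    have "P dvd int c - int c1"
      using cls(1)[OF c c1] by (simp add: P_def cong_int_iff flip: cong_iff_dvd_diff)
    hence dvd: "P ^ (D - 1) dvd \<bar>?S\<bar>" using q(3) cong_dvd_iff[OF cong] by simp
    have "\<bar>?S\<bar> < P ^ (D - 1)"
    proof -
      have summand: "\<bar>q e * (\<Prod>i<s. int (z i c) ^ e i)\<bar> \<le> (P ^ j - 1) * 2 ^ (b * s)" if e: "e \<in> Box" for e
      proof -
        have "(\<Prod>i<s. int (z i c) ^ e i) \<le> (\<Prod>i<s. 2 ^ b)"
        proof (rule prod_mono)
          fix i assume i: "i \<in> {..<s}"
          have "int (z i c) ^ e i \<le> int (z i c) ^ k"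
            using T(3)[OF c, of i] i e by (intro power_increasing) (auto simp: Box_def PiE_iff less_imp_le)
          also have "\<dots> = int (z i c ^ k)" by simp
          also have "\<dots> \<le> int (2 ^ b)" using T(3)[OF c, of i] i by (simp only: of_nat_le_iff lessThan_iff)
          finally show "0 \<le> int (z i c) ^ e i \<and> int (z i c) ^ e i \<le> 2 ^ b" by simp
        qed
        also have "\<dots> = 2 ^ (b * s)" by (simp add: power_mult)
        finally have "(\<Prod>i<s. int (z i c) ^ e i) \<le> 2 ^ (b * s)" .
        moreover have "(\<Prod>i<s. int (z i c) ^ e i) \<ge> 0" by (intro prod_nonneg) auto
        ultimately show ?thesis using q(2)[OF e] unfolding abs_mult by (intro mult_mono) auto
      qed
      have "\<bar>?S\<bar> \<le> (\<Sum>e\<in>Box. (P ^ j - 1) * 2 ^ (b * s))"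
        by (intro order.trans[OF sum_abs] sum_mono summand)
      also have "\<dots> = (P ^ j - 1) * int (D * 2 ^ (b * s))" by (simp add: DB)
      also have "\<dots> < P ^ j * int (D * 2 ^ (b * s))"
        using D2 by (intro mult_strict_right_mono) auto
      also have "\<dots> \<le> P ^ j * P ^ (D - 1 - j)"
      proof (rule mult_left_mono)
        have "int (D * 2 ^ (b * s)) \<le> int (2 ^ (D - 1 - j))"
          unfolding of_nat_le_iff D_def j_def by (rule big(2))
        also have "\<dots> = 2 ^ (D - 1 - j)" by simp
        also have "\<dots> \<le> P ^ (D - 1 - j)" using P(2) by (intro power_mono) auto
        finally show "int (D * 2 ^ (b * s)) \<le> P ^ (D - 1 - j)" .
      qed (use P(2) in auto)
      also have "\<dots> = P ^ (D - 1)"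
      proof -
        \<comment> \<open>The subtraction in \<open>big\<close> is truncated: for
          \<open>j > D - 1\<close> its exponent would be 0, forcing
          \<open>k^s \<le> 1\<close>.\<close>
        have "j \<le> D - 1"
        proof (rule ccontr)
          assume "\<not> j \<le> D - 1"
          hence "k ^ s - 1 - (k ^ s + 1) div 2 = 0" by (simp add: j_def D_def)
          hence "k ^ s * 2 ^ (b * s) \<le> 1" using big(2) by simp
          moreover have "k ^ s * 1 \<le> k ^ s * 2 ^ (b * s)" by (intro mult_le_mono) auto
          ultimately show False using big(1) by linarith
        qed
        thus ?thesis by (simp only: power_add[symmetric] le_add_diff_inverse)
      qed
      finally show ?thesis .
    qed
    hence "\<not> \<bar>?S\<bar> > 0" using zdvd_not_zless[of "\<bar>?S\<bar>" "P ^ (D - 1)"] dvd by blast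
    thus ?thesis by linarith
  qed
  have real_z: "poly (L i) (real c) = real (z i c) ^ k" if "i < s" "c \<in> T" for i c
  proof -
    have "real_of_int (int (a i) * int c + n) = real_of_int (int (z i c) ^ k)" using T(2)[OF that(2,1)] by simp
    thus ?thesis by (simp add: L_def algebra_simps)
  qed
  have y_z: "y e (real c) = (\<Prod>i<s. real (z i c) ^ e i)" if c: "c \<in> T" for e c
  proof -
    have "y e (real c) = exp (\<Sum>i<s. real (e i) * ln (real (z i c)))"
      unfolding y_def
    proof (intro arg_cong[where f = exp] sum.cong refl)
      fix i assume i: "i \<in> {..<s}"
      have "ln (real (z i c) ^ k) = real k * ln (real (z i c))" using T(3)[OF c, of i] i by (simp add: ln_realpow)
      thus "real (e i) / real k * ln (poly (L i) (real c)) = real (e i) * ln (real (z i c))"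
        using real_z[OF _ c, of i] i k by simp
    qed
    also have "\<dots> = (\<Prod>i<s. exp (real (e i) * ln (real (z i c))))" by (simp add: exp_sum)
    also have "\<dots> = (\<Prod>i<s. real (z i c) ^ e i)"
      using T(3)[OF c] by (intro prod.cong) (auto simp: exp_of_nat_mult)
    finally show ?thesis .
  qed
  obtain e0 where e0: "e0 \<in> Box" "q e0 \<noteq> 0" using q(1) by blast
  have "card (real ` T) \<le> s * k ^ s"
  proof (rule zeros_bound[of e0 "\<lambda>e. real_of_int (q e)"])
    fix x i assume "x \<in> real ` T" "i < s"
    thus "poly (L i) x > 0" using real_z T(3) by fastforce
  next
    fix x assume "x \<in> real ` T"
    then obtain c where c: "c \<in> T" "x = real c" by blast
    have "(\<Sum>e\<in>Box. real_of_int (q e) * y e x) = real_of_int (\<Sum>e\<in>Box. q e * (\<Prod>i<s. int (z i c) ^ e i))"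
      unfolding c(2) y_z[OF c(1)] by simp
    thus "(\<Sum>e\<in>Box. real_of_int (q e) * y e x) = 0" using zero[OF c(1)] by simp
  qed (use e0 T(1) in auto)
  moreover have "card (real ` T) = card T" by (intro card_image) (auto simp: inj_on_def)
  ultimately show ?thesis by simp
qed simp

section \<open>Elements of polynomial size\<close>

lemma card_le_fibers:
  assumes "finite B" "finite R" "f ` B \<subseteq> R" "\<And>r. r \<in> R \<Longrightarrow> card {b \<in> B. f b = r} \<le> t"
  shows "card B \<le> card R * t"
proof -
  have "B = (\<Union>r\<in>R. {b \<in> B. f b = r})" using assms(3) by auto
  hence "card B \<le> (\<Sum>r\<in>R. card {b \<in> B. f b = r})" using card_UN_le[OF assms(2), of "\<lambda>r. {b \<in> B. f b = r}"] by simp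
  also have "\<dots> \<le> card R * t" using sum_bounded_above[of R "\<lambda>r. card {b \<in> B. f b = r}" t] assms(4) by simp
  finally show ?thesis .
qed

lemma exists_monochromatic_injection:
  fixes c :: "'a \<Rightarrow> 'c"
  assumes "finite U" "finite K" "c ` U \<subseteq> K" "card K * (s - 1) < card U"
  shows "\<exists>k\<in>K. \<exists>f\<in>{..<s} \<rightarrow>\<^sub>E U. inj_on f {..<s} \<and> (\<forall>i<s. c (f i) = k)"
proof -
  obtain k where k: "k \<in> K" "\<not> card {a \<in> U. c a = k} \<le> s - 1"
    using card_le_fibers[OF assms(1-3), of "s - 1"] assms(4) by fastforce
  hence "s \<le> card {a \<in> U. c a = k}" by linarith
  then obtain S where S: "S \<subseteq> {a \<in> U. c a = k}" "card S = s" "finite S" by (rule obtain_subset_with_card_n)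
  obtain h where h: "bij_betw h {0..<s} S" using ex_bij_betw_nat_finite[OF S(3)] S(2) by auto
  have hS: "h i \<in> S" if "i < s" for i using h that by (auto simp: bij_betw_def)
  have "restrict h {..<s} \<in> {..<s} \<rightarrow>\<^sub>E U" using hS S(1) by auto
  moreover have "inj_on (restrict h {..<s}) {..<s}" using h by (auto simp: bij_betw_def inj_on_def)
  moreover have "\<forall>i<s. c (restrict h {..<s} i) = k" using hS S(1) by auto
  ultimately show ?thesis using k(1) by blast
qed

lemma mult_16_le_power: "q \<ge> 8 \<Longrightarrow> 16 * (q + 1) \<le> (2::nat) ^ q"
  by (induction q rule: dec_induct) auto

text \<open>Supplies the hypothesis \<open>big\<close> of \<open>residue_class_bound\<close> once
  the number \<open>D\<close> of monomials dominates the bit length \<open>b\<close> of their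
  values.\<close>

lemma pad_le_power:
  fixes D b :: nat
  assumes "D \<ge> 1024" "8 * b \<le> D"
  shows "D * 2 ^ b \<le> 2 ^ (D - 1 - (D + 1) div 2)"
proof -
  define q where "q = D div 16"
  have "D < 16 * (q + 1)" "q \<ge> 8" using assms(1) unfolding q_def by presburger+
  hence "D \<le> 2 ^ q" using mult_16_le_power[of q] by linarith
  hence "D * 2 ^ b \<le> 2 ^ q * 2 ^ b" by (rule mult_le_mono1)
  also have "\<dots> = 2 ^ (q + b)" by (simp add: power_add)
  also have "\<dots> \<le> 2 ^ (D - 1 - (D + 1) div 2)"
  proof (rule power_increasing)
    have "16 * q \<le> D" "2 * ((D + 1) div 2) \<le> D + 1" unfolding q_def by presburger+
    thus "q + b \<le> D - 1 - (D + 1) div 2" using assms by linarith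
  qed simp
  finally show ?thesis .
qed

text \<open>The bit length 37 comes from \<open>2 (17 l + 1)\<close> for the product and
  \<open>l\<close> for \<open>n\<close>, rounded up with the help of
  \<open>l \<ge> 1\<close>.\<close>

lemma D_property_representation:
  assumes A: "D_property n A" "A \<subseteq> {..2 ^ (17 * l + 1)}" and n: "\<bar>n\<bar> \<le> 2 ^ l" and l: "l \<ge> 1"
    and ab: "a \<in> A" "b \<in> A" "a \<noteq> b"
  shows "\<exists>k z. 2 \<le> k \<and> k \<le> 37 * l \<and> z > 0 \<and> z ^ k \<le> 2 ^ (37 * l) \<and> int a * int b + n = int z ^ k"
proof -
  have "int a * int b + n \<in> int ` perfect_powers" using A(1) ab unfolding D_property_def by blast
  then obtain x k where x: "x \<ge> 1" "k \<ge> 2" "int a * int b + n = int (x ^ k)" unfolding perfect_powers_def by blast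
  have "a \<le> 2 ^ (17 * l + 1)" "b \<le> 2 ^ (17 * l + 1)" using A(2) ab by auto
  hence "a * b \<le> 2 ^ (17 * l + 1) * 2 ^ (17 * l + 1)" by (rule mult_le_mono)
  also have "\<dots> = 2 ^ (34 * l + 2)"
  proof -
    have e: "34 * l + 2 = (17 * l + 1) + (17 * l + 1)" by simp
    show ?thesis by (subst e) (rule power_add[symmetric])
  qed
  also have "\<dots> \<le> 2 ^ (36 * l)" using l by (intro power_increasing) auto
  finally have "int (a * b) \<le> int (2 ^ (36 * l))" by (simp only: of_nat_le_iff)
  moreover have "(2::int) ^ l \<le> 2 ^ (36 * l)" by (intro power_increasing) auto
  ultimately have "int (x ^ k) \<le> 2 * 2 ^ (36 * l)" using x(3) n by (simp only: of_nat_mult of_nat_power of_nat_numeral)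
  also have "\<dots> = 2 ^ (36 * l + 1)" by simp
  also have "\<dots> \<le> 2 ^ (37 * l)" using l by (intro power_increasing) auto
  also have "\<dots> = int (2 ^ (37 * l))" by simp
  finally have xk: "x ^ k \<le> 2 ^ (37 * l)" by (simp only: of_nat_le_iff)
  show ?thesis
  \<comment> \<open>The number 1 is a power with every exponent; the choice 2 keeps the exponent
    within the range.\<close>
  proof (cases "x = 1")
    case True
    thus ?thesis using x l xk by (intro exI[of _ 2] exI[of _ 1]) auto
  next
    case False
    hence "(2::nat) ^ k \<le> x ^ k" using x(1) by (intro power_mono) auto
    hence "(2::nat) ^ k \<le> 2 ^ (37 * l)" using xk by linarith
    hence "k \<le> 37 * l" by (simp add: power_increasing_iff)
    thus ?thesis using x xk by (intro exI[of _ k] exI[of _ x]) auto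
  qed
qed

text \<open>Meant for \<open>Z = k * (\<Prod>i<s. z i)\<close>. Since \<open>2^m\<close> may be
  chosen of the order of \<open>l\<close>, the prime is bounded by a power of \<open>l\<close>. It
  is \<open>prime_not_dividing\<close> with \<open>2^(4 m)\<close> for \<open>m\<close> and
  \<open>e = 4 m + 2\<close>.\<close>

lemma small_prime_bound:
  fixes Z l m :: nat
  assumes "1024 * l \<le> 2 ^ m" "m \<ge> 10" "Z > 0" "Z \<le> 2 ^ (37 * l * (2 * m + 1))"
  shows "\<exists>p. prime p \<and> p \<le> 2 ^ (4 * m + 2) \<and> \<not> p dvd Z"
proof -
  have m: "2 * m + 1 \<le> 2 ^ m" using assms(2)
    by (induction m rule: dec_induct) auto
  have e: "2 * 2 ^ (4 * m) + 1 \<le> (2::nat) ^ (4 * m + 2)" by simp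
  have "Z ^ (4 * m + 2) \<le> (2 ^ (37 * l * (2 * m + 1))) ^ (4 * m + 2)" using assms(4) by (intro power_mono) auto
  also have "\<dots> = 2 ^ (37 * l * (2 * m + 1) * (4 * m + 2))" by (simp only: power_mult)
  also have "\<dots> < 2 ^ (2 * 2 ^ (4 * m))"
  proof (rule power_strict_increasing)
    have "37 * l * (2 * m + 1) * (4 * m + 2) = 74 * l * ((2 * m + 1) * (2 * m + 1))" by (simp add: algebra_simps)
    also have "\<dots> \<le> 74 * l * (2 ^ m * 2 ^ m)" by (intro mult_le_mono m) auto
    also have "\<dots> \<le> 2 ^ m * (2 ^ m * 2 ^ m)" using assms(1) by (intro mult_le_mono) auto
    also have "\<dots> = 2 ^ (3 * m)" by (simp flip: power_add)
    also have "\<dots> \<le> 2 ^ (4 * m)" by (intro power_increasing) auto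
    also have "\<dots> < 2 * 2 ^ (4 * m)" by simp
    finally show "37 * l * (2 * m + 1) * (4 * m + 2) < 2 * 2 ^ (4 * m)" .
  qed simp
  also have "2 ^ (2 * K) = (4::nat) ^ K" for K by (subst power_mult) simp
  finally have "Z ^ (4 * m + 2) < 4 ^ (2 ^ (4 * m))" .
  then obtain p where p: "prime p" "p \<le> 2 * 2 ^ (4 * m) + 1" "\<not> p dvd Z"
    using prime_not_dividing[OF assms(3) \<open>Z ^ (4 * m + 2) < 4 ^ (2 ^ (4 * m))\<close> e] by blast
  thus ?thesis using e by (meson le_trans)
qed

lemma small_elements_bound:
  assumes A: "D_property n A" "A \<subseteq> {..2 ^ (17 * l + 1)}" and n: "n \<noteq> 0" "\<bar>n\<bar> \<le> 2 ^ l" and l: "l \<ge> 1"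
    and m: "1024 * l \<le> 2 ^ m" "m \<ge> 10"
  shows "card A \<le> 2 ^ (17 * m\<^sup>2)"
proof -
  \<comment> \<open>Even for exponent 2 there are then at least \<open>2^(2 m)\<close> monomials,
    which exceeds eight times the \<open>37 l s\<close> bits of their values.\<close>
  define s where "s = 2 * m"
  \<comment> \<open>There are fewer than \<open>2^m\<close> exponents, so for every further element
    \<open>b\<close>, some \<open>s\<close> of these \<open>u\<close> elements have the same
    exponent with \<open>b\<close>.\<close>
  define u where "u = s * 2 ^ m"
  define K where "K = {2..37 * l}"
  define X where "X = (2::nat) ^ (4 * m + 2)"
  have finA: "finite A" using A(2) finite_subset by blast
  have posA: "a > 0" if "a \<in> A" for a using A(1) that by (auto simp: D_property_def)
  have sm: "s \<le> 2 ^ m" using m(2) unfolding s_def by (induction m rule: dec_induct) auto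
  have K: "finite K" "card K \<le> 2 ^ m" using m(1) by (auto simp: K_def)
  have u: "u \<le> 2 ^ (2 * m)"
  proof -
    have "u \<le> 2 ^ m * 2 ^ m" unfolding u_def by (intro mult_le_mono1 sm)
    thus ?thesis by (simp add: mult_2 power_add)
  qed
  have exp_mono: "2 ^ x \<le> (2::nat) ^ y" if "x \<le> y" for x y using that by (rule power_increasing) simp
  have mm: "10 * m \<le> m\<^sup>2" using m(2) by (simp add: power2_eq_square)
  show ?thesis
  proof (cases "card A \<le> u")
    case True
    also have "u \<le> 2 ^ (2 * m)" by (rule u)
    also have "\<dots> \<le> 2 ^ (17 * m\<^sup>2)" using mm by (intro exp_mono) linarith
    finally show ?thesis .
  next
    case False
    then obtain U where U: "U \<subseteq> A" "card U = u" "finite U"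
      using obtain_subset_with_card_n[of u A] by auto
    have "\<forall>a b. \<exists>k z. a \<in> A \<longrightarrow> b \<in> A \<longrightarrow> a \<noteq> b \<longrightarrow>
       2 \<le> k \<and> k \<le> 37 * l \<and> z > 0 \<and> z ^ k \<le> 2 ^ (37 * l) \<and> int a * int b + n = int z ^ k"
      using D_property_representation[OF A n(2) l] by metis
    then obtain kk zz :: "nat \<Rightarrow> nat \<Rightarrow> nat" where kz: "\<And>a b. a \<in> A \<Longrightarrow> b \<in> A \<Longrightarrow> a \<noteq> b \<Longrightarrow>
       2 \<le> kk a b \<and> kk a b \<le> 37 * l \<and> zz a b > 0 \<and> zz a b ^ kk a b \<le> 2 ^ (37 * l) \<and> int a * int b + n = int (zz a b) ^ kk a b"
      by metis
    define B where "B = A - U"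
    have finB: "finite B" using finA by (simp add: B_def)
    have ex: "\<exists>k f p. k \<in> K \<and> f \<in> {..<s} \<rightarrow>\<^sub>E U \<and> inj_on f {..<s} \<and> (\<forall>i<s. kk (f i) b = k) \<and>
       prime p \<and> p \<le> X \<and> \<not> p dvd k * (\<Prod>i<s. zz (f i) b)" if b: "b \<in> B" for b
    proof -
      have ab: "a \<in> A" "b \<in> A" "a \<noteq> b" if "a \<in> U" for a using b that U(1) by (auto simp: B_def)
      have "card K * (s - 1) \<le> 2 ^ m * (s - 1)" by (intro mult_le_mono1 K)
      also have "\<dots> < 2 ^ m * s" using m(2) by (simp add: s_def)
      finally have "card K * (s - 1) < card U" by (simp add: U u_def mult.commute)
      moreover have "(\<lambda>a. kk a b) ` U \<subseteq> K" using kz ab by (auto simp: K_def)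
      ultimately obtain k f where kf: "k \<in> K" "f \<in> {..<s} \<rightarrow>\<^sub>E U" "inj_on f {..<s}" "\<forall>i<s. kk (f i) b = k"
        using exists_monochromatic_injection[OF U(3) K(1), of "\<lambda>a. kk a b" s] by blast
      have zb: "zz (f i) b > 0 \<and> zz (f i) b \<le> 2 ^ (37 * l)" if i: "i < s" for i
      proof -
        have fU: "f i \<in> U" using kf(2) i by auto
        have z: "zz (f i) b > 0" "zz (f i) b ^ k \<le> 2 ^ (37 * l)" using kz[OF ab[OF fU]] kf(4) i by auto
        have "zz (f i) b ^ 1 \<le> zz (f i) b ^ k" using z(1) kf(1) by (intro power_increasing) (auto simp: K_def)
        thus ?thesis using z by simp
      qed
      have "k * (\<Prod>i<s. zz (f i) b) \<le> 2 ^ (37 * l) * (\<Prod>i<s. 2 ^ (37 * l))"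
      proof (intro mult_le_mono prod_mono)
        have "k \<le> 37 * l" using kf(1) by (simp add: K_def)
        also have "\<dots> < 2 ^ (37 * l)" by (rule less_exp)
        finally show "k \<le> 2 ^ (37 * l)" by simp
      qed (use zb in auto)
      also have "\<dots> = (2 ^ (37 * l)) ^ (2 * m + 1)" by (simp add: s_def)
      also have "\<dots> = 2 ^ (37 * l * (2 * m + 1))" by (rule power_mult[symmetric])
      finally have "k * (\<Prod>i<s. zz (f i) b) \<le> 2 ^ (37 * l * (2 * m + 1))" .
      moreover have "k * (\<Prod>i<s. zz (f i) b) > 0" using zb kf(1) by (auto simp: K_def intro!: prod_pos)
      ultimately obtain p where "prime p" "p \<le> X" "\<not> p dvd k * (\<Prod>i<s. zz (f i) b)"
        using small_prime_bound[OF m] unfolding X_def by blast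
      thus ?thesis using kf by blast
    qed
    then obtain k f p where kfp: "\<And>b. b \<in> B \<Longrightarrow> k b \<in> K \<and> f b \<in> {..<s} \<rightarrow>\<^sub>E U \<and> inj_on (f b) {..<s} \<and> (\<forall>i<s. kk (f b i) b = k b) \<and>
       prime (p b) \<and> p b \<le> X \<and> \<not> p b dvd k b * (\<Prod>i<s. zz (f b i) b)" by metis
    \<comment> \<open>On a fibre of \<open>\<Phi>\<close> the exponent, the multipliers, the prime
      and all residues are constant, as \<open>residue_class_bound\<close> demands.\<close>
    define \<Phi> where "\<Phi> b = (k b, f b, p b, b mod p b, \<lambda>i\<in>{..<s}. zz (f b i) b mod p b)" for b
    define R where "R = K \<times> ({..<s} \<rightarrow>\<^sub>E U) \<times> {..X} \<times> {..X} \<times> ({..<s} \<rightarrow>\<^sub>E {..X})"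
    have finR: "finite R" using K(1) U(3) by (simp add: R_def finite_PiE)
    have mod_le: "x mod p b \<le> X" if "b \<in> B" for x b
    proof -
      have "p b > 0" "p b \<le> X" using kfp[OF that] prime_gt_0_nat by auto
      thus ?thesis using mod_less_divisor[of "p b" x] by linarith
    qed
    have "\<Phi> b \<in> R" if b: "b \<in> B" for b
    proof -
      have "(\<lambda>i\<in>{..<s}. zz (f b i) b mod p b) \<in> {..<s} \<rightarrow>\<^sub>E {..X}"
        unfolding restrict_PiE_iff using mod_le[OF b] by simp
      moreover have "p b \<in> {..X}" "b mod p b \<in> {..X}" using kfp[OF b] mod_le[OF b] by simp_all
      ultimately show ?thesis unfolding \<Phi>_def R_def using kfp[OF b] by (intro SigmaI) blast+
    qed
    hence "\<Phi> ` B \<subseteq> R" by blast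
    moreover have "card {b \<in> B. \<Phi> b = r} \<le> s * (2 ^ m) ^ s" if r: "r \<in> R" for r
    proof (cases "{b \<in> B. \<Phi> b = r} = {}")
      case False
      define T where "T = {b \<in> B. \<Phi> b = r}"
      from False obtain b0 where b0: "b0 \<in> T" by (auto simp: T_def)
      define k0 f0 p0 where 0: "k0 = k b0" "f0 = f b0" "p0 = p b0"
      have b0B: "b0 \<in> B" using b0 by (simp add: T_def)
      note K0 = kfp[OF b0B]
      have k0: "2 \<le> k0" "k0 \<le> 37 * l" using K0 by (auto simp: 0 K_def)
      have T: "c \<in> B" "\<Phi> c = \<Phi> b0" if "c \<in> T" for c using that b0 by (auto simp: T_def)
      have Teq: "k c = k0" "f c = f0" "p c = p0" "c mod p0 = b0 mod p0" if "c \<in> T" for c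
        using T[OF that] by (auto simp: \<Phi>_def 0)
      have Tz: "zz (f0 i) c mod p0 = zz (f0 i) b0 mod p0" if "c \<in> T" "i < s" for c i
      proof -
        have "(\<lambda>i\<in>{..<s}. zz (f c i) c mod p c) = (\<lambda>i\<in>{..<s}. zz (f b0 i) b0 mod p b0)"
          using T(2)[OF that(1)] unfolding \<Phi>_def prod.inject by blast
        from fun_cong[OF this, of i] show ?thesis using that(2) Teq[OF that(1)] by (simp add: 0)
      qed
      have fU: "f0 i \<in> U" if "i < s" for i
      proof -
        have "f b0 \<in> {..<s} \<rightarrow>\<^sub>E U" using K0 by blast
        from PiE_mem[OF this, of i] show ?thesis using that by (simp add: 0)
      qed
      have ab: "f0 i \<in> A" "c \<in> A" "f0 i \<noteq> c" "kk (f0 i) c = k0" if "c \<in> T" "i < s" for c i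
      proof -
        show "f0 i \<in> A" "c \<in> A" "f0 i \<noteq> c" using fU[OF that(2)] T(1)[OF that(1)] U(1) unfolding B_def by blast+
        have "\<forall>i<s. kk (f c i) c = k c" using kfp[OF T(1)[OF that(1)]] by blast
        thus "kk (f0 i) c = k0" using Teq[OF that(1)] that(2) by simp
      qed
      have D: "2 ^ (2 * m) \<le> k0 ^ s"
        using k0(1) unfolding s_def by (intro power_mono) auto
      have "card T \<le> s * k0 ^ s"
      proof (rule residue_class_bound[where a = f0 and n = n and p = p0 and b = "37 * l" and z = "\<lambda>i c. zz (f0 i) c"])
        show "inj_on f0 {..<s}" "prime p0" using K0 unfolding 0 by blast+
        show "\<not> p0 dvd k0" using K0 unfolding 0 by (meson dvd_mult2)
        show "f0 i > 0" if "i < s" for i using fU[OF that] U(1) posA by auto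
        show "finite T" using finB by (simp add: T_def)
        show "int (f0 i) * int c + n = int (zz (f0 i) c) ^ k0" if "c \<in> T" "i < s" for c i
          using kz[OF ab(1-3)[OF that]] ab(4)[OF that] by simp
        show "zz (f0 i) c > 0 \<and> zz (f0 i) c ^ k0 \<le> 2 ^ (37 * l) \<and> \<not> p0 dvd zz (f0 i) c" if "c \<in> T" "i < s" for c i
        proof -
          have "\<not> p0 dvd k0 * (\<Prod>i<s. zz (f0 i) c)" using kfp[OF T(1)[OF that(1)]] Teq[OF that(1)] by simp
          moreover have "zz (f0 i) c dvd (\<Prod>i<s. zz (f0 i) c)" using that(2) by (intro dvd_prodI) auto
          ultimately have "\<not> p0 dvd zz (f0 i) c" by (meson dvd_mult dvd_trans)
          thus ?thesis using kz[OF ab(1-3)[OF that]] ab(4)[OF that] by simp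
        qed
        show "[c = d] (mod p0)" if "c \<in> T" "d \<in> T" for c d
          using Teq(4)[OF that(1)] Teq(4)[OF that(2)] by (simp add: cong_def)
        show "[zz (f0 i) c = zz (f0 i) d] (mod p0)" if "c \<in> T" "d \<in> T" "i < s" for c d i
          using Tz[OF that(1,3)] Tz[OF that(2,3)] by (simp add: cong_def)
        have "(2::nat) ^ 10 \<le> 2 ^ (2 * m)" using m(2) by (intro exp_mono) auto
        hence D1024: "1024 \<le> k0 ^ s" using D by simp
        thus "2 \<le> k0 ^ s" by simp
        have "8 * (37 * l * s) \<le> 1024 * l * m" by (simp add: s_def)
        also have "\<dots> \<le> 2 ^ m * 2 ^ m" using m(1) sm by (intro mult_le_mono) (auto simp: s_def)
        also have "\<dots> = 2 ^ (2 * m)" by (simp add: mult_2 power_add)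
        also have "\<dots> \<le> k0 ^ s" by (rule D)
        finally show "k0 ^ s * 2 ^ (37 * l * s) \<le> 2 ^ (k0 ^ s - 1 - (k0 ^ s + 1) div 2)"
          using D1024 by (intro pad_le_power)
      qed (use n in auto)
      also have "\<dots> \<le> s * (2 ^ m) ^ s" using k0(2) m(1) by (intro mult_le_mono2 power_mono) auto
      finally show ?thesis by (simp add: T_def)
    qed (simp del: Collect_empty_eq)
    ultimately have "card B \<le> card R * (s * (2 ^ m) ^ s)" by (rule card_le_fibers[OF finB finR])
    also have "card R = card K * (u ^ s * (Suc X * (Suc X * Suc X ^ s)))"
      using U by (simp add: R_def card_cartesian_product card_PiE)
    also have "\<dots> * (s * (2 ^ m) ^ s) \<le> (2 ^ m * ((2 ^ (2 * m)) ^ s * (2 ^ (4 * m + 3) * (2 ^ (4 * m + 3) * (2 ^ (4 * m + 3)) ^ s)))) * (2 ^ m * (2 ^ m) ^ s)"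
    proof -
      have "(1::nat) \<le> 2 ^ (4 * m)" by simp
      hence "Suc X \<le> 2 ^ (4 * m + 3)" unfolding X_def power_add by simp
      thus ?thesis using K(2) u sm by (intro mult_le_mono power_mono) auto
    qed
    also have "\<dots> = 2 ^ (m + (2 * m * s + ((4 * m + 3) + ((4 * m + 3) + (4 * m + 3) * s))) + (m + m * s))"
      by (simp only: power_add power_mult)
    also have "\<dots> \<le> 2 ^ (16 * m\<^sup>2)"
    proof (rule exp_mono)
      have "m + (2 * m * s + ((4 * m + 3) + ((4 * m + 3) + (4 * m + 3) * s))) + (m + m * s) = 14 * m\<^sup>2 + 16 * m + 6"
        by (simp add: s_def power2_eq_square algebra_simps)
      thus "m + (2 * m * s + ((4 * m + 3) + ((4 * m + 3) + (4 * m + 3) * s))) + (m + m * s) \<le> 16 * m\<^sup>2"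
        using mm m(2) by linarith
    qed
    finally have cB: "card B \<le> 2 ^ (16 * m\<^sup>2)" .
    have "card A \<le> card U + card B"
      using card_Un_le[of U B] U(1) by (simp add: B_def Un_absorb1)
    also have "\<dots> \<le> 2 ^ (2 * m) + 2 ^ (16 * m\<^sup>2)" using U(2) u cB by linarith
    also have "\<dots> \<le> 2 ^ (16 * m\<^sup>2) + 2 ^ (16 * m\<^sup>2)" using mm by (intro add_mono exp_mono) linarith+
    also have "\<dots> = 2 ^ (16 * m\<^sup>2 + 1)" by simp
    also have "\<dots> \<le> 2 ^ (17 * m\<^sup>2)" using mm m(2) by (intro exp_mono) linarith
    finally show ?thesis .
  qed
qed

section \<open>Consequences of the ABC conjecture\<close>

lemma rad_le:
  assumes "m \<noteq> 0" "N > 0" "\<And>p. prime p \<Longrightarrow> p dvd m \<Longrightarrow> p dvd N"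
  shows "rad m \<le> N"
proof -
  have "prime_factors m \<subseteq> prime_factors N" using assms by (auto simp: in_prime_factors_iff)
  hence "(\<Prod>p\<in>prime_factors m. p) dvd (\<Prod>p\<in>prime_factors N. p ^ multiplicity p N)"
  proof (intro prod_dvd_prod_subset2)
    fix p assume "p \<in> prime_factors m"
    with \<open>prime_factors m \<subseteq> prime_factors N\<close> have "p \<in> prime_factors N" by blast
    thus "p dvd p ^ multiplicity p N" by (intro dvd_power) (simp add: prime_factors_multiplicity)
  qed auto
  also have "(\<Prod>p\<in>prime_factors N. p ^ multiplicity p N) = N"
    using assms(2) prime_factorization_int[of N] by simp
  finally show ?thesis unfolding rad_def using assms(2) by (intro zdvd_imp_le) auto
qed

lemma rad_pos: "rad m > 0"
  unfolding rad_def by (intro prod_pos) (auto simp: in_prime_factors_iff prime_gt_0_int)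

text \<open>The conjecture in logarithmic form for \<open>X = Y + R\<close> with small
  \<open>R\<close>: the radical of \<open>R\<close> is estimated by \<open>|R|\<close>, and
  \<open>W\<close> is any number that contains the primes of \<open>X Y\<close>. For perfect powers
  the product of the bases serves as \<open>W\<close>.\<close>

definition abc_bound :: "real \<Rightarrow> real \<Rightarrow> bool" where
  "abc_bound \<epsilon> K \<longleftrightarrow> K \<ge> 0 \<and> (\<forall>(X::int) (Y::int) (R::int) (W::int).
     X \<noteq> 0 \<longrightarrow> Y \<noteq> 0 \<longrightarrow> R \<noteq> 0 \<longrightarrow> X = Y + R \<longrightarrow> W > 0 \<longrightarrow> (\<forall>p. prime p \<longrightarrow> p dvd X * Y \<longrightarrow> p dvd W) \<longrightarrow>
     ln (real_of_int \<bar>X\<bar>) \<le> K + (1 + \<epsilon>) * (ln (real_of_int W) + ln (real_of_int \<bar>R\<bar>)))"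

lemma abc_boundD:
  fixes X Y R W :: int
  assumes "abc_bound \<epsilon> K" "X \<noteq> 0" "Y \<noteq> 0" "R \<noteq> 0" "X = Y + R" "W > 0" "\<And>p. prime p \<Longrightarrow> p dvd X * Y \<Longrightarrow> p dvd W"
  shows "ln \<bar>X\<bar> \<le> K + (1 + \<epsilon>) * (ln W + ln \<bar>R\<bar>)"
  using assms unfolding abc_bound_def by blast

text \<open>No coprimality is needed: cancelling \<open>gcd X Y\<close>, which divides \<open>R\<close>, shrinks the left hand side by less than
  the right hand side.\<close>

lemma ABC_abc_bound:
  assumes "ABC_conjecture" "\<epsilon> > 0"
  shows "\<exists>K. abc_bound \<epsilon> K"
proof -
  obtain C0 :: real where C0: "\<And>a b c :: int. a \<noteq> 0 \<Longrightarrow> b \<noteq> 0 \<Longrightarrow> c \<noteq> 0 \<Longrightarrow> Gcd {a, b, c} = 1 \<Longrightarrow> a + b = c \<Longrightarrow>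
     real_of_int (Max {\<bar>a\<bar>, \<bar>b\<bar>, \<bar>c\<bar>}) \<le> C0 * real_of_int (rad (a * b * c)) powr (1 + \<epsilon>)"
    using assms unfolding ABC_conjecture_def by meson
  \<comment> \<open>Ensures that the logarithm of the constant is nonnegative.\<close>
  define C where "C = max 1 C0"
  have "abc_bound \<epsilon> (ln C)"
    unfolding abc_bound_def
  proof (intro conjI allI impI)
    show "ln C \<ge> 0" by (simp add: C_def)
    fix X Y R W :: int
    assume nz: "X \<noteq> 0" "Y \<noteq> 0" "R \<noteq> 0" and eq: "X = Y + R" and W: "W > 0"
      and pr: "\<forall>p. prime p \<longrightarrow> p dvd X * Y \<longrightarrow> p dvd W"
    define G where "G = gcd X Y"
    have G: "G > 0" using nz by (simp add: G_def)
    obtain x y where xy: "X = G * x" "Y = G * y" unfolding G_def by (meson dvdE gcd_dvd1 gcd_dvd2)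
    define r where "r = x - y"
    have r: "R = G * r" using eq xy by (simp add: r_def algebra_simps)
    have nz': "x \<noteq> 0" "y \<noteq> 0" "r \<noteq> 0" using nz xy r by auto
    have "coprime x y"
    proof -
      have "gcd (G * x) (G * y) = G" unfolding xy[symmetric] by (simp only: G_def)
      hence "G * gcd x y = G" using gcd_mult_distrib_int[of G x y] G by simp
      thus ?thesis using G by (simp add: coprime_iff_gcd_eq_1)
    qed
    hence gcd1: "Gcd {y, r, x} = 1"
    proof -
      have "Gcd {y, r, x} dvd gcd x y" by (intro gcd_greatest Gcd_dvd) auto
      hence "\<bar>Gcd {y, r, x}\<bar> = 1" using \<open>coprime x y\<close> by (metis coprime_iff_gcd_eq_1 zdvd1_eq)
      thus ?thesis by (simp only: abs_Gcd_eq)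
    qed
    have "rad (y * r * x) \<le> W * \<bar>r\<bar>"
    proof (rule rad_le)
      fix p :: int assume p: "prime p" "p dvd y * r * x"
      then consider "p dvd r" | "p dvd X * Y" unfolding xy by (auto simp: prime_dvd_mult_iff)
      thus "p dvd W * \<bar>r\<bar>" using pr p(1) by cases auto
    qed (use nz' W in auto)
    hence rad: "real_of_int (rad (y * r * x)) \<le> real_of_int W * real_of_int \<bar>r\<bar>"
      unfolding of_int_mult[symmetric] of_int_le_iff .
    have "real_of_int \<bar>x\<bar> \<le> real_of_int (Max {\<bar>y\<bar>, \<bar>r\<bar>, \<bar>x\<bar>})" unfolding of_int_le_iff by (intro Max_ge) auto
    also have "\<dots> \<le> C0 * real_of_int (rad (y * r * x)) powr (1 + \<epsilon>)"
      using nz' gcd1 by (intro C0) (auto simp: r_def)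
    also have "\<dots> \<le> C * (real_of_int W * real_of_int \<bar>r\<bar>) powr (1 + \<epsilon>)"
      using rad rad_pos[of "y * r * x"] assms(2) by (intro mult_mono powr_mono2) (auto simp: C_def)
    finally have x: "real_of_int \<bar>x\<bar> \<le> C * (real_of_int W * real_of_int \<bar>r\<bar>) powr (1 + \<epsilon>)" .
    have pos: "real_of_int \<bar>x\<bar> > 0" "real_of_int W > 0" "real_of_int \<bar>r\<bar> > 0" "C > 0" "real_of_int G \<ge> 1"
      using nz' W G by (auto simp: C_def)
    have "ln (real_of_int \<bar>x\<bar>) \<le> ln (C * (real_of_int W * real_of_int \<bar>r\<bar>) powr (1 + \<epsilon>))"
      using x pos by (subst ln_le_cancel_iff) auto
    also have "\<dots> = ln C + (1 + \<epsilon>) * (ln W + ln \<bar>r\<bar>)"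
      using pos by (simp add: ln_mult ln_powr)
    finally have lx: "ln (real_of_int \<bar>x\<bar>) \<le> ln C + (1 + \<epsilon>) * (ln W + ln \<bar>r\<bar>)" .
    have X: "ln (real_of_int \<bar>X\<bar>) = ln G + ln \<bar>x\<bar>" "ln (real_of_int \<bar>R\<bar>) = ln G + ln \<bar>r\<bar>"
      using pos G unfolding xy(1) r by (simp_all add: abs_mult ln_mult)
    have "\<epsilon> * ln G \<ge> 0" using assms(2) pos by (intro mult_nonneg_nonneg) auto
    hence "(1 + \<epsilon>) * (ln W + ln \<bar>r\<bar>) + ln G \<le> (1 + \<epsilon>) * (ln W + (ln G + ln \<bar>r\<bar>))"
      by (simp add: algebra_simps)
    with lx show "ln \<bar>X\<bar> \<le> ln C + (1 + \<epsilon>) * (ln W + ln \<bar>R\<bar>)" unfolding X by linarith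
  qed
  thus ?thesis ..
qed

lemma ln_2_le: "ln 2 \<le> (1::real)" using ln_2_less_1 by linarith

lemma ln_shifted_product:
  fixes a c n :: int
  assumes "a > 0" "c \<ge> 2" "\<bar>n\<bar> \<le> a"
  shows "a * c + n > 0" "ln a + ln c - 1 \<le> ln (a * c + n)" "ln (a * c + n) \<le> ln a + ln c + 1"
proof -
  define P where "P = a * c"
  have "a * 2 \<le> a * c" using assms by (intro mult_left_mono) auto
  hence "2 * a \<le> P" by (simp add: P_def)
  moreover have "- a \<le> n" "n \<le> a" using assms by auto
  ultimately have "2 * (P + n) \<ge> P" "P + n \<le> 2 * P" "P > 0" using assms(1) by simp_all
  moreover from this have "P + n > 0" by simp
  ultimately have b: "2 * (a * c + n) \<ge> a * c" "a * c + n \<le> 2 * (a * c)" "a * c > 0" and pos: "a * c + n > 0"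
    unfolding P_def .
  show "a * c + n > 0" by (rule pos)
  have l: "ln (real_of_int (a * c)) = ln a + ln c" using assms by (simp add: ln_mult)
  have "real_of_int (a * c) \<le> 2 * real_of_int (a * c + n)" "real_of_int (a * c + n) \<le> 2 * real_of_int (a * c)"
    using b by linarith+
  note le = this
  have p: "0 < real_of_int (a * c)" "0 < real_of_int (a * c + n)" using b(3) pos by (simp_all only: of_int_0_less_iff)
  have "ln (real_of_int (a * c)) \<le> ln (2 * real_of_int (a * c + n))"
    by (rule iffD2[OF ln_le_cancel_iff]) (use p le in linarith)+
  moreover have "ln (real_of_int (a * c + n)) \<le> ln (2 * real_of_int (a * c))"
    by (rule iffD2[OF ln_le_cancel_iff]) (use p le in linarith)+
  moreover have "ln (2 * real_of_int (a * c + n)) = ln 2 + ln (real_of_int (a * c + n))"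
    "ln (2 * real_of_int (a * c)) = ln 2 + ln (real_of_int (a * c))"
    using p by (simp_all only: ln_mult_pos zero_less_numeral)
  ultimately show "ln a + ln c - 1 \<le> ln (a * c + n)" "ln (a * c + n) \<le> ln a + ln c + 1"
    using l ln_2_le by linarith+
qed

lemma ln_root_le:
  fixes z V :: int and j k :: nat
  assumes "V = z ^ k" "z \<ge> 1" "k \<ge> j" "j > 0"
  shows "ln z \<le> ln V / j"
proof -
  have "real j * ln z \<le> real k * ln z" using assms by (intro mult_right_mono) auto
  thus ?thesis using assms by (simp add: ln_realpow field_simps)
qed

lemma prime_dvd_power_product:
  fixes p :: int
  assumes "prime p" "p dvd (a * x ^ k) * (b * y ^ l)"
  shows "p dvd a * b * x * y"
  using assms by (auto simp: prime_dvd_mult_iff dest: prime_dvd_power)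

text \<open>Unless both exponents are 2, the roots contribute at most \<open>1/2 + 1/3 = 5/6\<close>
  of \<open>\<gamma> = ln c\<close>. ABC then bounds \<open>\<gamma>\<close> by
  \<open>11/10 * 5/6 = 11/12\<close> of itself plus a bounded multiple of
  \<open>ln b \<le> \<gamma> / 100\<close> and a constant.\<close>

lemma sparse_exponents:
  fixes n a b c z w :: int and k l :: nat
  assumes K: "abc_bound (1/10) K" and n: "n \<noteq> 0" "\<bar>n\<bar> \<le> a" and ab: "0 < a" "a < b"
    and H: "K + 4 \<le> ln b" and c: "b ^ 100 \<le> c"
    and zw: "z \<ge> 1" "w \<ge> 1" "k \<ge> 2" "l \<ge> 2" "a * c + n = z ^ k" "b * c + n = w ^ l"
  shows "k = 2 \<and> l = 2"
proof (rule ccontr)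
  assume no: "\<not> (k = 2 \<and> l = 2)"
  have K0: "K \<ge> 0" using K by (simp add: abc_bound_def)
  have b2: "b \<ge> 2" using ab by simp
  have "b ^ 1 \<le> b ^ 100" using b2 by (intro power_increasing) auto
  hence c2: "c \<ge> 2" using b2 c by simp
  define \<beta> \<gamma> where bg: "\<beta> = ln (real_of_int b)" "\<gamma> = ln (real_of_int c)"
  have "real_of_int b ^ 100 \<le> real_of_int c" using c by (simp flip: of_int_power)
  hence "ln (real_of_int b ^ 100) \<le> \<gamma>" unfolding bg using b2 c2 by (subst ln_le_cancel_iff) auto
  hence g: "100 * \<beta> \<le> \<gamma>" using b2 by (simp add: bg ln_realpow)
  have la: "0 \<le> ln (real_of_int a)" "ln (real_of_int a) \<le> \<beta>" using ab by (auto simp: bg)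
  have "0 < b" "\<bar>n\<bar> \<le> b" using ab n by linarith+
  note V = ln_shifted_product[OF ab(1) c2 n(2)] ln_shifted_product[OF \<open>0 < b\<close> c2 \<open>\<bar>n\<bar> \<le> b\<close>]
  have V1: "ln (real_of_int (a * c + n)) \<le> \<beta> + \<gamma> + 1" "\<gamma> - 1 \<le> ln (real_of_int (a * c + n))"
    "ln (real_of_int (b * c + n)) \<le> \<beta> + \<gamma> + 1"
    using V la unfolding bg by linarith+
  have roots: "ln z + ln w \<le> 5/6 * (\<beta> + \<gamma> + 1)"
  proof (cases "k = 2")
    case True
    hence "l \<ge> 3" using no zw by simp
    hence "ln z \<le> ln (a * c + n) / 2" "ln w \<le> ln (b * c + n) / 3"
      using ln_root_le[OF zw(5,1), of 2] ln_root_le[OF zw(6,2), of 3] zw by auto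
    thus ?thesis using V1 by simp
  next
    case False
    hence "ln z \<le> ln (a * c + n) / 3" "ln w \<le> ln (b * c + n) / 2"
      using ln_root_le[OF zw(5,1), of 3] ln_root_le[OF zw(6,2), of 2] zw by auto
    thus ?thesis using V1 by simp
  qed
  have zpos: "z ^ k > 0" "w ^ l > 0" using zw by auto
  have "ln \<bar>b * z ^ k\<bar> \<le> K + (1 + 1/10) * (ln (a * b * z * w) + ln \<bar>n * (b - a)\<bar>)"
  proof (rule abc_boundD[OF K])
    show "b * z ^ k = a * w ^ l + n * (b - a)" unfolding zw(5,6)[symmetric] by (simp add: algebra_simps)
    show "a * b * z * w > 0" using ab zw by simp
    fix p :: int assume "prime p" "p dvd b * z ^ k * (a * w ^ l)"
    thus "p dvd a * b * z * w" using prime_dvd_power_product[of p b z k a w l] by (simp add: mult_ac)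
  qed (use n ab zpos zw(1,2) in auto)
  moreover have "ln \<bar>b * z ^ k\<bar> = \<beta> + ln (a * c + n)" using ab zpos zw(1) unfolding zw(5) by (simp add: ln_mult bg)
  moreover have "ln (a * b * z * w) = ln a + \<beta> + (ln z + ln w)" using ab zw by (simp add: ln_mult bg)
  moreover have "ln \<bar>n * (b - a)\<bar> \<le> 2 * \<beta>"
  proof -
    have "\<bar>n * (b - a)\<bar> \<le> b * b" unfolding abs_mult using n ab by (intro mult_mono) auto
    hence "real_of_int \<bar>n * (b - a)\<bar> \<le> real_of_int b * real_of_int b" by (simp flip: of_int_mult)
    hence "ln \<bar>n * (b - a)\<bar> \<le> ln (real_of_int b * real_of_int b)" using n ab by (subst ln_le_cancel_iff) auto
    thus ?thesis using b2 by (simp add: ln_mult bg)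
  qed
  ultimately show False using roots V1 la g H K0 unfolding bg(1)[symmetric] by (simp add: field_simps)
qed

section \<open>Grids of products in a short window\<close>

lemma rectangle_difference:
  fixes a1 a2 c1 c2 n :: int
  shows "(a1 * c1 + n) * (a2 * c2 + n) = (a1 * c2 + n) * (a2 * c1 + n) + n * (a1 - a2) * (c1 - c2)"
  by algebra

lemma ln_abs_diff_le:
  fixes a b :: int
  assumes "a > 0" "b > 0" "a \<noteq> b" "ln a \<le> u" "ln b \<le> u"
  shows "ln \<bar>a - b\<bar> \<le> u"
proof -
  have "\<bar>a - b\<bar> \<le> a \<or> \<bar>a - b\<bar> \<le> b" using assms(1,2) by linarith
  hence "real_of_int \<bar>a - b\<bar> \<le> real_of_int a \<or> real_of_int \<bar>a - b\<bar> \<le> real_of_int b"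
    by (simp only: of_int_le_iff)
  hence "ln (real_of_int \<bar>a - b\<bar>) \<le> ln (real_of_int a) \<or> ln (real_of_int \<bar>a - b\<bar>) \<le> ln (real_of_int b)"
    using assms(1-3) by (metis abs_of_nonneg ln_mono of_int_0_less_iff right_minus_eq zero_less_abs_iff)
  thus ?thesis using assms(4,5) by linarith
qed

lemma ln_rectangle_le:
  fixes a1 a2 c1 c2 n :: int
  assumes "n \<noteq> 0" "a1 \<noteq> a2" "c1 \<noteq> c2" "a1 > 0" "a2 > 0" "c1 > 0" "c2 > 0" "ln \<bar>n\<bar> \<le> h / 17"
    "ln a1 \<le> 21/20 * h" "ln a2 \<le> 21/20 * h" "ln c1 \<le> 21/20 * h" "ln c2 \<le> 21/20 * h"
  shows "ln \<bar>n * (a1 - a2) * (c1 - c2)\<bar> \<le> h / 17 + 21/10 * h"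
proof -
  have "ln (real_of_int \<bar>n * (a1 - a2) * (c1 - c2)\<bar>) = ln \<bar>n\<bar> + ln \<bar>a1 - a2\<bar> + ln \<bar>c1 - c2\<bar>"
    using assms(1-3) by (simp add: abs_mult ln_mult)
  thus ?thesis using assms(8) ln_abs_diff_le[OF assms(4,5,2,9,10)] ln_abs_diff_le[OF assms(6,7,3,11,12)] by linarith
qed

text \<open>ABC would bound \<open>4 h - 2\<close> by \<open>41/40\<close> times the sum of
  \<open>4/5 * 21/10 h\<close> for the roots and \<open>(21/10 + 1/17) h\<close> for the difference,
  which is about \<open>3.94 h\<close>, up to constants. The bound on \<open>h\<close> in terms of
  \<open>K\<close> takes care of these.\<close>

lemma no_high_power_rectangle:
  fixes n a1 a2 c1 c2 z11 z12 z21 z22 :: int and k11 k12 k21 k22 :: nat and h :: real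
  assumes K: "abc_bound (1/40) K"
    and n: "n \<noteq> 0" and ac: "a1 \<noteq> a2" "c1 \<noteq> c2" "a1 > 0" "a2 > 0" "c1 > 0" "c2 > 0"
    and bd: "ln \<bar>n\<bar> \<le> h / 17" "ln a1 \<le> 21/20 * h" "ln a2 \<le> 21/20 * h" "ln c1 \<le> 21/20 * h" "ln c2 \<le> 21/20 * h"
    and h: "h \<ge> 20 * (K + 4)" and z: "z11 \<ge> 1" "z12 \<ge> 1" "z21 \<ge> 1" "z22 \<ge> 1"
    and k: "k11 \<ge> 5" "k12 \<ge> 5" "k21 \<ge> 5" "k22 \<ge> 5"
    and eq: "a1 * c1 + n = z11 ^ k11" "a1 * c2 + n = z12 ^ k12" "a2 * c1 + n = z21 ^ k21" "a2 * c2 + n = z22 ^ k22"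
    and lo: "ln (a1 * c1 + n) \<ge> 2 * h - 1" "ln (a2 * c2 + n) \<ge> 2 * h - 1"
    and up: "ln (a1 * c1 + n) \<le> 21/10 * h + 1" "ln (a1 * c2 + n) \<le> 21/10 * h + 1"
      "ln (a2 * c1 + n) \<le> 21/10 * h + 1" "ln (a2 * c2 + n) \<le> 21/10 * h + 1"
  shows False
proof -
  have K0: "K \<ge> 0" using K by (simp add: abc_bound_def)
  let ?R = "n * (a1 - a2) * (c1 - c2)"
  have R: "ln \<bar>?R\<bar> \<le> h / 17 + 21/10 * h" by (rule ln_rectangle_le) (use n ac bd in auto)
  have zp: "z11 ^ k11 > 0" "z12 ^ k12 > 0" "z21 ^ k21 > 0" "z22 ^ k22 > 0" using z by simp_all
  have "ln \<bar>z11 ^ k11 * z22 ^ k22\<bar> \<le> K + (1 + 1/40) * (ln (z11 * z22 * z12 * z21) + ln \<bar>?R\<bar>)"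
  proof (rule abc_boundD[OF K])
    show "z11 ^ k11 * z22 ^ k22 = z12 ^ k12 * z21 ^ k21 + ?R"
      unfolding eq[symmetric] by (rule rectangle_difference)
    fix p :: int assume "prime p" "p dvd z11 ^ k11 * z22 ^ k22 * (z12 ^ k12 * z21 ^ k21)"
    thus "p dvd z11 * z22 * z12 * z21" by (auto simp: prime_dvd_mult_iff dest: prime_dvd_power)
  qed (use zp z n ac in auto)
  moreover have "ln \<bar>z11 ^ k11 * z22 ^ k22\<bar> = ln (z11 ^ k11) + ln (z22 ^ k22)" 
  proof -
    have "real_of_int (z11 ^ k11) > 0" "real_of_int (z22 ^ k22) > 0" using zp by (simp_all only: of_int_0_less_iff)
    thus ?thesis using zp by (simp only: abs_of_pos mult_pos_pos of_int_mult ln_mult_pos)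
  qed
  moreover have "ln (z11 * z22 * z12 * z21) = ln z11 + ln z22 + ln z12 + ln z21" using z by (simp add: ln_mult)
  moreover have "ln z11 \<le> (21/10 * h + 1) / 5" "ln z12 \<le> (21/10 * h + 1) / 5" "ln z21 \<le> (21/10 * h + 1) / 5" "ln z22 \<le> (21/10 * h + 1) / 5"
    using ln_root_le[OF eq(1) z(1) k(1)] ln_root_le[OF eq(2) z(2) k(2)] ln_root_le[OF eq(3) z(3) k(3)] ln_root_le[OF eq(4) z(4) k(4)] up
    by simp_all
  ultimately show False using R lo K0 h unfolding eq by (simp add: field_simps)
qed

text \<open>Cubes of distinct positive integers \<open>x\<close>, \<open>y\<close> differ by at
  least \<open>x^2\<close>. Here \<open>x^2\<close> has size at least about
  \<open>exp (8/3 h)\<close>, while the difference is at most about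
  \<open>exp (2.16 h)\<close>.\<close>

lemma no_cube_rectangle:
  fixes n a1 a2 c1 c2 x11 x12 x21 x22 :: int and h :: real
  assumes n: "n \<noteq> 0" and ac: "a1 \<noteq> a2" "c1 \<noteq> c2" "a1 > 0" "a2 > 0" "c1 > 0" "c2 > 0"
    and bd: "ln \<bar>n\<bar> \<le> h / 17" "ln a1 \<le> 21/20 * h" "ln a2 \<le> 21/20 * h" "ln c1 \<le> 21/20 * h" "ln c2 \<le> 21/20 * h"
    and h: "h \<ge> 10" and x: "x11 \<ge> 1" "x12 \<ge> 1" "x21 \<ge> 1" "x22 \<ge> 1"
    and eq: "a1 * c1 + n = x11 ^ 3" "a1 * c2 + n = x12 ^ 3" "a2 * c1 + n = x21 ^ 3" "a2 * c2 + n = x22 ^ 3"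
    and lo: "ln (a1 * c1 + n) \<ge> 2 * h - 1" "ln (a2 * c2 + n) \<ge> 2 * h - 1"
  shows False
proof -
  let ?R = "n * (a1 - a2) * (c1 - c2)"
  have R: "ln \<bar>?R\<bar> \<le> h / 17 + 21/10 * h" by (rule ln_rectangle_le) (use n ac bd in auto)
  define x y where xy: "x = x11 * x22" "y = x12 * x21"
  have pos: "x > 0" "y > 0" using x by (auto simp: xy)
  have "x ^ 3 = y ^ 3 + ?R"
    using rectangle_difference[of a1 c1 n a2 c2] by (simp add: eq xy power_mult_distrib)
  hence "?R = (x - y) * (x\<^sup>2 + x * y + y\<^sup>2)" by (simp add: algebra_simps power2_eq_square power3_eq_cube)
  moreover have R0: "?R \<noteq> 0" using n ac by simp
  ultimately have "\<bar>?R\<bar> = \<bar>x - y\<bar> * (x\<^sup>2 + x * y + y\<^sup>2)" "x - y \<noteq> 0"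
    using pos by (auto simp: abs_mult)
  moreover from this have "1 * x\<^sup>2 \<le> \<bar>x - y\<bar> * (x\<^sup>2 + x * y + y\<^sup>2)" using pos by (intro mult_mono) auto
  ultimately have "x\<^sup>2 \<le> \<bar>?R\<bar>" by simp
  hence "real_of_int (x\<^sup>2) \<le> real_of_int \<bar>?R\<bar>" by (simp only: of_int_le_iff)
  hence "ln (real_of_int (x\<^sup>2)) \<le> ln (real_of_int \<bar>?R\<bar>)"
    using pos R0 by (intro iffD2[OF ln_le_cancel_iff]) auto
  moreover have "ln (real_of_int (x\<^sup>2)) = 2 * (ln x11 + ln x22)"
    using x by (simp add: xy ln_realpow ln_mult)
  moreover have "ln (a1 * c1 + n) = 3 * ln x11" "ln (a2 * c2 + n) = 3 * ln x22"
    unfolding eq using x by (simp_all add: ln_realpow)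
  ultimately show False using R lo h by (simp add: field_simps)
qed

section \<open>Determinants of grids of squares\<close>

definition det3 :: "'a::comm_ring_1 \<Rightarrow> 'a \<Rightarrow> 'a \<Rightarrow> 'a \<Rightarrow> 'a \<Rightarrow> 'a \<Rightarrow> 'a \<Rightarrow> 'a \<Rightarrow> 'a \<Rightarrow> 'a" where
  "det3 x11 x12 x13 x21 x22 x23 x31 x32 x33 =
     x31 * (x12 * x23 - x13 * x22) + x32 * (x13 * x21 - x11 * x23) + x33 * (x11 * x22 - x12 * x21)"

lemma quadratic_three_zeros:
  fixes \<alpha> \<beta> \<gamma> a1 a2 a3 :: int
  assumes "\<alpha> * a1\<^sup>2 + \<beta> * a1 + \<gamma> = 0" "\<alpha> * a2\<^sup>2 + \<beta> * a2 + \<gamma> = 0" "\<alpha> * a3\<^sup>2 + \<beta> * a3 + \<gamma> = 0"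
    and "a1 \<noteq> a2" "a1 \<noteq> a3" "a2 \<noteq> a3"
  shows "\<alpha> = 0" "\<beta> = 0" "\<gamma> = 0"
proof -
  have "(a1 - a2) * (\<alpha> * (a1 + a2) + \<beta>) = 0" "(a1 - a3) * (\<alpha> * (a1 + a3) + \<beta>) = 0"
    using assms(1-3) by (simp_all add: algebra_simps power2_eq_square)
  hence 1: "\<alpha> * (a1 + a2) + \<beta> = 0" "\<alpha> * (a1 + a3) + \<beta> = 0" using assms(4,5) by simp_all
  have "\<alpha> * (a2 - a3) = (\<alpha> * (a1 + a2) + \<beta>) - (\<alpha> * (a1 + a3) + \<beta>)" by (simp add: algebra_simps)
  hence "\<alpha> * (a2 - a3) = 0" using 1 by simp
  thus "\<alpha> = 0" using assms(6) by simp
  thus "\<beta> = 0" using 1 by simp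
  thus "\<gamma> = 0" using assms(1) \<open>\<alpha> = 0\<close> by simp
qed

lemma square_minor_nonzero:
  fixes n a1 a2 c1 c2 x11 x12 x21 x22 :: int
  assumes "n \<noteq> 0" "a1 \<noteq> a2" "c1 \<noteq> c2"
    and "a1 * c1 + n = x11\<^sup>2" "a1 * c2 + n = x12\<^sup>2" "a2 * c1 + n = x21\<^sup>2" "a2 * c2 + n = x22\<^sup>2"
  shows "x11 * x22 - x12 * x21 \<noteq> 0"
proof
  assume "x11 * x22 - x12 * x21 = 0"
  hence "(x11 * x22)\<^sup>2 = (x12 * x21)\<^sup>2" by simp
  hence "n * (a1 - a2) * (c1 - c2) = 0"
    using rectangle_difference[of a1 c1 n a2 c2] unfolding assms(4-7) by (simp add: power_mult_distrib)
  thus False using assms by simp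
qed

text \<open>If the determinant is 0, every row is orthogonal to the cross product
  \<open>(l1, l2, l3)\<close> of the first two. Isolating and squaring twice turns this into a
  quadratic equation for the multiplier \<open>a\<close> with three solutions, so it vanishes
  identically. Its coefficients determine \<open>p^2\<close>, \<open>p q\<close> and
  \<open>q^2\<close>, and \<open>(p q)^2 = p^2 q^2\<close> then forces
  \<open>c1 = c2\<close>.\<close>

lemma square_grid_det_nonzero:
  fixes n a1 a2 a3 c1 c2 c3 x11 x12 x13 x21 x22 x23 x31 x32 x33 :: int
  assumes n: "n \<noteq> 0" and a: "a1 \<noteq> a2" "a1 \<noteq> a3" "a2 \<noteq> a3" and c: "c1 \<noteq> c2" "c1 \<noteq> c3" "c2 \<noteq> c3"
    and eq: "a1 * c1 + n = x11\<^sup>2" "a1 * c2 + n = x12\<^sup>2" "a1 * c3 + n = x13\<^sup>2"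
      "a2 * c1 + n = x21\<^sup>2" "a2 * c2 + n = x22\<^sup>2" "a2 * c3 + n = x23\<^sup>2"
      "a3 * c1 + n = x31\<^sup>2" "a3 * c2 + n = x32\<^sup>2" "a3 * c3 + n = x33\<^sup>2"
  shows "det3 x11 x12 x13 x21 x22 x23 x31 x32 x33 \<noteq> 0"
proof
  assume det: "det3 x11 x12 x13 x21 x22 x23 x31 x32 x33 = 0"
  define l1 where "l1 = x12 * x23 - x13 * x22"
  define l2 where "l2 = x13 * x21 - x11 * x23"
  define l3 where "l3 = x11 * x22 - x12 * x21"
  have l0: "l1 \<noteq> 0" "l2 \<noteq> 0"
    using square_minor_nonzero[OF n a(1) c(3) eq(2,3,5,6)] square_minor_nonzero[OF n a(1) c(2)[symmetric] eq(3,1,6,4)]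
    by (auto simp: l1_def l2_def)
  define \<mu> where "\<mu> = (l1 * l2)\<^sup>2"
  define p where "p = l1\<^sup>2 * c1 + l2\<^sup>2 * c2 - l3\<^sup>2 * c3"
  define q where "q = l1\<^sup>2 + l2\<^sup>2 - l3\<^sup>2"
  have G: "(p\<^sup>2 - 4 * \<mu> * (c1 * c2)) * a\<^sup>2 + n * (2 * (p * q) - 4 * \<mu> * (c1 + c2)) * a + n\<^sup>2 * (q\<^sup>2 - 4 * \<mu>) = 0"
    if e: "a * c1 + n = y1\<^sup>2" "a * c2 + n = y2\<^sup>2" "a * c3 + n = y3\<^sup>2" and lin: "y1 * l1 + y2 * l2 + y3 * l3 = 0" for a y1 y2 y3
  proof -
    have "(y3 * l3)\<^sup>2 = (y1 * l1 + y2 * l2)\<^sup>2" using lin by (metis add_eq_0_iff power2_minus)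
    hence "l1\<^sup>2 * y1\<^sup>2 + l2\<^sup>2 * y2\<^sup>2 - l3\<^sup>2 * y3\<^sup>2 = - 2 * (l1 * l2) * (y1 * y2)"
      by (simp add: power2_eq_square algebra_simps)
    hence "(l1\<^sup>2 * y1\<^sup>2 + l2\<^sup>2 * y2\<^sup>2 - l3\<^sup>2 * y3\<^sup>2)\<^sup>2 = 4 * \<mu> * (y1\<^sup>2 * y2\<^sup>2)"
      by (simp add: \<mu>_def power_mult_distrib)
    hence "(l1\<^sup>2 * (a * c1 + n) + l2\<^sup>2 * (a * c2 + n) - l3\<^sup>2 * (a * c3 + n))\<^sup>2 = 4 * \<mu> * ((a * c1 + n) * (a * c2 + n))"
      unfolding e .
    moreover have "l1\<^sup>2 * (a * c1 + n) + l2\<^sup>2 * (a * c2 + n) - l3\<^sup>2 * (a * c3 + n) = p * a + q * n"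
      by (simp add: p_def q_def algebra_simps)
    ultimately have "(p * a + q * n)\<^sup>2 = 4 * \<mu> * ((a * c1 + n) * (a * c2 + n))" by simp
    thus ?thesis by (simp add: power2_eq_square algebra_simps)
  qed
  have "x11 * l1 + x12 * l2 + x13 * l3 = 0" "x21 * l1 + x22 * l2 + x23 * l3 = 0" "x31 * l1 + x32 * l2 + x33 * l3 = 0"
    using det by (simp_all add: l1_def l2_def l3_def det3_def algebra_simps)
  note z = quadratic_three_zeros[OF G[OF eq(1-3) this(1)] G[OF eq(4-6) this(2)] G[OF eq(7-9) this(3)] a]
  have pq: "p\<^sup>2 = 4 * \<mu> * (c1 * c2)" "p * q = 2 * \<mu> * (c1 + c2)" "q\<^sup>2 = 4 * \<mu>" using z n by simp_all
  have "(p * q)\<^sup>2 = p\<^sup>2 * q\<^sup>2" by (rule power_mult_distrib)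
  hence "(2 * \<mu> * (c1 + c2))\<^sup>2 = 4 * \<mu> * (c1 * c2) * (4 * \<mu>)" unfolding pq .
  moreover have "(2 * \<mu> * (c1 + c2))\<^sup>2 = (4 * \<mu>\<^sup>2) * (c1 + c2)\<^sup>2" by (simp add: power_mult_distrib)
  moreover have "4 * \<mu> * (c1 * c2) * (4 * \<mu>) = (4 * \<mu>\<^sup>2) * (4 * (c1 * c2))" by (simp add: power2_eq_square)
  ultimately have "(4 * \<mu>\<^sup>2) * (c1 + c2)\<^sup>2 = (4 * \<mu>\<^sup>2) * (4 * (c1 * c2))" by simp
  moreover have "4 * \<mu>\<^sup>2 \<noteq> 0" using l0 by (simp add: \<mu>_def)
  ultimately have "(c1 + c2)\<^sup>2 = 4 * (c1 * c2)" by (metis mult_cancel_left)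
  hence "(c1 - c2)\<^sup>2 = 0" by algebra
  thus False using c(1) by simp
qed

text \<open>The matrix with entries \<open>1 + A_i B_j\<close> has rank at most 2, so every term
  contains some \<open>e\<close>. The nine linear terms have cofactors
  \<open>(A_i - A_j) (B_k - B_l)\<close> of size at most \<open>4 \<tau>\<close>; there are also
  nine quadratic terms and three cubic ones, and \<open>78 = 9 * 4 + 9 * 4 + 3 * 2\<close>.\<close>

lemma det3_near_rank_two:
  fixes \<tau> A1 A2 A3 B1 B2 B3 e11 e12 e13 e21 e22 e23 e31 e32 e33 :: real
  assumes \<tau>: "0 \<le> \<tau>" "\<tau> \<le> 1"
    and AB: "\<bar>A1 * B1\<bar> \<le> \<tau>" "\<bar>A1 * B2\<bar> \<le> \<tau>" "\<bar>A1 * B3\<bar> \<le> \<tau>" "\<bar>A2 * B1\<bar> \<le> \<tau>" "\<bar>A2 * B2\<bar> \<le> \<tau>" "\<bar>A2 * B3\<bar> \<le> \<tau>"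
      "\<bar>A3 * B1\<bar> \<le> \<tau>" "\<bar>A3 * B2\<bar> \<le> \<tau>" "\<bar>A3 * B3\<bar> \<le> \<tau>"
    and e: "\<bar>e11\<bar> \<le> \<tau>\<^sup>2" "\<bar>e12\<bar> \<le> \<tau>\<^sup>2" "\<bar>e13\<bar> \<le> \<tau>\<^sup>2" "\<bar>e21\<bar> \<le> \<tau>\<^sup>2" "\<bar>e22\<bar> \<le> \<tau>\<^sup>2" "\<bar>e23\<bar> \<le> \<tau>\<^sup>2"
      "\<bar>e31\<bar> \<le> \<tau>\<^sup>2" "\<bar>e32\<bar> \<le> \<tau>\<^sup>2" "\<bar>e33\<bar> \<le> \<tau>\<^sup>2"
  shows "\<bar>det3 (1 + A1 * B1 + e11) (1 + A1 * B2 + e12) (1 + A1 * B3 + e13)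
      (1 + A2 * B1 + e21) (1 + A2 * B2 + e22) (1 + A2 * B3 + e23)
      (1 + A3 * B1 + e31) (1 + A3 * B2 + e32) (1 + A3 * B3 + e33)\<bar> \<le> 78 * \<tau> ^ 3"
proof -
  have id: "det3 (1 + A1 * B1 + e11) (1 + A1 * B2 + e12) (1 + A1 * B3 + e13)
      (1 + A2 * B1 + e21) (1 + A2 * B2 + e22) (1 + A2 * B3 + e23)
      (1 + A3 * B1 + e31) (1 + A3 * B2 + e32) (1 + A3 * B3 + e33)
    = (e11 * ((A2 - A3) * (B2 - B3)) + e12 * ((A2 - A3) * (B3 - B1)) + e13 * ((A2 - A3) * (B1 - B2))
     + e21 * ((A3 - A1) * (B2 - B3)) + e22 * ((A3 - A1) * (B3 - B1)) + e23 * ((A3 - A1) * (B1 - B2))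
     + e31 * ((A1 - A2) * (B2 - B3)) + e32 * ((A1 - A2) * (B3 - B1)) + e33 * ((A1 - A2) * (B1 - B2)))
    + ((1 + A1 * B1) * (e22 * e33 - e23 * e32) + (1 + A1 * B2) * (e23 * e31 - e21 * e33) + (1 + A1 * B3) * (e21 * e32 - e22 * e31)
     + (1 + A2 * B1) * (e32 * e13 - e33 * e12) + (1 + A2 * B2) * (e33 * e11 - e31 * e13) + (1 + A2 * B3) * (e31 * e12 - e32 * e11)
     + (1 + A3 * B1) * (e12 * e23 - e13 * e22) + (1 + A3 * B2) * (e13 * e21 - e11 * e23) + (1 + A3 * B3) * (e11 * e22 - e12 * e21))
    + (e31 * (e12 * e23 - e13 * e22) + e32 * (e13 * e21 - e11 * e23) + e33 * (e11 * e22 - e12 * e21))"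
    unfolding det3_def by (simp add: algebra_simps)
  have t4: "\<tau> ^ 4 \<le> \<tau> ^ 3" "\<tau> ^ 6 \<le> \<tau> ^ 3" using \<tau> by (auto intro!: power_decreasing)
  have T1: "\<bar>x * ((P - Q) * (R - S))\<bar> \<le> 4 * \<tau> ^ 3"
    if "\<bar>x\<bar> \<le> \<tau>\<^sup>2" "\<bar>P * R\<bar> \<le> \<tau>" "\<bar>P * S\<bar> \<le> \<tau>" "\<bar>Q * R\<bar> \<le> \<tau>" "\<bar>Q * S\<bar> \<le> \<tau>" for x P Q R S
  proof -
    have "(P - Q) * (R - S) = P * R - P * S - Q * R + Q * S" by (simp add: algebra_simps)
    hence "\<bar>(P - Q) * (R - S)\<bar> \<le> 4 * \<tau>" using that by linarith
    hence "\<bar>x\<bar> * \<bar>(P - Q) * (R - S)\<bar> \<le> \<tau>\<^sup>2 * (4 * \<tau>)" using that(1) by (intro mult_mono) auto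
    thus ?thesis by (simp add: abs_mult power2_eq_square power3_eq_cube)
  qed
  have E2: "\<bar>x * y - u * v\<bar> \<le> 2 * \<tau> ^ 4"
    if "\<bar>x\<bar> \<le> \<tau>\<^sup>2" "\<bar>y\<bar> \<le> \<tau>\<^sup>2" "\<bar>u\<bar> \<le> \<tau>\<^sup>2" "\<bar>v\<bar> \<le> \<tau>\<^sup>2" for x y u v
  proof -
    have "\<bar>x\<bar> * \<bar>y\<bar> \<le> \<tau>\<^sup>2 * \<tau>\<^sup>2" "\<bar>u\<bar> * \<bar>v\<bar> \<le> \<tau>\<^sup>2 * \<tau>\<^sup>2" using that by (intro mult_mono; simp)+
    moreover have "\<tau>\<^sup>2 * \<tau>\<^sup>2 = \<tau> ^ 4" by (simp flip: power_add)
    ultimately show ?thesis by (simp flip: abs_mult)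
  qed
  have T2: "\<bar>(1 + w) * (x * y - u * v)\<bar> \<le> 4 * \<tau> ^ 3"
    if "\<bar>w\<bar> \<le> \<tau>" "\<bar>x\<bar> \<le> \<tau>\<^sup>2" "\<bar>y\<bar> \<le> \<tau>\<^sup>2" "\<bar>u\<bar> \<le> \<tau>\<^sup>2" "\<bar>v\<bar> \<le> \<tau>\<^sup>2" for w x y u v
  proof -
    have "\<bar>1 + w\<bar> * \<bar>x * y - u * v\<bar> \<le> 2 * (2 * \<tau> ^ 4)"
      using that \<tau> E2[OF that(2-5)] by (intro mult_mono) auto
    thus ?thesis using t4 by (simp add: abs_mult)
  qed
  have T3: "\<bar>w * (x * y - u * v)\<bar> \<le> 2 * \<tau> ^ 3"
    if "\<bar>w\<bar> \<le> \<tau>\<^sup>2" "\<bar>x\<bar> \<le> \<tau>\<^sup>2" "\<bar>y\<bar> \<le> \<tau>\<^sup>2" "\<bar>u\<bar> \<le> \<tau>\<^sup>2" "\<bar>v\<bar> \<le> \<tau>\<^sup>2" for w x y u v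
  proof -
    have "\<bar>w\<bar> * \<bar>x * y - u * v\<bar> \<le> \<tau>\<^sup>2 * (2 * \<tau> ^ 4)"
      using that E2[OF that(2-5)] by (intro mult_mono) auto
    moreover have "\<tau>\<^sup>2 * (2 * \<tau> ^ 4) = 2 * \<tau> ^ 6" by (simp flip: power_add)
    ultimately show ?thesis using t4 unfolding abs_mult by linarith
  qed
  note t1 = T1[OF e(1) AB(5,6,8,9)] T1[OF e(2) AB(6,4,9,7)] T1[OF e(3) AB(4,5,7,8)]
    T1[OF e(4) AB(8,9,2,3)] T1[OF e(5) AB(9,7,3,1)] T1[OF e(6) AB(7,8,1,2)]
    T1[OF e(7) AB(2,3,5,6)] T1[OF e(8) AB(3,1,6,4)] T1[OF e(9) AB(1,2,4,5)]
  note t2 = T2[OF AB(1) e(5,9,6,8)] T2[OF AB(2) e(6,7,4,9)] T2[OF AB(3) e(4,8,5,7)]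
    T2[OF AB(4) e(8,3,9,2)] T2[OF AB(5) e(9,1,7,3)] T2[OF AB(6) e(7,2,8,1)]
    T2[OF AB(7) e(2,6,3,5)] T2[OF AB(8) e(3,4,1,6)] T2[OF AB(9) e(1,5,2,4)]
  note t3 = T3[OF e(7) e(2,6,3,5)] T3[OF e(8) e(3,4,1,6)] T3[OF e(9) e(1,5,2,4)]
  have abs_sum: "\<bar>x + y\<bar> \<le> u + v" if "\<bar>x\<bar> \<le> u" "\<bar>y\<bar> \<le> v" for x y u v :: real using that by linarith
  note s1 = abs_sum[OF abs_sum[OF abs_sum[OF abs_sum[OF abs_sum[OF abs_sum[OF abs_sum[OF abs_sum[OF t1(1) t1(2)] t1(3)] t1(4)] t1(5)] t1(6)] t1(7)] t1(8)] t1(9)]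
  note s2 = abs_sum[OF abs_sum[OF abs_sum[OF abs_sum[OF abs_sum[OF abs_sum[OF abs_sum[OF abs_sum[OF t2(1) t2(2)] t2(3)] t2(4)] t2(5)] t2(6)] t2(7)] t2(8)] t2(9)]
  note s3 = abs_sum[OF abs_sum[OF t3(1) t3(2)] t3(3)]
  from abs_sum[OF abs_sum[OF s1 s2] s3] show ?thesis unfolding id by simp
qed

lemma sqrt_factor_expansion:
  fixes a c n \<tau> :: real
  assumes "a > 0" "c > 0" "\<bar>n\<bar> / (a * c) \<le> \<tau>" "\<tau> \<le> 1"
  obtains E where "\<bar>E\<bar> \<le> \<tau>\<^sup>2" "sqrt (a * c + n) = sqrt a * sqrt c * (1 + n / (2 * a) * (1 / c) + E)"
proof -
  define t where "t = n / (a * c)"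
  have "\<bar>t\<bar> = \<bar>n\<bar> / (a * c)" using assms(1,2) by (simp add: t_def abs_mult)
  hence t: "\<bar>t\<bar> \<le> \<tau>" "\<bar>t\<bar> \<le> 1" using assms(3,4) by linarith+
  define r where "r = sqrt (1 + t)"
  have r2: "r\<^sup>2 = 1 + t" using t(2) by (simp add: r_def)
  define E where "E = r - 1 - t / 2"
  \<comment> \<open>An exact identity, as \<open>t = r^2 - 1\<close>; the error is thus of second
    order.\<close>
  have "E = - (r - 1)\<^sup>2 / 2" using r2 by (simp add: E_def power2_eq_square algebra_simps)
  moreover have "(r - 1)\<^sup>2 \<le> \<tau>\<^sup>2"
    using sqrt_one_plus_diff[OF t(2)] t(1) unfolding r_def by (intro iffD1[OF abs_le_square_iff]) auto
  ultimately have "\<bar>E\<bar> \<le> \<tau>\<^sup>2" using zero_le_power2[of "r - 1"] by linarith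
  moreover have "sqrt (a * c + n) = sqrt a * sqrt c * (1 + n / (2 * a) * (1 / c) + E)"
  proof -
    have "a * c + n = a * c * (1 + t)" using assms by (simp add: t_def field_simps)
    hence "sqrt (a * c + n) = sqrt a * sqrt c * r" by (simp add: real_sqrt_mult r_def)
    moreover have "r = 1 + n / (2 * a) * (1 / c) + E" by (simp add: E_def t_def)
    ultimately show ?thesis by simp
  qed
  ultimately show ?thesis by (rule that)
qed

lemma det3_scale:
  "det3 (r1 * s1 * x11) (r1 * s2 * x12) (r1 * s3 * x13) (r2 * s1 * x21) (r2 * s2 * x22) (r2 * s3 * x23)
     (r3 * s1 * x31) (r3 * s2 * x32) (r3 * s3 * x33)
   = (r1 * r2 * r3 * s1 * s2 * s3) * det3 x11 x12 x13 x21 x22 x23 x31 x32 (x33 :: real)"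
  unfolding det3_def by (simp add: algebra_simps)

text \<open>After scaling rows and columns by \<open>sqrt a_i\<close> and \<open>sqrt c_j\<close>,
  the entries are \<open>1 + A_i B_j\<close> up to \<open>\<tau>^2\<close>, where
  \<open>\<tau> = exp (h/17 - 2 h)\<close>. The determinant is at most \<open>78 \<tau>^3\<close>
  times six roots of size at most \<open>exp (21/40 h)\<close>, that is, of order
  \<open>exp (-2.67 h)\<close>.\<close>

lemma no_square_grid:
  fixes n a1 a2 a3 c1 c2 c3 x11 x12 x13 x21 x22 x23 x31 x32 x33 :: int and h :: real
  assumes n: "n \<noteq> 0" and a: "a1 \<noteq> a2" "a1 \<noteq> a3" "a2 \<noteq> a3" and c: "c1 \<noteq> c2" "c1 \<noteq> c3" "c2 \<noteq> c3"
    and pos: "a1 > 0" "a2 > 0" "a3 > 0" "c1 > 0" "c2 > 0" "c3 > 0"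
    and x: "x11 \<ge> 0" "x12 \<ge> 0" "x13 \<ge> 0" "x21 \<ge> 0" "x22 \<ge> 0" "x23 \<ge> 0" "x31 \<ge> 0" "x32 \<ge> 0" "x33 \<ge> 0"
    and eq: "a1 * c1 + n = x11\<^sup>2" "a1 * c2 + n = x12\<^sup>2" "a1 * c3 + n = x13\<^sup>2"
      "a2 * c1 + n = x21\<^sup>2" "a2 * c2 + n = x22\<^sup>2" "a2 * c3 + n = x23\<^sup>2"
      "a3 * c1 + n = x31\<^sup>2" "a3 * c2 + n = x32\<^sup>2" "a3 * c3 + n = x33\<^sup>2"
    and bd: "ln \<bar>n\<bar> \<le> h / 17" "h \<le> ln a1" "h \<le> ln a2" "h \<le> ln a3" "h \<le> ln c1" "h \<le> ln c2" "h \<le> ln c3"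
      "ln a1 \<le> 21/20 * h" "ln a2 \<le> 21/20 * h" "ln a3 \<le> 21/20 * h" "ln c1 \<le> 21/20 * h" "ln c2 \<le> 21/20 * h" "ln c3 \<le> 21/20 * h"
    and h: "h \<ge> 10"
  shows False
proof -
  define N where "N = real_of_int n"
  define \<tau> where "\<tau> = exp (h / 17 - 2 * h)"
  have \<tau>: "0 \<le> \<tau>" "\<tau> \<le> 1" using h by (auto simp: \<tau>_def)
  have Nle: "\<bar>N\<bar> \<le> exp (h / 17)" using bd(1) n by (simp add: N_def ln_ge_iff flip: ln_le_cancel_iff)
  have prod_ge: "\<bar>N\<bar> / (u * v) \<le> \<tau>" "u > 0" "v > 0" if "exp h \<le> u" "exp h \<le> v" for u v
  proof -
    show uv: "u > 0" "v > 0" using that by (meson exp_gt_zero less_le_trans)+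
    have "exp h * exp h \<le> u * v" using that uv by (intro mult_mono) auto
    hence "\<bar>N\<bar> / (u * v) \<le> exp (h / 17) / (exp h * exp h)" using Nle by (intro frac_le) auto
    also have "\<dots> = \<tau>" unfolding \<tau>_def by (simp only: exp_diff mult_2 exp_add)
    finally show "\<bar>N\<bar> / (u * v) \<le> \<tau>" .
  qed
  define r1 r2 r3 s1 s2 s3 where rs: "r1 = real_of_int a1" "r2 = real_of_int a2" "r3 = real_of_int a3"
    "s1 = real_of_int c1" "s2 = real_of_int c2" "s3 = real_of_int c3"
  have ge: "exp h \<le> r1" "exp h \<le> r2" "exp h \<le> r3" "exp h \<le> s1" "exp h \<le> s2" "exp h \<le> s3"
    using bd(2-7) pos unfolding rs by (simp_all add: ln_ge_iff)
  have half_le: "0 \<le> sqrt u \<and> sqrt u \<le> exp (21/40 * h)" if "u > 0" "ln u \<le> 21/20 * h" for u :: real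
  proof -
    have "u = exp (ln u)" using that by simp
    also have "\<dots> \<le> exp (21/20 * h)" using that(2) by (simp only: exp_le_cancel_iff)
    also have "exp (21/20 * h) = (exp (21/40 * h))\<^sup>2" by (simp flip: exp_double)
    finally have "sqrt u \<le> sqrt ((exp (21/40 * h))\<^sup>2)" by (rule real_sqrt_le_mono)
    thus ?thesis using that by simp
  qed
  have le: "0 \<le> sqrt r1 \<and> sqrt r1 \<le> exp (21/40 * h)" "0 \<le> sqrt r2 \<and> sqrt r2 \<le> exp (21/40 * h)" "0 \<le> sqrt r3 \<and> sqrt r3 \<le> exp (21/40 * h)"
    "0 \<le> sqrt s1 \<and> sqrt s1 \<le> exp (21/40 * h)" "0 \<le> sqrt s2 \<and> sqrt s2 \<le> exp (21/40 * h)" "0 \<le> sqrt s3 \<and> sqrt s3 \<le> exp (21/40 * h)"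
    using pos bd unfolding rs by (intro half_le; simp)+
  have xr: "real_of_int y = sqrt (real_of_int u * real_of_int v + N)" if "y \<ge> 0" "u * v + n = y\<^sup>2" for y u v
    using int_sqrt[OF that(1) that(2)[symmetric]] by (simp add: N_def)
  have ex: "\<exists>E. \<bar>E\<bar> \<le> \<tau>\<^sup>2 \<and> sqrt (u * v + N) = sqrt u * sqrt v * (1 + N / (2 * u) * (1 / v) + E)"
    if "exp h \<le> u" "exp h \<le> v" for u v
    using sqrt_factor_expansion[OF prod_ge(2,3,1)[OF that] \<tau>(2)] by metis
  obtain e11 where e11: "\<bar>e11\<bar> \<le> \<tau>\<^sup>2" "x11 = sqrt r1 * sqrt s1 * (1 + N / (2 * r1) * (1 / s1) + e11)"
    using ex[OF ge(1,4)] xr[OF x(1) eq(1)] unfolding rs by metis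
  obtain e12 where e12: "\<bar>e12\<bar> \<le> \<tau>\<^sup>2" "x12 = sqrt r1 * sqrt s2 * (1 + N / (2 * r1) * (1 / s2) + e12)"
    using ex[OF ge(1,5)] xr[OF x(2) eq(2)] unfolding rs by metis
  obtain e13 where e13: "\<bar>e13\<bar> \<le> \<tau>\<^sup>2" "x13 = sqrt r1 * sqrt s3 * (1 + N / (2 * r1) * (1 / s3) + e13)"
    using ex[OF ge(1,6)] xr[OF x(3) eq(3)] unfolding rs by metis
  obtain e21 where e21: "\<bar>e21\<bar> \<le> \<tau>\<^sup>2" "x21 = sqrt r2 * sqrt s1 * (1 + N / (2 * r2) * (1 / s1) + e21)"
    using ex[OF ge(2,4)] xr[OF x(4) eq(4)] unfolding rs by metis
  obtain e22 where e22: "\<bar>e22\<bar> \<le> \<tau>\<^sup>2" "x22 = sqrt r2 * sqrt s2 * (1 + N / (2 * r2) * (1 / s2) + e22)"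
    using ex[OF ge(2,5)] xr[OF x(5) eq(5)] unfolding rs by metis
  obtain e23 where e23: "\<bar>e23\<bar> \<le> \<tau>\<^sup>2" "x23 = sqrt r2 * sqrt s3 * (1 + N / (2 * r2) * (1 / s3) + e23)"
    using ex[OF ge(2,6)] xr[OF x(6) eq(6)] unfolding rs by metis
  obtain e31 where e31: "\<bar>e31\<bar> \<le> \<tau>\<^sup>2" "x31 = sqrt r3 * sqrt s1 * (1 + N / (2 * r3) * (1 / s1) + e31)"
    using ex[OF ge(3,4)] xr[OF x(7) eq(7)] unfolding rs by metis
  obtain e32 where e32: "\<bar>e32\<bar> \<le> \<tau>\<^sup>2" "x32 = sqrt r3 * sqrt s2 * (1 + N / (2 * r3) * (1 / s2) + e32)"
    using ex[OF ge(3,5)] xr[OF x(8) eq(8)] unfolding rs by metis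
  obtain e33 where e33: "\<bar>e33\<bar> \<le> \<tau>\<^sup>2" "x33 = sqrt r3 * sqrt s3 * (1 + N / (2 * r3) * (1 / s3) + e33)"
    using ex[OF ge(3,6)] xr[OF x(9) eq(9)] unfolding rs by metis
  have AB: "\<bar>N / (2 * u) * (1 / v)\<bar> \<le> \<tau>" if "exp h \<le> u" "exp h \<le> v" for u v
  proof -
    have half: "x / 2 \<le> x" if "x \<ge> 0" for x :: real using that by simp
    have "\<bar>N / (2 * u) * (1 / v)\<bar> = (\<bar>N\<bar> / (u * v)) / 2" using prod_ge(2,3)[OF that] by (simp add: abs_mult)
    also have "\<dots> \<le> \<bar>N\<bar> / (u * v)" using prod_ge(2,3)[OF that] by (intro half) simp
    also have "\<dots> \<le> \<tau>" by (rule prod_ge(1)[OF that])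
    finally show ?thesis .
  qed
  let ?d = "det3 x11 x12 x13 x21 x22 x23 x31 x32 x33"
  let ?D = "det3 (1 + N / (2 * r1) * (1 / s1) + e11) (1 + N / (2 * r1) * (1 / s2) + e12) (1 + N / (2 * r1) * (1 / s3) + e13)
    (1 + N / (2 * r2) * (1 / s1) + e21) (1 + N / (2 * r2) * (1 / s2) + e22) (1 + N / (2 * r2) * (1 / s3) + e23)
    (1 + N / (2 * r3) * (1 / s1) + e31) (1 + N / (2 * r3) * (1 / s2) + e32) (1 + N / (2 * r3) * (1 / s3) + e33)"
  let ?P = "sqrt r1 * sqrt r2 * sqrt r3 * sqrt s1 * sqrt s2 * sqrt s3"
  have "real_of_int ?d = det3 (real_of_int x11) (real_of_int x12) (real_of_int x13) (real_of_int x21) (real_of_int x22) (real_of_int x23)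
     (real_of_int x31) (real_of_int x32) (real_of_int x33)"
    by (simp add: det3_def)
  also have "\<dots> = ?P * ?D"
    unfolding e11(2) e12(2) e13(2) e21(2) e22(2) e23(2) e31(2) e32(2) e33(2) by (rule det3_scale)
  finally have "\<bar>real_of_int ?d\<bar> = ?P * \<bar>?D\<bar>" using le by (simp add: abs_mult)
  also have "\<dots> \<le> exp (21/40 * h) * exp (21/40 * h) * exp (21/40 * h) * exp (21/40 * h) * exp (21/40 * h) * exp (21/40 * h) * (78 * \<tau> ^ 3)"
  proof (rule mult_mono)
    show "\<bar>?D\<bar> \<le> 78 * \<tau> ^ 3"
      by (rule det3_near_rank_two[OF \<tau>]) (intro AB ge e11(1) e12(1) e13(1) e21(1) e22(1) e23(1) e31(1) e32(1) e33(1))+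
    show "?P \<le> exp (21/40 * h) * exp (21/40 * h) * exp (21/40 * h) * exp (21/40 * h) * exp (21/40 * h) * exp (21/40 * h)"
      using le by (intro mult_mono mult_nonneg_nonneg) auto
  qed auto
  also have "\<dots> = 78 * exp (63/20 * h + 3 * (h / 17 - 2 * h))"
    unfolding \<tau>_def by (simp add: exp_of_nat_mult[symmetric] flip: exp_add; simp add: algebra_simps)
  \<comment> \<open>The constant 78 becomes an exponent that \<open>h \<ge> 10\<close>
    outweighs.\<close>
  also have "\<dots> \<le> exp 10 * exp (63/20 * h + 3 * (h / 17 - 2 * h))"
  proof (rule mult_right_mono)
    have "(2::real) ^ 10 \<le> exp 1 ^ 10" using exp_ge_add_one_self[of 1] by (intro power_mono) auto
    also have "exp (1::real) ^ 10 = exp 10" by (simp flip: exp_of_nat_mult)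
    finally show "(78::real) \<le> exp 10" by simp
  qed simp
  also have "\<dots> = exp (10 + 63/20 * h + 3 * (h / 17 - 2 * h))" by (simp flip: exp_add add: add.assoc)
  also have "\<dots> < 1" using h by (simp add: field_simps)
  finally have "\<bar>?d\<bar> < 1" by linarith
  hence "?d = 0" by linarith
  thus False using square_grid_det_nonzero[OF n a c eq] by blast
qed

section \<open>Pigeonhole in a window\<close>

definition power_class :: "nat \<Rightarrow> int \<Rightarrow> bool" where
  "power_class j V \<longleftrightarrow> j = 0 \<and> (\<exists>y\<ge>1. V = y\<^sup>2) \<or> j = 1 \<and> (\<exists>y\<ge>1. V = y ^ 3) \<or> j = 2 \<and> (\<exists>y\<ge>1. \<exists>k\<ge>5. V = y ^ k)"

text \<open>Exponents below 5 are 2, 3 and 4, and fourth powers are squares.\<close>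

lemma power_class_exists:
  assumes "V \<in> int ` perfect_powers"
  shows "\<exists>j\<in>{0, 1, 2}. power_class j V"
proof -
  obtain x k where x: "x \<ge> 1" "k \<ge> 2" "V = int x ^ k" using assms by (auto simp: perfect_powers_def)
  consider "even k" | "3 dvd k" | "k \<ge> 5"
  proof -
    have "k \<in> {2, 3, 4} \<or> k \<ge> 5" using x(2) by auto
    thus ?thesis using that by auto
  qed
  thus ?thesis
  proof cases
    case 1
    then obtain m where "k = m * 2" by (metis dvdE mult.commute)
    hence "V = (int x ^ m)\<^sup>2" using x by (simp add: power_mult)
    moreover have "int x ^ m \<ge> 1" using x by simp
    ultimately have "power_class 0 V" unfolding power_class_def by blast
    thus ?thesis by blast
  next
    case 2
    then obtain m where "k = m * 3" by (metis dvdE mult.commute)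
    hence "V = (int x ^ m) ^ 3" using x by (simp add: power_mult)
    moreover have "int x ^ m \<ge> 1" using x by simp
    ultimately have "power_class 1 V" unfolding power_class_def by blast
    thus ?thesis by blast
  next
    case 3
    have "int x \<ge> 1" using x by simp
    hence "power_class 2 V" using 3 x unfolding power_class_def by blast
    thus ?thesis by blast
  qed
qed

text \<open>Of \<open>7 = 3 * 2 + 1\<close> fixed elements, three share a class with any given
  further element \<open>b\<close>. There are \<open>3 * 7^3 = 1029\<close> patterns of a class and
  three of the seven. As \<open>7 + 2 * 1029 < 2100\<close>, three further elements would share a
  pattern and complete a grid. For classes 1 and 2 a 2 by 2 corner of it is contradictory.\<close>

lemma window_bound:
  fixes n :: int and h :: real
  assumes K: "abc_bound (1/40) K" and A: "D_property n A" "finite A" and n: "n \<noteq> 0"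
    and hK: "h \<ge> 20 * (K + 4)" and nh: "ln \<bar>n\<bar> \<le> h / 17"
    and win: "\<forall>a\<in>A. h \<le> ln (real a) \<and> ln (real a) \<le> 21/20 * h"
  shows "card A \<le> 2100"
proof (rule ccontr)
  assume big: "\<not> card A \<le> 2100"
  have h: "h \<ge> 10" using K hK by (simp add: abc_bound_def)
  define K3 where "K3 = {0, 1, 2 :: nat}"
  have K3: "finite K3" "card K3 = 3" by (simp_all add: K3_def)
  have pos: "a > 0" if "a \<in> A" for a using A(1) that by (auto simp: D_property_def)
  have "\<forall>a b. \<exists>j. a \<in> A \<longrightarrow> b \<in> A \<longrightarrow> a \<noteq> b \<longrightarrow> j \<in> K3 \<and> power_class j (int a * int b + n)"
    using power_class_exists A(1) unfolding D_property_def K3_def by metis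
  then obtain col where col: "\<And>a b. a \<in> A \<Longrightarrow> b \<in> A \<Longrightarrow> a \<noteq> b \<Longrightarrow> col a b \<in> K3 \<and> power_class (col a b) (int a * int b + n)"
    by metis
  obtain U where U: "U \<subseteq> A" "card U = 7" "finite U" using obtain_subset_with_card_n[of 7 A] big by auto
  define B where "B = A - U"
  have finB: "finite B" using A(2) by (simp add: B_def)
  have "\<exists>j f. j \<in> K3 \<and> f \<in> {..<3::nat} \<rightarrow>\<^sub>E U \<and> inj_on f {..<3} \<and> (\<forall>i<3. col (f i) b = j)" if b: "b \<in> B" for b
  proof -
    have "(\<lambda>a. col a b) ` U \<subseteq> K3"
    proof
      fix j assume "j \<in> (\<lambda>a. col a b) ` U"
      then obtain a where a: "a \<in> U" "j = col a b" by blast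
      hence "a \<in> A" "b \<in> A" "a \<noteq> b" using b U(1) unfolding B_def by blast+
      from col[OF this] show "j \<in> K3" unfolding a(2) by (rule conjunct1)
    qed
    moreover have "card K3 * (3 - 1) < card U" using U(2) K3 by simp
    ultimately have "\<exists>j\<in>K3. \<exists>f\<in>{..<3::nat} \<rightarrow>\<^sub>E U. inj_on f {..<3} \<and> (\<forall>i<3. col (f i) b = j)"
      by (rule exists_monochromatic_injection[OF U(3) K3(1)])
    thus ?thesis by blast
  qed
  then obtain j f where jf: "\<And>b. b \<in> B \<Longrightarrow> j b \<in> K3 \<and> f b \<in> {..<3::nat} \<rightarrow>\<^sub>E U \<and> inj_on (f b) {..<3} \<and> (\<forall>i<3. col (f b i) b = j b)"
    by metis
  define R where "R = K3 \<times> ({..<3::nat} \<rightarrow>\<^sub>E U)"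
  have "card R = card K3 * (\<Prod>i<(3::nat). card U)" by (simp only: R_def card_cartesian_product card_PiE finite_lessThan)
  hence R: "card R = 1029" using U(2) K3(2) by simp
  have finR: "finite R" unfolding R_def using K3(1) U(3) by (intro finite_cartesian_product finite_PiE) auto
  have sub: "(\<lambda>b. (j b, f b)) ` B \<subseteq> R" using jf unfolding R_def by blast
  have "card A = card U + card B"
    using card_Diff_subset[OF U(3,1)] card_mono[OF A(2) U(1)] unfolding B_def by linarith
  hence "card R * 2 < card B" using big U R by simp
  then obtain r where r: "r \<in> R" "\<not> card {b \<in> B. (j b, f b) = r} \<le> 2"
    using card_le_fibers[OF finB finR sub, of 2] by fastforce
  hence "3 \<le> card {b \<in> B. (j b, f b) = r}" by linarith
  then obtain T where T: "T \<subseteq> {b \<in> B. (j b, f b) = r}" "card T = 3" by (meson obtain_subset_with_card_n)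
  obtain b1 b2 b3 where b: "T = {b1, b2, b3}" "b1 \<noteq> b2" "b1 \<noteq> b3" "b2 \<noteq> b3"
    using T(2) by (auto simp: card_3_iff)
  obtain J F where JF: "r = (J, F)" by fastforce
  have TB: "b \<in> B" "j b = J" "f b = F" if "b \<in> {b1, b2, b3}" for b using T(1) b(1) that JF by auto
  have F: "F i \<in> U" if "i < 3" for i
    using jf[OF TB(1)[of b1]] TB(3)[of b1] that by auto
  have Finj: "inj_on F {..<3}" using jf[OF TB(1)[of b1]] TB(3)[of b1] by auto
  define a1 a2 a3 where a: "a1 = F 0" "a2 = F 1" "a3 = F 2"
  have aU: "a1 \<in> U" "a2 \<in> U" "a3 \<in> U" using F by (auto simp: a)
  have adist: "a1 \<noteq> a2" "a1 \<noteq> a3" "a2 \<noteq> a3" 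
    using inj_on_eq_iff[OF Finj, of 0 1] inj_on_eq_iff[OF Finj, of 0 2] inj_on_eq_iff[OF Finj, of 1 2] by (simp_all add: a)
  have pc: "power_class J (int a * int b + n)" if ab: "a \<in> {a1, a2, a3}" "b \<in> {b1, b2, b3}" for a b
  proof -
    have "\<forall>i<3. col (F i) b = J" using jf[OF TB(1)[OF ab(2)]] TB[OF ab(2)] by auto
    hence "col a b = J" using ab(1) by (auto simp: a)
    moreover have "a \<in> A" "b \<in> A" "a \<noteq> b" using ab aU U(1) TB(1)[OF ab(2)] by (auto simp: B_def)
    ultimately show ?thesis using col by blast
  qed
  have mem: "a \<in> A" if "a \<in> {a1, a2, a3, b1, b2, b3}" for a
    using that aU U(1) TB(1)[of b1] TB(1)[of b2] TB(1)[of b3] by (auto simp: B_def)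
  have ln_bd: "h \<le> ln (real_of_int (int a))" "ln (real_of_int (int a)) \<le> 21/20 * h" "int a > 0"
    if "a \<in> {a1, a2, a3, b1, b2, b3}" for a
    using win mem[OF that] pos[OF mem[OF that]] by auto
  have vals: "2 * h - 1 \<le> ln (real_of_int (int a * int b + n))" "ln (real_of_int (int a * int b + n)) \<le> 21/10 * h + 1"
    if ab: "a \<in> {a1, a2, a3, b1, b2, b3}" "b \<in> {a1, a2, a3, b1, b2, b3}" for a b
  proof -
    have "real_of_int \<bar>n\<bar> \<le> real_of_int (int a)"
    proof -
      have "ln (real_of_int \<bar>n\<bar>) \<le> ln (real_of_int (int a))" using nh ln_bd(1)[OF ab(1)] h by simp
      thus ?thesis using n ln_bd(3)[OF ab(1)] by (subst (asm) ln_le_cancel_iff) auto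
    qed
    hence na: "\<bar>n\<bar> \<le> int a" by (simp only: of_int_le_iff)
    have "b \<noteq> 1" using ln_bd(1)[OF ab(2)] h by auto
    hence b2: "int b \<ge> 2" using ln_bd(3)[OF ab(2)] by simp
    show "2 * h - 1 \<le> ln (real_of_int (int a * int b + n))" "ln (real_of_int (int a * int b + n)) \<le> 21/10 * h + 1"
      using ln_shifted_product(2,3)[OF ln_bd(3)[OF ab(1)] b2 na] ln_bd[OF ab(1)] ln_bd[OF ab(2)] by linarith+
  qed
  have "J \<in> {0, 1, 2}" using r(1) JF by (auto simp: R_def K3_def)
  then consider "J = 0" | "J = 1" | "J = 2" by auto
  thus False
  proof cases
    case 1
    have ex: "\<exists>y\<ge>0. int a * int b + n = y\<^sup>2" if "a \<in> {a1, a2, a3}" "b \<in> {b1, b2, b3}" for a b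
    proof -
      from pc[OF that] obtain y where "y \<ge> 1" "int a * int b + n = y\<^sup>2" using 1 unfolding power_class_def by auto
      thus ?thesis by (intro exI[of _ y]) simp
    qed
    obtain x11 x12 x13 where x1: "x11 \<ge> 0" "int a1 * int b1 + n = x11\<^sup>2" "x12 \<ge> 0" "int a1 * int b2 + n = x12\<^sup>2" "x13 \<ge> 0" "int a1 * int b3 + n = x13\<^sup>2"
      using ex[of a1 b1] ex[of a1 b2] ex[of a1 b3] by auto
    obtain x21 x22 x23 where x2: "x21 \<ge> 0" "int a2 * int b1 + n = x21\<^sup>2" "x22 \<ge> 0" "int a2 * int b2 + n = x22\<^sup>2" "x23 \<ge> 0" "int a2 * int b3 + n = x23\<^sup>2"
      using ex[of a2 b1] ex[of a2 b2] ex[of a2 b3] by auto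
    obtain x31 x32 x33 where x3: "x31 \<ge> 0" "int a3 * int b1 + n = x31\<^sup>2" "x32 \<ge> 0" "int a3 * int b2 + n = x32\<^sup>2" "x33 \<ge> 0" "int a3 * int b3 + n = x33\<^sup>2"
      using ex[of a3 b1] ex[of a3 b2] ex[of a3 b3] by auto
    show False
      by (rule no_square_grid[of n "int a1" "int a2" "int a3" "int b1" "int b2" "int b3" x11 x12 x13 x21 x22 x23 x31 x32 x33 h])
         (use n adist b x1 x2 x3 ln_bd nh h in simp_all)
  next
    case 2
    have ex: "\<exists>y\<ge>1. int a * int b + n = y ^ 3" if "a \<in> {a1, a2, a3}" "b \<in> {b1, b2, b3}" for a b
      using pc[OF that] 2 by (auto simp: power_class_def)
    obtain x11 x12 x21 x22 where x: "x11 \<ge> 1" "int a1 * int b1 + n = x11 ^ 3" "x12 \<ge> 1" "int a1 * int b2 + n = x12 ^ 3"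
        "x21 \<ge> 1" "int a2 * int b1 + n = x21 ^ 3" "x22 \<ge> 1" "int a2 * int b2 + n = x22 ^ 3"
      using ex[of a1 b1] ex[of a1 b2] ex[of a2 b1] ex[of a2 b2] by auto
    show False
      by (rule no_cube_rectangle[of n "int a1" "int a2" "int b1" "int b2" h x11 x12 x21 x22])
         (use n adist b x ln_bd nh h vals(1)[of a1 b1] vals(1)[of a2 b2] in \<open>simp_all del: of_int_add of_int_mult\<close>)
  next
    case 3
    have ex: "\<exists>y\<ge>1. \<exists>k\<ge>5. int a * int b + n = y ^ k" if "a \<in> {a1, a2, a3}" "b \<in> {b1, b2, b3}" for a b
      using pc[OF that] 3 by (auto simp: power_class_def)
    obtain z11 k11 where z11: "z11 \<ge> 1" "k11 \<ge> 5" "int a1 * int b1 + n = z11 ^ k11" using ex[of a1 b1] by auto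
    obtain z12 k12 where z12: "z12 \<ge> 1" "k12 \<ge> 5" "int a1 * int b2 + n = z12 ^ k12" using ex[of a1 b2] by auto
    obtain z21 k21 where z21: "z21 \<ge> 1" "k21 \<ge> 5" "int a2 * int b1 + n = z21 ^ k21" using ex[of a2 b1] by auto
    obtain z22 k22 where z22: "z22 \<ge> 1" "k22 \<ge> 5" "int a2 * int b2 + n = z22 ^ k22" using ex[of a2 b2] by auto
    show False
      by (rule no_high_power_rectangle[OF K n _ _ ln_bd(3) ln_bd(3) ln_bd(3) ln_bd(3) nh ln_bd(2) ln_bd(2) ln_bd(2) ln_bd(2) hK
        z11(1) z12(1) z21(1) z22(1) z11(2) z12(2) z21(2) z22(2) z11(3) z12(3) z21(3) z22(3) vals(1) vals(1) vals(2) vals(2) vals(2) vals(2)])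
        (use adist b in simp_all)
  qed
qed

section \<open>Large elements\<close>

lemma D_property_subset: "D_property n A \<Longrightarrow> B \<subseteq> A \<Longrightarrow> D_property n B"
  unfolding D_property_def by blast

lemma ln_lt_imp_power_le:
  fixes b c :: nat
  assumes "b > 0" "c > 0" "real k * ln (real b) \<le> ln (real c)"
  shows "b ^ k \<le> c"
proof -
  have "ln (real b ^ k) \<le> ln (real c)" using assms by (simp add: ln_realpow)
  hence "real b ^ k \<le> real c" using assms by (subst (asm) ln_le_cancel_iff) auto
  thus ?thesis by (simp flip: of_nat_power)
qed

text \<open>Let \<open>a\<close>, \<open>b\<close> be the two least elements. All others have
  logarithms within a factor 100 of \<open>ln b\<close> or exceed \<open>b^100\<close>; with
  \<open>c\<close> the least of the latter, none reaches \<open>c^100\<close> by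
  \<open>no_sparse_square_quadruple\<close>. This leaves \<open>a\<close> and two ranges, each
  covered by 101 windows.\<close>

lemma large_bound:
  fixes n :: int
  assumes K1: "abc_bound (1/10) K1" and K2: "abc_bound (1/40) K2" and A: "D_property n A" "finite A" and n: "n \<noteq> 0"
    and H: "H \<ge> 20 * (K2 + 4)" "H \<ge> K1 + 4" "H \<ge> ln 4096"
    and large: "\<forall>a\<in>A. H \<le> ln (real a) \<and> 2 * \<bar>n\<bar> ^ 17 < int a"
  shows "card A \<le> 1 + 212100 + 212100"
proof -
  have H10: "H \<ge> 10" using K2 H(1) by (simp add: abc_bound_def)
  have pos: "a > 0" if "a \<in> A" for a using A(1) that by (auto simp: D_property_def)
  have sub: "D_property n B" if "B \<subseteq> A" for B by (rule D_property_subset[OF A(1) that])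
  have nle: "\<bar>n\<bar> \<le> int a" if "a \<in> A" for a
  proof -
    have "\<bar>n\<bar> ^ 1 \<le> \<bar>n\<bar> ^ 17" using n by (intro power_increasing) auto
    moreover have "2 * \<bar>n\<bar> ^ 17 < int a" using large that by blast
    moreover have "\<bar>n\<bar> ^ 17 \<ge> 0" by (rule zero_le_power) simp
    ultimately show ?thesis unfolding power_one_right by linarith
  qed
  have ln_n: "ln (real_of_int \<bar>n\<bar>) \<le> ln (real a) / 17" if "a \<in> A" for a
  proof -
    have "2 * \<bar>n\<bar> ^ 17 < int a" using large that by blast
    moreover have "\<bar>n\<bar> ^ 17 \<ge> 0" by (rule zero_le_power) simp
    ultimately have "\<bar>n\<bar> ^ 17 \<le> int a" by linarith
    hence "real_of_int (\<bar>n\<bar> ^ 17) \<le> real_of_int (int a)" by (simp only: of_int_le_iff)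
    hence "ln (real_of_int \<bar>n\<bar> ^ 17) \<le> ln (real a)" using n pos[OF that] by (subst ln_le_cancel_iff) auto
    moreover have "ln (real_of_int \<bar>n\<bar> ^ 17) = 17 * ln (real_of_int \<bar>n\<bar>)" using n by (simp add: ln_realpow)
    ultimately show ?thesis by linarith
  qed
  have windows: "card {a \<in> A. h \<le> ln (real a) \<and> ln (real a) \<le> (21/20) ^ m * h} \<le> 2100 * (m + 1)"
    if h: "h \<ge> H" "ln (real_of_int \<bar>n\<bar>) \<le> h / 17" for h m
  proof (induction m)
    case 0
    have "h \<le> 21/20 * h" using h H10 by simp
    thus ?case using h H A(2)
      by (intro order.trans[OF window_bound[OF K2 sub _ n _ h(2)]]) auto
  next
    case (Suc m)
    define h' where "h' = (21/20) ^ m * h"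
    have "1 \<le> (21/20 :: real) ^ m" by (intro one_le_power) simp
    hence "1 * h \<le> h'" unfolding h'_def using h H10 by (intro mult_right_mono) auto
    hence h': "h \<le> h'" by simp
    have "{a \<in> A. h \<le> ln (real a) \<and> ln (real a) \<le> (21/20) ^ Suc m * h}
      \<subseteq> {a \<in> A. h \<le> ln (real a) \<and> ln (real a) \<le> (21/20) ^ m * h} \<union> {a \<in> A. h' \<le> ln (real a) \<and> ln (real a) \<le> 21/20 * h'}"
      by (auto simp: h'_def)
    hence "card {a \<in> A. h \<le> ln (real a) \<and> ln (real a) \<le> (21/20) ^ Suc m * h}
      \<le> card ({a \<in> A. h \<le> ln (real a) \<and> ln (real a) \<le> (21/20) ^ m * h} \<union> {a \<in> A. h' \<le> ln (real a) \<and> ln (real a) \<le> 21/20 * h'})"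
      using A(2) by (intro card_mono) auto
    also have "\<dots> \<le> card {a \<in> A. h \<le> ln (real a) \<and> ln (real a) \<le> (21/20) ^ m * h} + card {a \<in> A. h' \<le> ln (real a) \<and> ln (real a) \<le> 21/20 * h'}"
      by (rule card_Un_le)
    also have "card {a \<in> A. h' \<le> ln (real a) \<and> ln (real a) \<le> 21/20 * h'} \<le> 2100"
      using h h' H A(2) by (intro window_bound[OF K2 sub _ n, of _ h']) auto
    finally show ?case using Suc by simp
  qed
  have W: "card {a \<in> A. ln (real b) \<le> ln (real a) \<and> ln (real a) \<le> 100 * ln (real b)} \<le> 212100" if b: "b \<in> A" for b
  proof -
    have lb: "H \<le> ln (real b)" using large b by blast
    \<comment> \<open>\<open>(21/20)^100\<close> is about 131, so the range is exhausted after 100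
      enlargements, and \<open>212100 = 2100 * 101\<close>.\<close>
    have "(100::real) \<le> (21/20) ^ 100" by (simp add: power_divide)
    hence "100 * ln (real b) \<le> (21/20) ^ 100 * ln (real b)" using lb H10 by (intro mult_right_mono) auto
    hence "{a \<in> A. ln (real b) \<le> ln (real a) \<and> ln (real a) \<le> 100 * ln (real b)}
      \<subseteq> {a \<in> A. ln (real b) \<le> ln (real a) \<and> ln (real a) \<le> (21/20) ^ 100 * ln (real b)}" by auto
    hence "card {a \<in> A. ln (real b) \<le> ln (real a) \<and> ln (real a) \<le> 100 * ln (real b)}
      \<le> card {a \<in> A. ln (real b) \<le> ln (real a) \<and> ln (real a) \<le> (21/20) ^ 100 * ln (real b)}"
      using A(2) by (intro card_mono) auto
    also have "\<dots> \<le> 2100 * (100 + 1)" by (rule windows[OF lb ln_n[OF b]])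
    finally show ?thesis by simp
  qed
  have rep: "\<exists>z k. z \<ge> 1 \<and> k \<ge> 2 \<and> int a * int b + n = z ^ k" if "a \<in> A" "b \<in> A" "a \<noteq> b" for a b
  proof -
    have "int a * int b + n \<in> int ` perfect_powers" using A(1) that unfolding D_property_def by blast
    then obtain x k where "x \<ge> 1" "k \<ge> 2" "int a * int b + n = int (x ^ k)" unfolding perfect_powers_def by blast
    thus ?thesis by (intro exI[of _ "int x"] exI[of _ k]) auto
  qed
  have sq: "(\<exists>z\<ge>0. z\<^sup>2 = int a * int c + n) \<and> (\<exists>w\<ge>0. w\<^sup>2 = int b * int c + n)"
    if abc: "a \<in> A" "b \<in> A" "c \<in> A" and ab: "a < b" and bc: "b ^ 100 \<le> c" for a b c
  proof -
    have b1: "b > 1" using ab pos[OF abc(1)] by simp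
    have "b ^ 1 < b ^ 100" using b1 by (intro power_strict_increasing) auto
    hence "b < c" using bc by simp
    then obtain z w k l where zw: "z \<ge> 1" "k \<ge> 2" "int a * int c + n = z ^ k" "w \<ge> 1" "l \<ge> 2" "int b * int c + n = w ^ l"
      using rep[OF abc(1,3)] rep[OF abc(2,3)] ab by auto
    have "int b ^ 100 \<le> int c" using bc by (metis of_nat_le_iff of_nat_power)
    moreover have "K1 + 4 \<le> ln (real_of_int (int b))" using large abc(2) H by fastforce
    ultimately have "k = 2 \<and> l = 2"
      using sparse_exponents[OF K1 n nle[OF abc(1)] _ _ _ _ zw(1,4,2,5,3,6)] pos[OF abc(1)] ab by simp
    thus ?thesis using zw by (metis zero_le_one order.trans)
  qed
  have chain: False if abcd: "a \<in> A" "b \<in> A" "c \<in> A" "d \<in> A" and ord: "a < b" "b ^ 100 \<le> c" "c ^ 100 \<le> d" for a b c d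
  proof -
    have b1: "b > 1" using ord(1) pos[OF abcd(1)] by simp
    have "b ^ 1 < b ^ 100" using b1 by (intro power_strict_increasing) auto
    hence bc: "b < c" using ord(2) by simp
    have "b ^ 100 \<le> c ^ 100" using bc by (intro power_mono) auto
    hence bd: "b ^ 100 \<le> d" using ord(3) by linarith
    obtain s t where st: "s \<ge> 0" "s\<^sup>2 = int a * int c + n" "t \<ge> 0" "t\<^sup>2 = int b * int c + n"
      using sq[OF abcd(1,2,3) ord(1,2)] by blast
    obtain x y where xy: "x \<ge> 0" "x\<^sup>2 = int a * int d + n" "y \<ge> 0" "y\<^sup>2 = int b * int d + n"
      using sq[OF abcd(1,2,4) ord(1) bd] by blast
    \<comment> \<open>The remaining product is a square because the triple \<open>b\<close>,
      \<open>c\<close>, \<open>d\<close> is sparse as well.\<close>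
    obtain w where w: "w \<ge> 0" "w\<^sup>2 = int c * int d + n"
      using sq[OF abcd(2,3,4) bc ord(3)] by blast
    have "ln 4096 \<le> ln (real b)" using large abcd(2) H(3) by fastforce
    hence "4096 \<le> real b" using b1 by (subst (asm) ln_le_cancel_iff) auto
    hence "int b \<ge> 4096" by linarith
    moreover have "int b ^ 100 \<le> int c" "int c ^ 100 \<le> int d" using ord by (metis of_nat_le_iff of_nat_power)+
    ultimately show False
      using no_sparse_square_quadruple[of "int a" "int b" n "int c" "int d" s t x y w] st xy w n nle[OF abcd(1)] pos[OF abcd(1)] ord(1) by simp
  qed
  show "card A \<le> 1 + 212100 + 212100"
  proof (cases "A = {}")
    case False
    define a where "a = Min A"
    have a: "a \<in> A" "\<And>x. x \<in> A \<Longrightarrow> a \<le> x" using A(2) False by (auto simp: a_def)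
    show ?thesis
    proof (cases "A - {a} = {}")
      case True
      hence "A \<subseteq> {a}" by blast
      hence "card A \<le> card {a}" by (intro card_mono) auto
      thus ?thesis by simp
    next
      case ne: False
      define b where "b = Min (A - {a})"
      have "b \<in> A - {a}" unfolding b_def using A(2) ne by (intro Min_in) auto
      hence b: "b \<in> A" "a < b" using a(2)[of b] by auto
      have bmin: "b \<le> x" if "x \<in> A - {a}" for x unfolding b_def using A(2) that by (intro Min_le) auto
      define W1 where "W1 = {x \<in> A. ln (real b) \<le> ln (real x) \<and> ln (real x) \<le> 100 * ln (real b)}"
      define A2 where "A2 = {x \<in> A. 100 * ln (real b) < ln (real x)}"
      have cover: "A \<subseteq> {a} \<union> W1 \<union> A2"
      proof
        fix x assume x: "x \<in> A"
        show "x \<in> {a} \<union> W1 \<union> A2"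
        proof (cases "x = a")
          case False
          hence "ln (real b) \<le> ln (real x)" using bmin[of x] x pos b by auto
          thus ?thesis using x by (auto simp: W1_def A2_def)
        qed simp
      qed
      have c2: "card A2 \<le> 212100"
      proof (cases "A2 = {}")
        case False
        define c where "c = Min A2"
        have fin2: "finite A2" using A(2) by (simp add: A2_def)
        have c: "c \<in> A2" "\<And>x. x \<in> A2 \<Longrightarrow> c \<le> x" using fin2 False by (auto simp: c_def)
        have cA: "c \<in> A" using c(1) by (simp add: A2_def)
        have bc: "b ^ 100 \<le> c"
          using ln_lt_imp_power_le[of b c 100] c(1) pos[OF b(1)] pos[OF cA] by (simp add: A2_def)
        have "A2 \<subseteq> {x \<in> A. ln (real c) \<le> ln (real x) \<and> ln (real x) \<le> 100 * ln (real c)}"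
        proof
          fix x assume x: "x \<in> A2"
          hence xA: "x \<in> A" by (simp add: A2_def)
          have "ln (real c) \<le> ln (real x)" using c(2)[OF x] pos[OF cA] pos[OF xA] by simp
          moreover have "ln (real x) \<le> 100 * ln (real c)"
          proof (rule ccontr)
            assume "\<not> ?thesis"
            hence "c ^ 100 \<le> x" using ln_lt_imp_power_le[of c x 100] pos[OF cA] pos[OF xA] by simp
            thus False using chain[OF a(1) b(1) cA xA b(2) bc] by blast
          qed
          ultimately show "x \<in> {x \<in> A. ln (real c) \<le> ln (real x) \<and> ln (real x) \<le> 100 * ln (real c)}" using xA by simp
        qed
        hence "card A2 \<le> card {x \<in> A. ln (real c) \<le> ln (real x) \<and> ln (real x) \<le> 100 * ln (real c)}"
          using A(2) by (intro card_mono) auto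
        also have "\<dots> \<le> 212100" by (rule W[OF cA])
        finally show ?thesis .
      qed simp
      have "finite W1" "finite A2" using A(2) by (auto simp: W1_def A2_def)
      hence "card A \<le> card ({a} \<union> W1 \<union> A2)" using cover by (intro card_mono) auto
      also have "\<dots> \<le> card ({a} \<union> W1) + card A2" by (rule card_Un_le)
      also have "card ({a} \<union> W1) \<le> card {a} + card W1" by (rule card_Un_le)
      also have "card W1 \<le> 212100" unfolding W1_def by (rule W[OF b(1)])
      finally show ?thesis using c2 by simp
    qed
  qed simp
qed

lemma large_elements_bound:
  assumes "ABC_conjecture"
  obtains C0 :: nat where "\<And>(n::int) (A::nat set). D_property n A \<Longrightarrow> n \<noteq> 0 \<Longrightarrow>
    finite {a \<in> A. 2 * \<bar>n\<bar> ^ 17 < int a} \<and> card {a \<in> A. 2 * \<bar>n\<bar> ^ 17 < int a} \<le> C0"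
proof -
  obtain K1 K2 where K: "abc_bound (1/10) K1" "abc_bound (1/40) K2"
    using ABC_abc_bound[OF assms, of "1/10"] ABC_abc_bound[OF assms, of "1/40"] by auto
  define H where "H = max (20 * (K2 + 4)) (max (K1 + 4) (ln 4096))"
  define C0 :: nat where "C0 = 1 + 212100 + 212100"
  \<comment> \<open>Elements too small for the ABC constants. \<open>H\<close> depends on these
    constants only, so the size of \<open>S\<close> is absolute.\<close>
  define S where "S = {..nat \<lceil>exp H\<rceil>}"
  define C where "C = card S + C0"
  have bound: "card B \<le> C" if B: "D_property n B" "finite B" "n \<noteq> 0" "\<forall>a\<in>B. 2 * \<bar>n\<bar> ^ 17 < int a" for n B
  proof -
    have "card (B - S) \<le> C0"
      unfolding C0_def
    proof (rule large_bound[OF K, of n _ H])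
      show "D_property n (B - S)" by (rule D_property_subset[OF B(1)]) blast
      show "\<forall>a\<in>B - S. H \<le> ln (real a) \<and> 2 * \<bar>n\<bar> ^ 17 < int a"
      proof
        fix a assume a: "a \<in> B - S"
        hence "nat \<lceil>exp H\<rceil> < a" by (simp add: S_def)
        hence e: "exp H < real a" by linarith
        hence "0 < real a" using exp_gt_zero[of H] by linarith
        hence "H \<le> ln (real a)" using e by (subst ln_ge_iff) auto
        thus "H \<le> ln (real a) \<and> 2 * \<bar>n\<bar> ^ 17 < int a" using B(4) a by blast
      qed
    qed (use B in \<open>auto simp: H_def\<close>)
    moreover have "card B \<le> card (S \<union> (B - S))" using B(2) by (intro card_mono) (auto simp: S_def)
    moreover have "card (S \<union> (B - S)) \<le> card S + card (B - S)" by (rule card_Un_le)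
    ultimately show ?thesis by (simp add: C_def)
  qed
  show ?thesis
  proof (rule that[of C])
    fix n :: int and A :: "nat set"
    assume A: "D_property n A" "n \<noteq> 0"
    let ?B = "{a \<in> A. 2 * \<bar>n\<bar> ^ 17 < int a}"
    have sub: "D_property n T" if "T \<subseteq> ?B" for T by (rule D_property_subset[OF A(1)]) (use that in blast)
    \<comment> \<open>The counting argument speaks of finite sets; an infinite one would contain a
      finite subset exceeding the uniform bound.\<close>
    have "finite ?B"
    proof (rule ccontr)
      assume "infinite ?B"
      then obtain T where T: "T \<subseteq> ?B" "finite T" "card T = Suc C" using infinite_arbitrarily_large[of ?B "Suc C"] by blast
      hence "card T \<le> C" using sub[OF T(1)] A(2) by (intro bound[of n]) auto
      thus False using T(3) by simp
    qed
    thus "finite ?B \<and> card ?B \<le> C" using sub[of ?B] A(2) by (intro conjI bound[of n]) auto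
  qed
qed

section \<open>Constants of the explicit bound\<close>

lemma ln_2_ge_half: "(1/2::real) \<le> ln 2"
proof -
  have "exp (1/2::real) \<le> 2"
  proof -
    have "exp (1/2::real) ^ 2 = exp 1" by (simp flip: exp_double)
    also have "\<dots> \<le> 2 ^ 2" using exp_le by simp
    finally show ?thesis by (rule power2_le_imp_le) simp
  qed
  thus ?thesis by (subst ln_ge_iff) auto
qed

text \<open>\<open>l\<close> is about the binary logarithm of \<open>N\<close>, and \<open>m\<close>
  exceeds that of \<open>l\<close> by about 10 because \<open>1024 = 2^10\<close>. Binary logarithms
  are at most twice the natural ones, which leads to
  \<open>m \<le> 15 + 2 ln (ln N)\<close>.\<close>

lemma log_scale_parameters:
  fixes N :: real
  assumes "N \<ge> 2"
  obtains l m :: nat where "l \<ge> 1" "N \<le> 2 ^ l" "1024 * l \<le> 2 ^ m" "m \<ge> 10" "(real m)\<^sup>2 \<le> 450 + 8 * (ln (ln N))\<^sup>2"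
proof -
  have lnN: "ln N \<ge> 1/2" using assms ln_2_ge_half by (meson ln_le_cancel_iff less_le_trans order.trans zero_less_numeral)
  define l where "l = nat \<lceil>log 2 N\<rceil>"
  have log1: "log 2 N \<ge> 1" using assms by simp
  have l: "log 2 N \<le> real l" "real l \<le> log 2 N + 1" using log1 unfolding l_def by linarith+
  hence l1: "l \<ge> 1" using log1 by linarith
  have "N = 2 powr log 2 N" using assms by simp
  also have "\<dots> \<le> 2 powr real l" using l by (intro powr_mono) auto
  finally have Nl: "N \<le> 2 ^ l" by (simp add: powr_realpow)
  define k where "k = nat \<lceil>log 2 (real l)\<rceil>"
  have logl: "log 2 (real l) \<ge> 0" using l1 by simp
  have k: "log 2 (real l) \<le> real k" "real k \<le> log 2 (real l) + 1" using logl unfolding k_def by linarith+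
  have "real l = 2 powr log 2 (real l)" using l1 by simp
  also have "\<dots> \<le> 2 powr real k" using k by (intro powr_mono) auto
  also have "\<dots> = real (2 ^ k)" by (simp add: powr_realpow)
  finally have lk: "l \<le> 2 ^ k" by (simp only: of_nat_le_iff)
  have inv: "x / ln 2 \<le> 2 * x" if "x \<ge> 0" for x :: real
  proof -
    have "x * (1/2) \<le> x * ln 2" using that ln_2_ge_half by (intro mult_left_mono)
    thus ?thesis using ln_2_ge_half by (simp add: field_simps)
  qed
  have "log 2 N \<le> 2 * ln N" unfolding log_def using lnN by (intro inv) simp
  hence "real l \<le> 4 * ln N" using l lnN by linarith
  hence "ln (real l) \<le> ln (4 * ln N)" using l1 lnN by (subst ln_le_cancel_iff) auto
  also have "\<dots> = 2 * ln 2 + ln (ln N)" using lnN ln_realpow[of 2 2] by (simp add: ln_mult)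
  also have "\<dots> \<le> 2 + ln (ln N)" using ln_2_le by simp
  finally have lnl: "ln (real l) \<le> 2 + ln (ln N)" .
  have "log 2 (real l) \<le> 2 * ln (real l)" unfolding log_def using l1 by (intro inv) simp
  hence km: "real (10 + k) \<le> 15 + 2 * ln (ln N)" using k lnl by simp
  \<comment> \<open>\<open>ln (ln N)\<close> may be negative, but \<open>10 + k\<close> is not, so
    squaring is monotone here. The constants come from \<open>(u + v)^2 \<le> 2 u^2 + 2 v^2\<close>
    with \<open>u = 15\<close>.\<close>
  have "(real (10 + k))\<^sup>2 \<le> (15 + 2 * ln (ln N))\<^sup>2" using km by (intro power_mono) auto
  also have "\<dots> \<le> 450 + 8 * (ln (ln N))\<^sup>2"
    using zero_le_power2[of "15 - 2 * ln (ln N)"] by (simp add: power2_eq_square algebra_simps)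
  finally have "(real (10 + k))\<^sup>2 \<le> 450 + 8 * (ln (ln N))\<^sup>2" .
  moreover have "1024 * l \<le> 2 ^ (10 + k)" using lk by (simp add: power_add)
  ultimately show ?thesis using that[of l "10 + k"] l1 Nl by simp
qed

lemma M_inf_le:
  assumes "\<And>A. D_property n A \<Longrightarrow> finite A \<and> card A \<le> c"
  shows "M_inf n \<le> enat c"
  unfolding M_inf_def
proof (rule Sup_least)
  fix x assume "x \<in> {ecard A | A. D_property n A}"
  then obtain A where "x = ecard A" "D_property n A" by blast
  thus "x \<le> enat c" using assms[of A] by (simp add: ecard_def)
qed

lemma ereal_M_inf_le:
  assumes "M_inf n \<le> enat c" "real c \<le> x"
  shows "ereal_of_enat (M_inf n) \<le> ereal x"
proof -
  have "ereal_of_enat (M_inf n) \<le> ereal_of_enat (enat c)" using assms(1) by (simp only: ereal_of_enat_le_iff)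
  also have "\<dots> = ereal (real c)" by simp
  also have "\<dots> \<le> ereal x" using assms(2) by simp
  finally show ?thesis .
qed

lemma card_le_f_tilde:
  assumes "D_property n S" "1 \<le> \<bar>n\<bar>" "real_of_int \<bar>n\<bar> \<le> x" "S \<subseteq> {a. 1 \<le> a \<and> real a \<le> x}"
  shows "card S \<le> f_tilde x"
  unfolding f_tilde_def using assms by (intro Max_ge f_tilde_candidates_finite) blast

theorem theorem2p17:
  assumes "ABC_conjecture"
  shows "(\<exists>C::real. \<forall>n::int. n \<noteq> 0 \<longrightarrow>
            ereal_of_enat (M_inf n) \<le> ereal (C * real (f_tilde (2 * real_of_int \<bar>n\<bar> ^ 17))))
       \<and> (\<exists>(L::real) (C'::real). \<forall>n::int. \<bar>n\<bar> \<ge> 2 \<longrightarrow>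
            ereal_of_enat (M_inf n)
              \<le> ereal (C' * exp (L * (ln (ln (real_of_int \<bar>n\<bar>))) ^ 2)))"
proof -
  obtain C0 :: nat where C0: "\<And>(n::int) (A::nat set). D_property n A \<Longrightarrow> n \<noteq> 0 \<Longrightarrow>
    finite {a \<in> A. 2 * \<bar>n\<bar> ^ 17 < int a} \<and> card {a \<in> A. 2 * \<bar>n\<bar> ^ 17 < int a} \<le> C0"
    using large_elements_bound[OF assms] by blast
  have split: "finite A \<and> card A \<le> c + C0"
    if A: "D_property n A" "n \<noteq> 0" and c: "card {a \<in> A. int a \<le> 2 * \<bar>n\<bar> ^ 17} \<le> c" for n A c
  proof -
    let ?S = "{a \<in> A. int a \<le> 2 * \<bar>n\<bar> ^ 17}" and ?B = "{a \<in> A. 2 * \<bar>n\<bar> ^ 17 < int a}"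
    have eq: "A = ?S \<union> ?B" by auto
    have "?S \<subseteq> {..nat (2 * \<bar>n\<bar> ^ 17)}" by (auto simp: le_nat_iff)
    hence "finite ?S" using finite_subset by blast
    hence fin: "finite A" by (rule finite_subset[OF eq_refl[OF eq] finite_UnI]) (use C0[OF A] in blast)
    have "card A = card (?S \<union> ?B)" by (rule arg_cong[OF eq])
    also have "\<dots> \<le> card ?S + card ?B" by (rule card_Un_le)
    finally have "card A \<le> card ?S + card ?B" .
    thus ?thesis using C0[OF A] c fin by linarith
  qed
  have sub: "D_property n {a \<in> A. int a \<le> 2 * \<bar>n\<bar> ^ 17}" if "D_property n A" for n A
    by (rule D_property_subset[OF that]) blast
  have part1: "ereal_of_enat (M_inf n) \<le> ereal ((1 + real C0) * real (f_tilde (2 * real_of_int \<bar>n\<bar> ^ 17)))" if n: "n \<noteq> 0" for n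
  proof -
    define x where "x = 2 * real_of_int \<bar>n\<bar> ^ 17"
    have n1: "1 \<le> \<bar>n\<bar>" using n by simp
    hence nr: "1 \<le> real_of_int \<bar>n\<bar>" by simp
    have "real_of_int \<bar>n\<bar> ^ 1 \<le> real_of_int \<bar>n\<bar> ^ 17" using nr by (intro power_increasing) auto
    hence nx: "real_of_int \<bar>n\<bar> \<le> x" using nr unfolding x_def by simp
    \<comment> \<open>A singleton has the property vacuously, so \<open>f_tilde x \<ge> 1\<close>
      and the additive constant \<open>C0\<close> can be turned into a factor.\<close>
    have "card {1 :: nat} \<le> f_tilde x"
      using nx nr n1 by (intro card_le_f_tilde[of n]) (auto simp: D_property_def)
    hence f1: "1 \<le> f_tilde x" by simp
    have "M_inf n \<le> enat (f_tilde x + C0)"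
    proof (rule M_inf_le)
      fix A assume A: "D_property n A"
      have "card {a \<in> A. int a \<le> 2 * \<bar>n\<bar> ^ 17} \<le> f_tilde x"
      proof (rule card_le_f_tilde[OF sub[OF A] n1 nx])
        show "{a \<in> A. int a \<le> 2 * \<bar>n\<bar> ^ 17} \<subseteq> {a. 1 \<le> a \<and> real a \<le> x}"
        proof
          fix a assume a: "a \<in> {a \<in> A. int a \<le> 2 * \<bar>n\<bar> ^ 17}"
          hence "real_of_int (int a) \<le> real_of_int (2 * \<bar>n\<bar> ^ 17)" by (simp only: of_int_le_iff mem_Collect_eq)
          thus "a \<in> {a. 1 \<le> a \<and> real a \<le> x}" using a A by (auto simp: x_def D_property_def)
        qed
      qed
      thus "finite A \<and> card A \<le> f_tilde x + C0" by (rule split[OF A n])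
    qed
    moreover have "real (f_tilde x + C0) \<le> (1 + real C0) * real (f_tilde x)"
    proof -
      have "real C0 * 1 \<le> real C0 * real (f_tilde x)" using f1 by (intro mult_left_mono) auto
      thus ?thesis by (simp add: algebra_simps)
    qed
    ultimately show ?thesis unfolding x_def[symmetric] by (rule ereal_M_inf_le)
  qed
  \<comment> \<open>\<open>7650 = 17 * 450\<close> and \<open>136 = 17 * 8\<close> result from
    inserting the bound for \<open>m^2\<close> into
    \<open>2 ^ (17 m^2) \<le> exp (17 m^2)\<close>.\<close>
  have part2: "ereal_of_enat (M_inf n) \<le> ereal ((1 + real C0) * exp 7650 * exp (136 * (ln (ln (real_of_int \<bar>n\<bar>))) ^ 2))"
    if n: "\<bar>n\<bar> \<ge> 2" for n
  proof -
    define N where "N = real_of_int \<bar>n\<bar>"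
    have "N \<ge> 2" using n unfolding N_def by linarith
    then obtain l m :: nat where lm: "l \<ge> 1" "N \<le> 2 ^ l" "1024 * l \<le> 2 ^ m" "m \<ge> 10" "(real m)\<^sup>2 \<le> 450 + 8 * (ln (ln N))\<^sup>2"
      by (rule log_scale_parameters)
    have "real_of_int \<bar>n\<bar> \<le> real_of_int (2 ^ l)" using lm(2) by (simp add: N_def)
    hence nl: "\<bar>n\<bar> \<le> 2 ^ l" by (simp only: of_int_le_iff)
    have n0: "n \<noteq> 0" using n by auto
    have "M_inf n \<le> enat (2 ^ (17 * m\<^sup>2) + C0)"
    proof (rule M_inf_le)
      fix A assume A: "D_property n A"
      have "card {a \<in> A. int a \<le> 2 * \<bar>n\<bar> ^ 17} \<le> 2 ^ (17 * m\<^sup>2)"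
      proof (rule small_elements_bound[OF sub[OF A] _ n0 nl lm(1,3,4)])
        show "{a \<in> A. int a \<le> 2 * \<bar>n\<bar> ^ 17} \<subseteq> {..2 ^ (17 * l + 1)}"
        proof
          fix a assume "a \<in> {a \<in> A. int a \<le> 2 * \<bar>n\<bar> ^ 17}"
          hence "int a \<le> 2 * \<bar>n\<bar> ^ 17" by simp
          also have "\<dots> \<le> 2 * (2 ^ l) ^ 17" using nl by (intro mult_left_mono power_mono) auto
          also have "\<dots> = int (2 ^ (17 * l + 1))" by (simp add: mult.commute flip: power_mult)
          finally show "a \<in> {..2 ^ (17 * l + 1)}" by (simp only: of_nat_le_iff atMost_iff)
        qed
      qed
      thus "finite A \<and> card A \<le> 2 ^ (17 * m\<^sup>2) + C0" by (rule split[OF A n0])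
    qed
    moreover have "real (2 ^ (17 * m\<^sup>2) + C0) \<le> (1 + real C0) * exp 7650 * exp (136 * (ln (ln N))\<^sup>2)"
    proof -
      define X where "X = exp 7650 * exp (136 * (ln (ln N))\<^sup>2)"
      have "(2::real) ^ (17 * m\<^sup>2) \<le> exp 1 ^ (17 * m\<^sup>2)" using exp_ge_add_one_self[of 1] by (intro power_mono) auto
      also have "\<dots> = exp (17 * (real m)\<^sup>2)" by (simp flip: exp_of_nat_mult)
      also have "\<dots> \<le> exp (7650 + 136 * (ln (ln N))\<^sup>2)" using lm(5) by simp
      finally have "2 ^ (17 * m\<^sup>2) \<le> X" by (simp add: X_def exp_add)
      moreover have "1 \<le> X"
        unfolding X_def exp_add[symmetric] by (simp only: one_le_exp_iff) (intro add_nonneg_nonneg mult_nonneg_nonneg; simp)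
      hence "real C0 * 1 \<le> real C0 * X" by (intro mult_left_mono) auto
      ultimately have "real (2 ^ (17 * m\<^sup>2) + C0) \<le> (1 + real C0) * X" by (simp add: distrib_right)
      thus ?thesis by (simp add: X_def mult.assoc)
    qed
    ultimately show ?thesis unfolding N_def[symmetric] by (rule ereal_M_inf_le)
  qed
  show ?thesis
  proof (intro conjI exI allI impI)
    fix n :: int assume "n \<noteq> 0"
    thus "ereal_of_enat (M_inf n) \<le> ereal ((1 + real C0) * real (f_tilde (2 * real_of_int \<bar>n\<bar> ^ 17)))" by (rule part1)
  next
    fix n :: int assume "\<bar>n\<bar> \<ge> 2"
    thus "ereal_of_enat (M_inf n) \<le> ereal ((1 + real C0) * exp 7650 * exp (136 * (ln (ln (real_of_int \<bar>n\<bar>))) ^ 2))" by (rule part2)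
  qed
qed

end
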